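(* Let $K\ge 1$ and $D\ge 1$ be integers and put $L=K+D$. Call a tuple of positive integers $(a_1,\ldots,a_K,b_1,\ldots,b_L)$ an integral factorial ratio if $a_1+\cdots+a_K=b_1+\cdots+b_L$, $a_i\neq b_j$ for all $i,j$, and $$\frac{(a_1 n)!\,(a_2 n)!\cdots (a_K n)!}{(b_1 n)!\,(b_2 n)!\cdots (b_L n)!}\in\mathbb{N}\quad\text{for all positive integers } n.$$ Then: 1. There is a function $\varepsilon(D)$ with $\varepsilon(D)\to 0$ as $D\to\infty$ such that no integral factorial ratio with $K$ numerator terms and $L=K+D$ denominator terms exists unless $$K+L\le (1+\varepsilon(D))\,\frac{18e^{2\gamma}}{\pi^2}\,D^2(\log\log(D+2))^2,$$ where $\gamma$ is Euler's constant. 2. For fixed $K$ and $D$, there are finitely many vector subspaces of $\mathbb{R}^{K+L}$, each of dimension at most $3D^2-1$, whose union contains every point $(a_1,\ldots,a_K,b_1,\ldots,b_L)$ corresponding to an integral factorial ratio. 3. If $D=2$, there are no integral factorial ratios with $K+L\ge 82$, and if $K+L\ge 76$ there are at most finitely many primitive ones (i.e. with $\gcd(a_1,\ldots,a_K,b_1,\ldots,b_L)=1$).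
   Context: $\mathbb{N}$ denotes the positive integers. A tuple is primitive if the gcd of all its entries is $1$. *)

theory Defs
  imports "HOL-Analysis.Analysis" "HOL-Analysis.Finite_Function_Topology"
begin

text \<open>The tuple \<open>(a\<^sub>1,\<dots>,a\<^sub>K,b\<^sub>1,\<dots>,b\<^sub>L)\<close> is the list \<open>as @ bs\<close> with \<open>length as = K\<close> and \<open>length bs = L\<close>.
  The set \<open>\<nat>\<close> of the library contains 0, but the quotient below is never 0, so
  membership says that it is a positive integer.\<close>

definition integral_factorial_ratio :: "nat \<Rightarrow> nat \<Rightarrow> nat list \<Rightarrow> nat list \<Rightarrow> bool" where
  "integral_factorial_ratio K L as bs \<longleftrightarrow>
     length as = K \<and> length bs = L \<and>
     (\<forall>a\<in>set as. a \<ge> 1) \<and> (\<forall>b\<in>set bs. b \<ge> 1) \<and>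
     sum_list as = sum_list bs \<and>
     (\<forall>a\<in>set as. \<forall>b\<in>set bs. a \<noteq> b) \<and>
     (\<forall>n\<ge>1. (\<Prod>a\<leftarrow>as. fact (a * n)) / (\<Prod>b\<leftarrow>bs. fact (b * n)) \<in> (\<nat> :: real set))"

definition primitive :: "nat list \<Rightarrow> bool" where
  "primitive xs \<longleftrightarrow> Gcd (set xs) = 1"

text \<open>\<open>\<real>\<^sup>m\<close> for a dimension \<open>m\<close> that may be quantified over: the finitely supported functions
  supported on \<open>{..<m}\<close>, inside the real vector space \<open>nat \<Rightarrow>\<^sub>0 real\<close>. Coordinate \<open>i\<close> of \<open>v\<close>
  is \<open>lookup v i\<close>, counted from 0.\<close>

definition coord_space :: "nat \<Rightarrow> (nat \<Rightarrow>\<^sub>0 real) set" where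
  "coord_space m = {v. Poly_Mapping.keys v \<subseteq> {..<m}}"

text \<open>\<open>Poly_Mapping.nth xs\<close> has the entries of \<open>xs\<close> as its leading coordinates, then zeros.\<close>

definition point_of :: "nat list \<Rightarrow> (nat \<Rightarrow>\<^sub>0 real)" where
  "point_of xs = Poly_Mapping.nth (map real xs)"

lemma subspace_coord_space: "subspace (coord_space m)"
  by (auto simp: subspace_def coord_space_def subset_iff in_keys_iff lookup_add
      scaleR_poly_mapping_def)
    (metis add.right_neutral)+

lemma point_of_in_coord_space: "point_of xs \<in> coord_space (length xs)"
  by (auto simp: point_of_def coord_space_def subset_iff in_keys_iff nth_default_def
      simp del: keys_nth split: if_splits)

end

theory Submission
  imports Defs "HOL-Computational_Algebra.Primes"
begin

text \<open>
  A tuple is encoded by the function \<open>f\<close> counting \<open>b\<^sub>j\<close> with sign \<open>+\<close> and \<open>a\<^sub>i\<close> with sign \<open>-\<close>; its mass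
  \<open>\<Sum>\<bar>f a\<bar>\<close> is \<open>K + L\<close>. By Landau's criterion the step function
  \<open>\<Sum>\<lfloor>a\<^sub>i x\<rfloor> - \<Sum>\<lfloor>b\<^sub>j x\<rfloor>\<close> takes generic values in \<open>[0, D]\<close>, so its deviation from \<open>D / 2\<close>, a
  combination of sawtooth functions, has small mean square. The correlation of the sawtooths at \<open>a\<close>
  and \<open>b\<close> is \<open>gcd(a, b)\<^sup>2 / (12 a b)\<close>, hence the energy
  \<open>E(f) = \<Sum> f(a) f(b) gcd(a, b)\<^sup>2 / (a b)\<close> is at most \<open>3 D\<^sup>2\<close>.

  The energy is bounded from below by cutting the support at a gap of the \<open>p\<close>-adic valuation. If
  \<open>f = g + h\<close> with valuations at most \<open>i\<close> on \<open>g\<close> and at least \<open>i + k\<close> on \<open>h\<close>, then with \<open>q = p\<^sup>k\<close>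
  \<open>E(f) = (1 - 1/q) (E(g) + E(h)) + E(m) / q\<close>, where \<open>m\<close> arises from \<open>g\<close> and the dilate of \<open>h\<close>
  by \<open>1/q\<close>, and the mass of \<open>m\<close> is at least the difference of the masses of \<open>g\<close> and \<open>h\<close>. A bound
  \<open>G(mass f) \<le> E(f)\<close> follows by induction as soon as \<open>G\<close> satisfies the corresponding inequality.
  For primes \<open>p \<ge> y\<close> this holds for \<open>G(n) = n\<^sup>\<theta>\<close> with \<open>2\<^sup>1\<^sup>-\<^sup>\<theta> (1 - 1/y) = 1\<close>, while every
  smaller prime costs a factor \<open>(p - 1) / (p + 1)\<close>; with \<open>y\<close> slightly larger than \<open>log D\<close>, Mertens'
  third theorem gives the asymptotic bound. For \<open>D = 2\<close> the recursion is solved numerically.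
  Finally, cutting at all large gaps writes \<open>f\<close> as a sum of nearly orthogonal pieces, each a multiple
  of one of finitely many shapes and of energy at least 1, and of energy at least 1.3 if the piece
  itself is balanced. So there are at most \<open>3 D\<^sup>2\<close> pieces, and if there are that many, then some
  piece is unbalanced and the relation \<open>\<Sum> a\<^sub>i = \<Sum> b\<^sub>j\<close> lowers the dimension by one.
\<close>

section \<open>The energy of a signed multiset\<close>

text \<open>A cut is useful because dividing the upper part of the support by q multiplies every
  cross term by q and changes nothing else. Cancellation is the obstacle: only the mass j of m is
  controlled, by |a - b| \<le> j \<le> a + b and a parity, so G must survive the worst j. Moreover m
  can have the full mass of f, so the induction runs on the sum of |f(a)| a, which decreases for g,
  h and m. Primes are separated because no single exponent close to 1 works for the small ones. An
  exponent \<theta> loses the factor n^(1-\<theta>), where 1 - \<theta> is about 1/(y ln 2) and n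
  about D^2; so y has to outgrow log D, but with log y still asymptotic to log log D, since the
  primes below y cost the product of (p + 1)/(p - 1), about (6 e^(2 gamma)/pi^2) (log y)^2. Together
  with 3 D^2 = 12 (D/2)^2 this gives the constant 18 = 3 * 6. For D = 2 the energy is at most 12.
  The mass is even, and 82 is the first even mass with numerical bound above 12; for 76, 78 and 80
  the bounds of the two parts of any cut add up to more than 12.\<close>

definition supp :: "(nat \<Rightarrow> int) \<Rightarrow> nat set" where
  "supp f = {a. f a \<noteq> 0}"

definition kern :: "nat \<Rightarrow> nat \<Rightarrow> real" where
  "kern a b = (real (gcd a b))\<^sup>2 / (real a * real b)"

definition form :: "(nat \<Rightarrow> int) \<Rightarrow> (nat \<Rightarrow> int) \<Rightarrow> real" where
  "form f g = (\<Sum>a\<in>supp f. \<Sum>b\<in>supp g. real_of_int (f a) * real_of_int (g b) * kern a b)"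

definition energy :: "(nat \<Rightarrow> int) \<Rightarrow> real" where
  "energy f = form f f"

definition mass :: "(nat \<Rightarrow> int) \<Rightarrow> nat" where
  "mass f = (\<Sum>a\<in>supp f. nat \<bar>f a\<bar>)"

definition weight :: "(nat \<Rightarrow> int) \<Rightarrow> nat" where
  "weight f = (\<Sum>a\<in>supp f. nat \<bar>f a\<bar> * a)"

definition admissible :: "(nat \<Rightarrow> int) \<Rightarrow> bool" where
  "admissible f \<longleftrightarrow> finite (supp f) \<and> f 0 = 0"

definition restr :: "(nat \<Rightarrow> int) \<Rightarrow> nat set \<Rightarrow> nat \<Rightarrow> int" where
  "restr f A a = (if a \<in> A then f a else 0)"

text \<open>The dilate by 1/q. Values at non-multiples of q are lost, so the invariance lemmas
  assume that q divides the whole support.\<close>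

definition shift :: "nat \<Rightarrow> (nat \<Rightarrow> int) \<Rightarrow> nat \<Rightarrow> int" where
  "shift q f a = f (a * q)"

lemma kern_sym: "kern a b = kern b a"
  by (simp add: kern_def gcd.commute mult.commute)

lemma admissible_pos: "admissible f \<Longrightarrow> a \<in> supp f \<Longrightarrow> a > 0"
  by (cases a) (auto simp: admissible_def supp_def)

lemma form_superset:
  assumes "finite A" "finite B" "supp f \<subseteq> A" "supp g \<subseteq> B"
  shows "form f g = (\<Sum>a\<in>A. \<Sum>b\<in>B. real_of_int (f a) * real_of_int (g b) * kern a b)"
proof -
  have "(\<Sum>b\<in>supp g. real_of_int (f a) * real_of_int (g b) * kern a b)
      = (\<Sum>b\<in>B. real_of_int (f a) * real_of_int (g b) * kern a b)" for a
    by (rule sum.mono_neutral_left) (use assms in \<open>auto simp: supp_def\<close>)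
  then have "form f g = (\<Sum>a\<in>supp f. \<Sum>b\<in>B. real_of_int (f a) * real_of_int (g b) * kern a b)"
    by (simp add: form_def)
  also have "\<dots> = (\<Sum>a\<in>A. \<Sum>b\<in>B. real_of_int (f a) * real_of_int (g b) * kern a b)"
    by (rule sum.mono_neutral_left) (use assms in \<open>auto simp: supp_def\<close>)
  finally show ?thesis .
qed

lemma form_sym: "form f g = form g f"
  unfolding form_def by (subst sum.swap) (simp add: kern_sym mult.commute)

lemma supp_add: "supp (\<lambda>a. f a + g a) \<subseteq> supp f \<union> supp g"
  by (auto simp: supp_def)

lemma form_add_left:
  assumes "finite (supp f)" "finite (supp g)" "finite (supp h)"
  shows "form (\<lambda>a. f a + g a) h = form f h + form g h"
proof -
  let ?A = "supp f \<union> supp g" and ?B = "supp h"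
  have "form (\<lambda>a. f a + g a) h = (\<Sum>a\<in>?A. \<Sum>b\<in>?B. real_of_int (f a + g a) * real_of_int (h b) * kern a b)"
    by (rule form_superset) (use assms supp_add in auto)
  also have "\<dots> = (\<Sum>a\<in>?A. \<Sum>b\<in>?B. real_of_int (f a) * real_of_int (h b) * kern a b)
      + (\<Sum>a\<in>?A. \<Sum>b\<in>?B. real_of_int (g a) * real_of_int (h b) * kern a b)"
    by (simp add: sum.distrib[symmetric] algebra_simps)
  also have "\<dots> = form f h + form g h"
    using assms by (simp add: form_superset[of ?A ?B])
  finally show ?thesis .
qed

lemma energy_add:
  assumes "finite (supp f)" "finite (supp g)"
  shows "energy (\<lambda>a. f a + g a) = energy f + energy g + 2 * form f g"
proof -
  have fin: "finite (supp (\<lambda>a. f a + g a))"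
    using assms supp_add finite_subset by blast
  have "energy (\<lambda>a. f a + g a) = form f (\<lambda>a. f a + g a) + form g (\<lambda>a. f a + g a)"
    unfolding energy_def using assms fin by (simp add: form_add_left)
  also have "\<dots> = form (\<lambda>a. f a + g a) f + form (\<lambda>a. f a + g a) g"
    using form_sym[of f "\<lambda>a. f a + g a"] form_sym[of g "\<lambda>a. f a + g a"] by simp
  also have "\<dots> = energy f + energy g + 2 * form f g"
    using assms form_sym[of g f] by (simp add: form_add_left energy_def)
  finally show ?thesis .
qed

lemma supp_restr: "supp (restr f A) = supp f \<inter> A"
  by (auto simp: supp_def restr_def)

lemma admissible_restr: "admissible f \<Longrightarrow> admissible (restr f A)"
  by (auto simp: admissible_def supp_restr restr_def)

lemma shift_image:
  assumes "q > 0" "\<forall>b\<in>supp g. q dvd b"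
  shows "supp g = (\<lambda>x. x * q) ` supp (shift q g)"
proof -
  have "b \<in> (\<lambda>x. x * q) ` supp (shift q g)" if "b \<in> supp g" for b
  proof
    show "b = (b div q) * q" using assms that by simp
    show "b div q \<in> supp (shift q g)" using assms that by (simp add: supp_def shift_def)
  qed
  then show ?thesis by (auto simp: supp_def shift_def)
qed

lemma inj_mult_right: "(q::nat) > 0 \<Longrightarrow> inj_on (\<lambda>x. x * q) A"
  by (auto simp: inj_on_def)

lemma admissible_shift:
  assumes "q > 0" "admissible g"
  shows "admissible (shift q g)"
proof -
  have "(\<lambda>x. x * q) ` supp (shift q g) \<subseteq> supp g" by (auto simp: supp_def shift_def)
  then have "finite ((\<lambda>x. x * q) ` supp (shift q g))"
    using assms by (auto simp: admissible_def intro: finite_subset)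
  then have "finite (supp (shift q g))"
    using inj_mult_right[OF assms(1)] finite_imageD by blast
  then show ?thesis using assms by (simp add: admissible_def shift_def)
qed

lemma sum_shift:
  assumes "q > 0" "\<forall>b\<in>supp g. q dvd b"
  shows "sum F (supp g) = (\<Sum>x\<in>supp (shift q g). F (x * q))"
proof -
  have "sum F (supp g) = sum F ((\<lambda>x. x * q) ` supp (shift q g))"
    using shift_image[OF assms] by simp
  then show ?thesis by (simp add: sum.reindex[OF inj_mult_right[OF assms(1)]])
qed

lemma mass_shift:
  assumes "q > 0" "\<forall>b\<in>supp g. q dvd b"
  shows "mass (shift q g) = mass g"
  unfolding mass_def sum_shift[OF assms] by (simp add: shift_def)

lemma weight_shift:
  assumes "q > 0" "\<forall>b\<in>supp g. q dvd b"
  shows "weight g = weight (shift q g) * q"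
proof -
  have "weight g = (\<Sum>x\<in>supp (shift q g). nat \<bar>g (x * q)\<bar> * (x * q))"
    unfolding weight_def by (rule sum_shift[OF assms])
  then show ?thesis
    by (simp add: weight_def shift_def sum_distrib_right mult.assoc)
qed

lemma kern_mult: "q > 0 \<Longrightarrow> kern (a * q) (b * q) = kern a b"
  by (simp add: kern_def gcd_mult_distrib_nat[symmetric] mult.commute[of _ q] power2_eq_square)

lemma energy_shift:
  assumes "q > 0" "\<forall>b\<in>supp g. q dvd b"
  shows "energy (shift q g) = energy g"
proof -
  let ?S = "supp (shift q g)"
  have "energy g = (\<Sum>a\<in>?S. \<Sum>b\<in>?S. real_of_int (g (a*q)) * real_of_int (g (b*q)) * kern (a*q) (b*q))"
    unfolding energy_def form_def by (simp add: sum_shift[OF assms])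
  then show ?thesis
    using assms by (simp add: energy_def form_def shift_def kern_mult)
qed

lemma mass_superset:
  assumes "finite A" "supp f \<subseteq> A"
  shows "mass f = (\<Sum>a\<in>A. nat \<bar>f a\<bar>)"
  unfolding mass_def by (rule sum.mono_neutral_left) (use assms in \<open>auto simp: supp_def\<close>)

lemma weight_superset:
  assumes "finite A" "supp f \<subseteq> A"
  shows "weight f = (\<Sum>a\<in>A. nat \<bar>f a\<bar> * a)"
  unfolding weight_def by (rule sum.mono_neutral_left) (use assms in \<open>auto simp: supp_def\<close>)

lemma mass_restr_split:
  assumes "admissible f"
  shows "mass (restr f A) + mass (restr f (-A)) = mass f"
proof -
  have fin: "finite (supp f)" using assms by (simp add: admissible_def)
  have "mass (restr f A) + mass (restr f (-A))
      = (\<Sum>a\<in>supp f. nat \<bar>restr f A a\<bar> + nat \<bar>restr f (-A) a\<bar>)"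
    using fin by (simp add: mass_superset[of "supp f"] supp_restr sum.distrib)
  also have "\<dots> = mass f" unfolding mass_def by (rule sum.cong) (auto simp: restr_def)
  finally show ?thesis .
qed

lemma weight_restr_split:
  assumes "admissible f"
  shows "weight (restr f A) + weight (restr f (-A)) = weight f"
proof -
  have fin: "finite (supp f)" using assms by (simp add: admissible_def)
  have "weight (restr f A) + weight (restr f (-A))
      = (\<Sum>a\<in>supp f. nat \<bar>restr f A a\<bar> * a + nat \<bar>restr f (-A) a\<bar> * a)"
    using fin by (simp add: weight_superset[of "supp f"] supp_restr sum.distrib)
  also have "\<dots> = weight f" unfolding weight_def by (rule sum.cong) (auto simp: restr_def)
  finally show ?thesis .
qed

lemma mass_pos: "admissible f \<Longrightarrow> supp f \<noteq> {} \<Longrightarrow> mass f > 0"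
  unfolding mass_def admissible_def by (intro sum_pos) (auto simp: supp_def)

lemma weight_pos: "admissible f \<Longrightarrow> supp f \<noteq> {} \<Longrightarrow> weight f > 0"
  unfolding weight_def using admissible_pos[of f]
  by (intro sum_pos) (simp_all add: admissible_def supp_def)

lemma mass_eq_0: "admissible f \<Longrightarrow> mass f = 0 \<longleftrightarrow> supp f = {}"
  using mass_pos[of f] by (cases "supp f = {}") (auto simp: mass_def)

text \<open>Pointwise, |x + y| lies between the difference and the sum of |x| and |y| and has the
  parity of the sum. This is all that the bounds ever use about cancellation in a merged
  function.\<close>

lemma mass_add:
  assumes "finite (supp f)" "finite (supp g)"
  shows "mass (\<lambda>a. f a + g a) \<le> mass f + mass g"
    and "mass f \<le> mass (\<lambda>a. f a + g a) + mass g"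
    and "mass g \<le> mass (\<lambda>a. f a + g a) + mass f"
    and "even (mass (\<lambda>a. f a + g a) + mass f + mass g)"
proof -
  let ?A = "supp f \<union> supp g"
  have *: "finite ?A" "supp f \<subseteq> ?A" "supp g \<subseteq> ?A" "supp (\<lambda>a. f a + g a) \<subseteq> ?A"
    using assms supp_add by auto
  note m = mass_superset[OF *(1,2)] mass_superset[OF *(1,3)] mass_superset[OF *(1,4)]
  show "mass (\<lambda>a. f a + g a) \<le> mass f + mass g"
    unfolding m sum.distrib[symmetric] by (rule sum_mono) auto
  show "mass f \<le> mass (\<lambda>a. f a + g a) + mass g"
    unfolding m sum.distrib[symmetric] by (rule sum_mono) auto
  show "mass g \<le> mass (\<lambda>a. f a + g a) + mass f"
    unfolding m sum.distrib[symmetric] by (rule sum_mono) auto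
  show "even (mass (\<lambda>a. f a + g a) + mass f + mass g)"
    unfolding m sum.distrib[symmetric]
    by (rule dvd_sum) (auto simp: even_nat_iff)
qed

lemma weight_add:
  assumes "finite (supp f)" "finite (supp g)"
  shows "weight (\<lambda>a. f a + g a) \<le> weight f + weight g"
proof -
  let ?A = "supp f \<union> supp g"
  have *: "finite ?A" "supp f \<subseteq> ?A" "supp g \<subseteq> ?A" "supp (\<lambda>a. f a + g a) \<subseteq> ?A"
    using assms supp_add by auto
  note m = weight_superset[OF *(1,2)] weight_superset[OF *(1,3)] weight_superset[OF *(1,4)]
  show "weight (\<lambda>a. f a + g a) \<le> weight f + weight g"
    unfolding m sum.distrib[symmetric] distrib_right[symmetric]
    by (intro sum_mono mult_right_mono) auto
qed

section \<open>Cutting the support at a gap of a valuation\<close>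

definition merge :: "nat \<Rightarrow> nat set \<Rightarrow> (nat \<Rightarrow> int) \<Rightarrow> nat \<Rightarrow> int" where
  "merge q A f = (\<lambda>a. restr f A a + shift q (restr f (-A)) a)"

text \<open>For a in A and b = b' q outside A the gcd hypothesis gives \<open>kern a b\<close> =
  \<open>kern a b'\<close> / q, while dilation preserves energies. With F =
  \<open>form ?g ?h\<close> the energies of f and of the merged function are therefore E(g) + E(h) +
  2F and E(g) + E(h) + 2qF, and eliminating F gives the claim.\<close>

lemma cut_energy:
  assumes f: "admissible f" and q: "q > 0"
    and dvd: "\<And>b. b \<in> supp f - A \<Longrightarrow> q dvd b"
    and gcd: "\<And>a b. a \<in> supp f \<inter> A \<Longrightarrow> b \<in> supp f - A \<Longrightarrow> gcd a b = gcd a (b div q)"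
  shows "energy f = (1 - 1 / q) * (energy (restr f A) + energy (restr f (-A)))
           + 1 / q * energy (merge q A f)"
proof -
  let ?g = "restr f A" and ?h = "restr f (-A)"
  let ?S = "supp (shift q ?h)"
  have fin: "finite (supp ?g)" "finite (supp ?h)" "finite ?S"
    using f admissible_restr admissible_shift[OF q] by (auto simp: admissible_def)
  have d: "\<forall>b\<in>supp ?h. q dvd b" using dvd by (auto simp: supp_restr)
  have "f = (\<lambda>a. ?g a + ?h a)" by (auto simp: restr_def)
  then have "energy f = energy (\<lambda>a. ?g a + ?h a)" by simp
  also have "\<dots> = energy ?g + energy ?h + 2 * form ?g ?h"
    using fin by (intro energy_add)
  finally have 1: "energy f = energy ?g + energy ?h + 2 * form ?g ?h" .
  have 2: "energy (merge q A f) = energy ?g + energy ?h + 2 * form ?g (shift q ?h)"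
    unfolding merge_def using fin by (subst energy_add) (simp_all add: energy_shift[OF q d])
  have k: "real q * kern a (b * q) = kern a b" if "a \<in> supp ?g" "b \<in> ?S" for a b
  proof -
    have "b * q \<in> supp ?h" using that by (auto simp: supp_def shift_def)
    then have "gcd a (b * q) = gcd a b" using gcd[of a "b * q"] that q by (auto simp: supp_restr)
    then show ?thesis using q by (simp add: kern_def field_simps)
  qed
  have "form ?g ?h = (\<Sum>a\<in>supp ?g. \<Sum>b\<in>?S. real_of_int (?g a) * real_of_int (?h (b*q)) * kern a (b*q))"
    unfolding form_def by (simp add: sum_shift[OF q d])
  then have "real q * form ?g ?h
      = (\<Sum>a\<in>supp ?g. \<Sum>b\<in>?S. real_of_int (?g a) * real_of_int (?h (b*q)) * (real q * kern a (b*q)))"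
    by (simp add: sum_distrib_left mult_ac)
  also have "\<dots> = (\<Sum>a\<in>supp ?g. \<Sum>b\<in>?S. real_of_int (?g a) * real_of_int (?h (b*q)) * kern a b)"
    by (intro sum.cong refl) (simp add: k)
  also have "\<dots> = form ?g (shift q ?h)" by (simp add: form_def shift_def)
  finally have 3: "real q * form ?g ?h = form ?g (shift q ?h)" .
  show ?thesis using q unfolding 1 2 3[symmetric] by (simp add: field_simps)
qed

text \<open>At p both gcds have the valuation of a, since b keeps at least that much after the
  division; the other primes do not see \<open>p ^ k\<close>.\<close>

lemma gcd_div_prime_power:
  fixes a b p :: nat
  assumes p: "prime p" and ab: "a > 0" "b > 0"
    and le: "multiplicity p a + k \<le> multiplicity p b"
  shows "p ^ k dvd b" and "gcd a b = gcd a (b div p ^ k)"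
proof -
  show d: "p ^ k dvd b" by (meson le le_add2 le_trans multiplicity_dvd')
  define v where "v = multiplicity p a"
  obtain a' where a': "a = p ^ v * a'" "\<not> p dvd a'"
    using multiplicity_decompose'[of a p] ab p v_def by (metis not_gr0 not_prime_unit)
  have "p ^ (v + k) dvd b" using le v_def by (metis multiplicity_dvd')
  then obtain b' where b': "b = p ^ (v + k) * b'" by auto
  have c: "coprime a' (p ^ k)" using a' p
    by (metis coprime_commute coprime_power_right_iff prime_imp_coprime)
  have q: "p ^ k > 0" using p prime_gt_0_nat by simp
  have "b div p ^ k = p ^ v * b'" using q unfolding b' by (simp add: power_add mult.assoc mult.left_commute)
  moreover have "gcd a b = p ^ v * gcd a' (p ^ k * b')"
    unfolding a'(1) b' power_add mult.assoc by (simp add: gcd_mult_distrib_nat)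
  moreover have "gcd a' (p ^ k * b') = gcd a' b'"
    by (rule gcd_mult_right_left_cancel[OF c])
  ultimately show "gcd a b = gcd a (b div p ^ k)"
    using a'(1) by (simp add: gcd_mult_distrib_nat)
qed

text \<open>Everything the recursions need about one cut. The weight of m drops because the nonempty
  upper part is divided by \<open>p ^ k\<close> > 1, even when its mass equals that of f.\<close>

lemma cut:
  assumes f: "admissible f" and p: "prime p" and k: "k > 0"
    and A: "\<And>a b. a \<in> supp f \<inter> A \<Longrightarrow> b \<in> supp f - A \<Longrightarrow> multiplicity p a + k \<le> multiplicity p b"
    and ne: "supp f \<inter> A \<noteq> {}" "supp f - A \<noteq> {}"
  defines "g \<equiv> restr f A" and "h \<equiv> restr f (-A)" and "m \<equiv> merge (p ^ k) A f"
  shows "admissible g" "admissible h" "admissible m"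
    "energy f = (1 - 1 / real p ^ k) * (energy g + energy h) + 1 / real p ^ k * energy m"
    "mass g > 0" "mass h > 0" "mass g + mass h = mass f"
    "mass m \<le> mass f" "mass g \<le> mass m + mass h" "mass h \<le> mass m + mass g"
    "even (mass m + mass f)"
    "weight g < weight f" "weight h < weight f" "weight m < weight f"
proof -
  let ?q = "p ^ k"
  have q: "?q > 0" "?q > 1" using p k prime_gt_1_nat[OF p] one_less_power[of p k] by auto
  obtain a0 where a0: "a0 \<in> supp f \<inter> A" using ne by blast
  have dg: "?q dvd b" "gcd a b = gcd a (b div ?q)" if "b \<in> supp f - A" "a \<in> supp f \<inter> A" for a b
    using gcd_div_prime_power[OF p, of a b k] A[of a b] that admissible_pos[OF f] by auto
  show ag: "admissible g" and ah: "admissible h"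
    using f by (auto simp: g_def h_def admissible_restr)
  have d: "\<forall>b\<in>supp h. ?q dvd b" using dg(1)[OF _ a0] by (auto simp: h_def supp_restr)
  have as: "admissible (shift ?q h)" using admissible_shift[OF q(1) ah] .
  have fin: "finite (supp g)" "finite (supp (shift ?q h))" using ag as by (auto simp: admissible_def)
  have mm: "m = (\<lambda>a. g a + shift ?q h a)" by (simp add: m_def merge_def g_def h_def)
  show "admissible m"
    using ag as finite_subset[OF supp_add[of g "shift ?q h"]] by (auto simp: mm admissible_def)
  have "energy f = (1 - 1 / real ?q) * (energy g + energy h) + 1 / real ?q * energy m"
    unfolding g_def h_def m_def
    by (rule cut_energy[OF f q(1)]) (use dg a0 in blast)+
  then show "energy f = (1 - 1 / real p ^ k) * (energy g + energy h) + 1 / real p ^ k * energy m" by simp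
  have sg: "supp g \<noteq> {}" "supp h \<noteq> {}" using ne by (auto simp: g_def h_def supp_restr)
  show mg: "mass g > 0" "mass h > 0" using mass_pos ag ah sg by auto
  show ms: "mass g + mass h = mass f" unfolding g_def h_def by (rule mass_restr_split[OF f])
  note ma = mass_add[OF fin, folded mm, unfolded mass_shift[OF q(1) d]]
  show "mass m \<le> mass f" "mass g \<le> mass m + mass h" "mass h \<le> mass m + mass g"
    using ma ms by (auto simp: add_ac)
  show "even (mass m + mass f)" using ma(4) by (simp only: add.assoc ms)
  have ws: "weight g + weight h = weight f" unfolding g_def h_def by (rule weight_restr_split[OF f])
  have wp: "weight g > 0" "weight h > 0" using weight_pos ag ah sg by auto
  show "weight g < weight f" "weight h < weight f" using ws wp by auto
  have "weight m \<le> weight g + weight (shift ?q h)" using weight_add[OF fin] by (simp add: mm)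
  moreover have wh: "weight h = weight (shift ?q h) * ?q" by (rule weight_shift[OF q(1) d])
  moreover have "weight (shift ?q h) < weight (shift ?q h) * ?q"
    using wh wp(2) q(2) by (intro n_less_n_mult_m) auto
  ultimately show "weight m < weight f" using ws by linarith
qed

lemma supp_merge:
  assumes "x \<in> supp (merge q A f)"
  shows "x \<in> supp f \<or> x * q \<in> supp f"
  using assms by (auto simp: supp_def merge_def restr_def shift_def split: if_splits)

section \<open>Functions whose valuations vary at few primes\<close>

definition varies_in :: "nat set \<Rightarrow> (nat \<Rightarrow> int) \<Rightarrow> bool" where
  "varies_in Q f \<longleftrightarrow> (\<forall>p. prime p \<longrightarrow> p \<notin> Q \<longrightarrow>
     (\<forall>a\<in>supp f. \<forall>b\<in>supp f. multiplicity p a = multiplicity p b))"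

lemma varies_in_UNIV [simp]: "varies_in UNIV f"
  by (simp add: varies_in_def)

lemma varies_in_restr: "varies_in Q f \<Longrightarrow> varies_in Q (restr f A)"
  by (auto simp: varies_in_def supp_restr)

text \<open>A prime r outside Q differs from p, so division by \<open>p ^ k\<close> leaves r-adic
  valuations alone.\<close>

lemma varies_in_merge:
  assumes f: "admissible f" and v: "varies_in Q f" and p: "prime p" "p \<in> Q"
  shows "varies_in Q (merge (p ^ k) A f)"
  unfolding varies_in_def
proof (intro allI impI ballI)
  fix r a b assume r: "prime r" "r \<notin> Q"
    and ab: "a \<in> supp (merge (p ^ k) A f)" "b \<in> supp (merge (p ^ k) A f)"
  have *: "\<exists>y\<in>supp f. multiplicity r x = multiplicity r y"
    if "x \<in> supp (merge (p ^ k) A f)" for x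
  proof (cases "x \<in> supp f")
    case False
    then have y: "x * p ^ k \<in> supp f" using supp_merge[OF that] by blast
    have "x * p ^ k > 0" using admissible_pos[OF f y] .
    moreover have "multiplicity r (p ^ k) = 0"
      using p r by (metis multiplicity_distinct_prime_power)
    ultimately have "multiplicity r (x * p ^ k) = multiplicity r x"
      using r by (subst prime_elem_multiplicity_mult_distrib) auto
    then show ?thesis using y by metis
  qed auto
  show "multiplicity r a = multiplicity r b"
    using *[OF ab(1)] *[OF ab(2)] v r unfolding varies_in_def by metis
qed

text \<open>Constant valuations at all primes force a single support point, where
  \<open>kern\<close> is 1. This is the start of every recursion.\<close>

lemma varies_in_empty:
  assumes f: "admissible f" and v: "varies_in {} f" and ne: "supp f \<noteq> {}"
  obtains a where "supp f = {a}" "mass f = nat \<bar>f a\<bar>" "energy f = (real (mass f))\<^sup>2"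
proof -
  obtain a where a: "a \<in> supp f" using ne by blast
  have "b = a" if b: "b \<in> supp f" for b
  proof (rule multiplicity_eq_nat)
    show "a > 0" "b > 0" using admissible_pos[OF f] a b by auto
    show "multiplicity p b = multiplicity p a" if "prime p" for p
      using v a b that unfolding varies_in_def by fast
  qed
  then have s: "supp f = {a}" using a by blast
  have "kern a a = 1" using admissible_pos[OF f a] by (simp add: kern_def power2_eq_square)
  then show ?thesis using s
    by (intro that[of a]) (auto simp: mass_def energy_def form_def power2_eq_square)
qed

lemma energy_empty: "supp f = {} \<Longrightarrow> energy f = 0"
  by (simp add: energy_def form_def)

text \<open>A is the layer of minimal valuation. Constancy of the valuation on A, the last
  conclusion, lets the better bound without p be applied to that layer.\<close>

lemma not_constant_cut:
  assumes f: "admissible f" and p: "prime p"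
    and ab: "a \<in> supp f" "b \<in> supp f" "multiplicity p a \<noteq> multiplicity p b"
  obtains A where "\<And>a b. a \<in> supp f \<inter> A \<Longrightarrow> b \<in> supp f - A \<Longrightarrow> multiplicity p a + 1 \<le> multiplicity p b"
    "supp f \<inter> A \<noteq> {}" "supp f - A \<noteq> {}"
    "\<And>a b. a \<in> supp f \<inter> A \<Longrightarrow> b \<in> supp f \<inter> A \<Longrightarrow> multiplicity p a = multiplicity p b"
proof -
  have fin: "finite (supp f)" using f by (simp add: admissible_def)
  define v where "v = Min (multiplicity p ` supp f)"
  have v: "v \<le> multiplicity p x" if "x \<in> supp f" for x
    using that fin by (simp add: v_def)
  have "v \<in> multiplicity p ` supp f" unfolding v_def by (rule Min_in) (use fin ab in auto)
  then obtain c where c: "c \<in> supp f" "multiplicity p c = v" by auto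
  show ?thesis
  proof (rule that[of "{x. multiplicity p x = v}"])
    show "supp f - {x. multiplicity p x = v} \<noteq> {}" using ab by auto
    show "supp f \<inter> {x. multiplicity p x = v} \<noteq> {}" using c by auto
    show "multiplicity p a + 1 \<le> multiplicity p b"
      if "a \<in> supp f \<inter> {x. multiplicity p x = v}" "b \<in> supp f - {x. multiplicity p x = v}" for a b
      using that v[of b] by auto
  qed auto
qed

text \<open>The lowest p-adic layer no longer varies at p and so satisfies the bound g; the rest and
  the merged function may still vary at p, have smaller \<open>weight\<close>, and satisfy G by
  induction. The cut is always made with k = 1. A cut never increases the mass, so the cap M on
  masses is preserved and finite tables can be used.\<close>

lemma lower_bound_insert_prime:
  fixes g G :: "nat \<Rightarrow> real"
  assumes p: "prime p"
    and base: "\<And>f. admissible f \<Longrightarrow> varies_in Q f \<Longrightarrow> mass f \<le> M \<Longrightarrow> g (mass f) \<le> energy f"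
    and le: "\<And>n. n \<le> M \<Longrightarrow> G n \<le> g n"
    and step: "\<And>a b j. \<lbrakk>a > 0; b > 0; a + b \<le> M; a \<le> j + b; b \<le> j + a; j \<le> a + b; even (j + a + b)\<rbrakk>
        \<Longrightarrow> G (a + b) \<le> (1 - 1 / p) * (g a + G b) + 1 / p * G j"
  shows "admissible f \<Longrightarrow> varies_in (insert p Q) f \<Longrightarrow> mass f \<le> M \<Longrightarrow> G (mass f) \<le> energy f"
proof (induction "weight f" arbitrary: f rule: less_induct)
  case less
  note f = less.prems(1) and v = less.prems(2) and M = less.prems(3)
  show ?case
  proof (cases "\<exists>a\<in>supp f. \<exists>b\<in>supp f. multiplicity p a \<noteq> multiplicity p b")
    case False
    then have "varies_in Q f" using v unfolding varies_in_def by blast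
    then show ?thesis using base[OF f] le[OF M] M by fastforce
  next
    case True
    then obtain A where A: "\<And>a b. a \<in> supp f \<inter> A \<Longrightarrow> b \<in> supp f - A \<Longrightarrow> multiplicity p a + 1 \<le> multiplicity p b"
      "supp f \<inter> A \<noteq> {}" "supp f - A \<noteq> {}"
      "\<And>a b. a \<in> supp f \<inter> A \<Longrightarrow> b \<in> supp f \<inter> A \<Longrightarrow> multiplicity p a = multiplicity p b"
      using not_constant_cut[OF f p] by metis
    define g' h m where "g' = restr f A" and "h = restr f (-A)" and "m = merge (p ^ 1) A f"
    note c = cut[OF f p zero_less_one A(1-3), folded g'_def h_def m_def]
    have ev: "even (mass m + mass g' + mass h)" using c(7,11) by presburger
    have p0: "real p > 1" using prime_gt_1_nat[OF p] by simp
    have "varies_in Q g'"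
      using v A(4) unfolding varies_in_def g'_def supp_restr by (metis Int_iff insert_iff)
    then have 1: "g (mass g') \<le> energy g'" using base[OF c(1)] c(7) M by linarith
    have 2: "G (mass h) \<le> energy h"
      using less.hyps[OF c(13) c(2)] varies_in_restr[OF v] c(7) M by (simp add: h_def)
    have "varies_in (insert p Q) m" unfolding m_def by (rule varies_in_merge[OF f v p]) simp
    then have 3: "G (mass m) \<le> energy m"
      using less.hyps[OF c(14) c(3)] c(8) M by simp
    have "G (mass f) \<le> (1 - 1 / p) * (g (mass g') + G (mass h)) + 1 / p * G (mass m)"
      using step[OF c(5,6) _ _ _ _ ev] c(7-10) M by (simp add: add.commute)
    also have "\<dots> \<le> (1 - 1 / p) * (energy g' + energy h) + 1 / p * energy m"
      using p0 1 2 3 by (intro add_mono mult_left_mono) auto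
    also have "\<dots> = energy f" using c(4) by simp
    finally show ?thesis .
  qed
qed

text \<open>One G for all primes outside Q means no loss per prime, so infinitely many primes are
  treated in a single induction that cuts at any prime where f still varies.\<close>

lemma lower_bound_all_primes:
  fixes G :: "nat \<Rightarrow> real"
  assumes base: "\<And>f. admissible f \<Longrightarrow> varies_in Q f \<Longrightarrow> G (mass f) \<le> energy f"
    and step: "\<And>p a b j. \<lbrakk>prime p; p \<in> R - Q; a > 0; b > 0; a \<le> j + b; b \<le> j + a; j \<le> a + b; even (j + a + b)\<rbrakk>
        \<Longrightarrow> G (a + b) \<le> (1 - 1 / p) * (G a + G b) + 1 / p * G j"
  shows "admissible f \<Longrightarrow> varies_in R f \<Longrightarrow> G (mass f) \<le> energy f"
proof (induction "weight f" arbitrary: f rule: less_induct)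
  case less
  note f = less.prems(1) and v = less.prems(2)
  show ?case
  proof (cases "varies_in Q f")
    case True
    then show ?thesis using base f by blast
  next
    case False
    then obtain p a b where p: "prime p" "p \<notin> Q" and
      ab: "a \<in> supp f" "b \<in> supp f" "multiplicity p a \<noteq> multiplicity p b"
      unfolding varies_in_def by blast
    have pR: "p \<in> R" using p ab v unfolding varies_in_def by blast
    obtain A where A: "\<And>a b. a \<in> supp f \<inter> A \<Longrightarrow> b \<in> supp f - A \<Longrightarrow> multiplicity p a + 1 \<le> multiplicity p b"
      "supp f \<inter> A \<noteq> {}" "supp f - A \<noteq> {}"
      using not_constant_cut[OF f p(1) ab] by metis
    define g' h m where "g' = restr f A" and "h = restr f (-A)" and "m = merge (p ^ 1) A f"
    note c = cut[OF f p(1) zero_less_one A(1-3), folded g'_def h_def m_def]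
    have ev: "even (mass m + mass g' + mass h)" using c(7,11) by presburger
    have p0: "real p > 1" using prime_gt_1_nat[OF p(1)] by simp
    have 1: "G (mass g') \<le> energy g'"
      using less.hyps[OF c(12) c(1)] varies_in_restr[OF v] by (simp add: g'_def)
    have 2: "G (mass h) \<le> energy h"
      using less.hyps[OF c(13) c(2)] varies_in_restr[OF v] by (simp add: h_def)
    have "varies_in R m" unfolding m_def by (rule varies_in_merge[OF f v p(1) pR])
    then have 3: "G (mass m) \<le> energy m"
      using less.hyps[OF c(14) c(3)] by simp
    have "G (mass f) \<le> (1 - 1 / p) * (G (mass g') + G (mass h)) + 1 / p * G (mass m)"
      using step[OF p(1) _ c(5,6) _ _ _ ev] c(7-10) pR p(2) by (simp add: add.commute)
    also have "\<dots> \<le> (1 - 1 / p) * (energy g' + energy h) + 1 / p * energy m"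
      using p0 1 2 3 by (intro add_mono mult_left_mono) auto
    also have "\<dots> = energy f" using c(4) by simp
    finally show ?thesis .
  qed
qed

text \<open>With g(n) = c n and G(n) = d n it suffices to use j \<ge> b - a in the step. The
  coefficients of b then agree for every d, and those of a agree when d (1 + 1/p) = c (1 - 1/p),
  which is the origin of the factor.\<close>

lemma linear_bound_insert_prime:
  fixes c :: real
  assumes p: "prime p" and c: "c \<ge> 0"
    and base: "\<And>f. admissible f \<Longrightarrow> varies_in Q f \<Longrightarrow> mass f \<le> M \<Longrightarrow> c * mass f \<le> energy f"
    and f: "admissible f" "varies_in (insert p Q) f" "mass f \<le> M"
  shows "c * ((real p - 1) / (real p + 1)) * mass f \<le> energy f"
proof -
  have p1: "real p > 1" using prime_gt_1_nat[OF p] by simp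
  define d where "d = c * ((real p - 1) / (real p + 1))"
  have d0: "d \<ge> 0" using c p1 by (simp add: d_def)
  have "1 - 1 / real p = (real p - 1) / p" "1 + 1 / real p = (real p + 1) / p"
    using p1 by (simp_all add: field_simps)
  then have cd: "(1 - 1 / p) * c = (1 + 1 / p) * d" using p1 by (simp add: d_def)
  have dc: "d \<le> c"
  proof -
    have "c * ((real p - 1) / (real p + 1)) \<le> c * 1" using c p1 by (intro mult_left_mono) auto
    then show ?thesis by (simp add: d_def)
  qed
  have "d * mass f \<le> energy f"
  proof (rule lower_bound_insert_prime[OF p, where g = "\<lambda>n. c * n" and G = "\<lambda>n. d * n", OF base _ _ f])
    show "d * real n \<le> c * real n" for n using dc by (intro mult_right_mono) auto
    fix a b j :: nat
    assume "a \<le> j + b" "b \<le> j + a"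
    then have "real a \<le> real j + real b" "real b \<le> real j + real a" by linarith+
    then have "d * (real a - real b) \<le> d * real j" "d * (real b - real a) \<le> d * real j"
      using d0 by (intro mult_left_mono; simp)+
    then have "1 / p * (d * (real b - real a)) \<le> 1 / p * (d * real j)"
      using p1 mult_left_mono[of "d * (real b - real a)" "d * real j" "1 / p"] by simp
    moreover have "(1 - 1 / p) * (c * real a) = (1 + 1 / p) * (d * real a)"
      using cd by (metis mult.assoc)
    moreover have "d * real (a + b) = (1 + 1 / p) * (d * real a) + (1 - 1 / p) * (d * real b)
        + 1 / p * (d * (real b - real a))"
      using p1 by (simp add: field_simps)
    ultimately show "d * real (a + b) \<le> (1 - 1 / p) * (c * real a + d * real b) + 1 / p * (d * real j)"
      by (simp only: distrib_left)
  qed auto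
  then show ?thesis by (simp add: d_def)
qed

lemma energy_ge_mass_no_primes:
  assumes f: "admissible f" "varies_in {} f"
  shows "energy f = (real (mass f))\<^sup>2" "mass f \<le> energy f"
proof -
  show *: "energy f = (real (mass f))\<^sup>2"
  proof (cases "supp f = {}")
    case True
    then show ?thesis using f mass_eq_0[of f] energy_empty by simp
  next
    case False
    then show ?thesis using varies_in_empty[OF f] by metis
  qed
  show "mass f \<le> energy f" unfolding * by (cases "mass f") (auto simp: power2_eq_square algebra_simps)
qed

section \<open>Integral factorial ratios have small energy\<close>

lemma multiplicity_fact_rec:
  assumes p: "prime (p::nat)"
  shows "multiplicity p (fact n :: nat) = n div p + multiplicity p (fact (n div p) :: nat)"
proof (induction n)
  case (Suc n)
  have *: "multiplicity p (fact (Suc n) :: nat) = multiplicity p (Suc n) + multiplicity p (fact n :: nat)"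
    unfolding fact_Suc of_nat_id
    by (rule prime_elem_multiplicity_mult_distrib) (use p in auto)
  show ?case
  proof (cases "p dvd Suc n")
    case True
    then obtain q where q: "Suc n = p * q" by auto
    have p0: "p > 0" using p prime_gt_0_nat by blast
    have q0: "q > 0" using q by (cases q) auto
    have d: "Suc n div p = q" using q p0 by simp
    then have "n div p = q - 1" using True by (simp add: div_Suc dvd_eq_mod_eq_0)
    moreover have "multiplicity p (Suc n) = 1 + multiplicity p q"
      unfolding q using p q0 by (subst prime_elem_multiplicity_mult_distrib) auto
    moreover have "multiplicity p (fact q :: nat) = multiplicity p q + multiplicity p (fact (q - 1) :: nat)"
    proof -
      have "(fact q :: nat) = q * fact (q - 1)" using q0 by (simp add: fact_reduce)
      then show ?thesis using p q0 by (simp add: prime_elem_multiplicity_mult_distrib)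
    qed
    ultimately show ?thesis using * Suc.IH d q0 by simp
  next
    case False
    then have "Suc n div p = n div p" by (simp add: div_Suc dvd_eq_mod_eq_0)
    then show ?thesis using * Suc.IH not_dvd_imp_multiplicity_0[OF False] by simp
  qed
qed simp

lemma multiplicity_fact_small:
  assumes p: "prime (p::nat)" and n: "n < p * p"
  shows "multiplicity p (fact n :: nat) = n div p"
proof -
  have "n div p < p" using n by (simp add: less_mult_imp_div_less)
  then have "\<not> p dvd (fact (n div p) :: nat)" using p by (simp add: prime_dvd_fact_iff)
  then show ?thesis using multiplicity_fact_rec[OF p, of n] not_dvd_imp_multiplicity_0 by fastforce
qed

lemma multiplicity_prod_list_fact:
  assumes p: "prime (p::nat)"
  shows "multiplicity p (\<Prod>x\<leftarrow>xs. fact (h x) :: nat) = (\<Sum>x\<leftarrow>xs. multiplicity p (fact (h x) :: nat))"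
proof (induction xs)
  case (Cons x xs)
  have "(\<Prod>x\<leftarrow>xs. fact (h x) :: nat) \<noteq> 0" by (induction xs) auto
  then show ?case using Cons p by (simp add: prime_elem_multiplicity_mult_distrib)
qed simp

lemma integral_factorial_ratio_multiplicity:
  assumes r: "integral_factorial_ratio K L as bs" and n: "n \<ge> 1" and p: "prime p"
  shows "(\<Sum>b\<leftarrow>bs. multiplicity p (fact (b * n) :: nat)) \<le> (\<Sum>a\<leftarrow>as. multiplicity p (fact (a * n) :: nat))"
proof -
  let ?A = "\<Prod>a\<leftarrow>as. fact (a * n) :: nat" and ?B = "\<Prod>b\<leftarrow>bs. fact (b * n) :: nat"
  have real: "real (\<Prod>a\<leftarrow>xs. fact (a * n)) = (\<Prod>a\<leftarrow>xs. fact (a * n))" for xs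
    by (induction xs) auto
  have ne: "?A \<noteq> 0" "?B \<noteq> 0" by (induction as, auto) (induction bs, auto)
  have "(\<Prod>a\<leftarrow>as. fact (a * n)) / (\<Prod>b\<leftarrow>bs. fact (b * n)) \<in> (\<nat> :: real set)"
    using r n by (simp add: integral_factorial_ratio_def)
  then have "real ?A / real ?B \<in> \<nat>" by (simp only: real)
  then obtain k where k: "real ?A / real ?B = real k" by (rule Nats_cases)
  then have "real ?A = real (k * ?B)" using ne by (simp add: field_simps)
  then have "?A = k * ?B" by (simp only: of_nat_eq_iff)
  then have "?B dvd ?A" by simp
  then have "multiplicity p ?B \<le> multiplicity p ?A" using ne by (intro dvd_imp_multiplicity_le) auto
  then show ?thesis by (simp add: multiplicity_prod_list_fact[OF p])
qed

text \<open>The fraction \<open>u / w\<close> is approximated from above by \<open>m / p\<close> with a large prime denominator,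
  so closely that no floor changes.\<close>
lemma sum_floor_le:
  assumes r: "integral_factorial_ratio K L as bs" and u: "0 < u" "u < w"
  shows "(\<Sum>b\<leftarrow>bs. b * u div w) \<le> (\<Sum>a\<leftarrow>as. a * u div w)"
proof -
  obtain p where p: "prime p" "p > w * sum_list (as @ bs) + w" using bigger_prime by blast
  define m where "m = (p * u + w - 1) div w"
  define s where "s = m * w - p * u"
  have mw: "p * u \<le> m * w" "m * w < p * u + w"
  proof -
    have "m * w + (p * u + w - 1) mod w = p * u + w - 1" unfolding m_def by simp
    moreover have "(p * u + w - 1) mod w < w" using u by simp
    ultimately show "p * u \<le> m * w" "m * w < p * u + w" using u by linarith+
  qed
  then have s: "m * w = p * u + s" "s < w" unfolding s_def by linarith+
  have mp: "m \<le> p"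
  proof -
    have "p * u + w \<le> p * u + p" using p by (intro add_left_mono) linarith
    also have "\<dots> = p * (u + 1)" by simp
    also have "\<dots> \<le> p * w" using u by (intro mult_left_mono) auto
    finally have "m * w < p * w" using mw(2) by linarith
    then show ?thesis by simp
  qed
  have m1: "m \<ge> 1"
  proof (rule ccontr)
    assume "\<not> m \<ge> 1"
    then have "m * w = 0" by simp
    then have "p * u = 0" using mw(1) by linarith
    then show False using p u by simp
  qed
  \<comment> \<open>The second claim puts x m below p^2, where only the first term of Legendre's
    formula is left: the valuation of \<open>fact (x * m)\<close> at p is the floor itself.\<close>
  have fl: "x * m div p = x * u div w" and sm: "x * m < p * p" if "x \<in> set (as @ bs)" for x
  proof -
    have "x \<le> sum_list (as @ bs)" using that member_le_sum_list by blast
    then have "x * w \<le> w * sum_list (as @ bs)" by (simp add: mult.commute)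
    then have xw: "x * w < p" using p by linarith
    have w1: "w \<ge> 1" using u by simp
    then have "x \<le> x * w" by (cases w) auto
    then have xp: "x < p" using xw by linarith
    then have "x * m \<le> x * p" "x * p < p * p" using mp by simp_all
    then show "x * m < p * p" by linarith
    define Q R where "Q = x * u div w" and "R = x * u mod w"
    have QR: "x * u = Q * w + R" "R < w" using u by (simp_all add: Q_def R_def)
    have e: "x * m * w = p * Q * w + (p * R + x * s)"
    proof -
      have "x * m * w = x * (p * u + s)" using s(1) by (simp add: mult.assoc)
      also have "\<dots> = p * (x * u) + x * s" by (simp add: algebra_simps)
      finally show ?thesis unfolding QR(1) by (simp add: algebra_simps)
    qed
    have "p * R \<le> p * (w - 1)" using QR(2) by (intro mult_left_mono) auto
    moreover have "x * s \<le> x * w" using s(2) by simp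
    moreover have "p * (w - 1) + p = p * w" using w1 by (cases w) auto
    ultimately have lt: "p * R + x * s < p * w" using xw by linarith
    have "p * Q * w \<le> x * m * w" using e by simp
    then have 1: "p * Q \<le> x * m" using w1 by simp
    have "x * m * w < p * Q * w + p * w" using e lt by simp
    also have "\<dots> = (p * Suc Q) * w" by (simp add: algebra_simps)
    finally have 2: "x * m < p * Suc Q" by simp
    show "x * m div p = x * u div w"
      using 1 2 unfolding Q_def[symmetric] by (rule div_nat_eqI)
  qed
  have "(\<Sum>b\<leftarrow>xs. multiplicity p (fact (b * m) :: nat)) = (\<Sum>b\<leftarrow>xs. b * u div w)"
    if "set xs \<subseteq> set (as @ bs)" for xs
    by (rule arg_cong[of _ _ sum_list], rule map_cong[OF refl])
      (use that fl sm multiplicity_fact_small[OF p(1)] in \<open>auto simp: subset_iff\<close>)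
  then show ?thesis
    using integral_factorial_ratio_multiplicity[OF r m1 p(1)] by simp
qed

section \<open>The signed counting function of a tuple\<close>

definition signed_count :: "nat list \<Rightarrow> nat list \<Rightarrow> nat \<Rightarrow> int" where
  "signed_count as bs x = int (count_list bs x) - int (count_list as x)"

lemma supp_signed_count:
  assumes "integral_factorial_ratio K L as bs"
  shows "supp (signed_count as bs) = set as \<union> set bs"
proof -
  have "set as \<inter> set bs = {}" using assms by (auto simp: integral_factorial_ratio_def)
  then show ?thesis
    by (auto simp: supp_def signed_count_def count_list_0_iff) (metis count_list_0_iff of_nat_eq_0_iff disjoint_iff diff_0_right diff_0 neg_equal_0_iff_equal)+
qed

lemma admissible_signed_count:
  assumes "integral_factorial_ratio K L as bs"
  shows "admissible (signed_count as bs)"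
  using assms supp_signed_count[OF assms]
  by (auto simp: admissible_def supp_def integral_factorial_ratio_def)

lemma sum_list_eq_sum_count:
  fixes F :: "nat \<Rightarrow> real"
  assumes "finite S" "set xs \<subseteq> S"
  shows "(\<Sum>x\<leftarrow>xs. F x) = (\<Sum>x\<in>S. real (count_list xs x) * F x)"
  using assms(2)
proof (induction xs)
  case (Cons y ys)
  have "(\<Sum>x\<in>S. real (count_list (y # ys) x) * F x)
      = (\<Sum>x\<in>S. (if x = y then F x else 0) + real (count_list ys x) * F x)"
    by (intro sum.cong) (auto simp: algebra_simps)
  then show ?case using Cons assms(1) by (simp add: sum.distrib)
qed simp

lemma sum_signed_count:
  fixes F :: "nat \<Rightarrow> real"
  assumes r: "integral_factorial_ratio K L as bs"
  shows "(\<Sum>x\<in>supp (signed_count as bs). real_of_int (signed_count as bs x) * F x)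
      = (\<Sum>b\<leftarrow>bs. F b) - (\<Sum>a\<leftarrow>as. F a)"
proof -
  let ?S = "set as \<union> set bs"
  have "(\<Sum>x\<leftarrow>xs. F x) = (\<Sum>x\<in>?S. real (count_list xs x) * F x)" if "set xs \<subseteq> ?S" for xs
    using that by (intro sum_list_eq_sum_count) auto
  then show ?thesis
    unfolding supp_signed_count[OF r]
    by (simp add: signed_count_def sum_subtractf[symmetric] left_diff_distrib)
qed

lemma mass_signed_count:
  assumes r: "integral_factorial_ratio K L as bs"
  shows "mass (signed_count as bs) = K + L"
proof -
  have d: "set as \<inter> set bs = {}" and l: "length as = K" "length bs = L"
    using r by (auto simp: integral_factorial_ratio_def)
  have "mass (signed_count as bs) = (\<Sum>x\<in>set as \<union> set bs. count_list bs x + count_list as x)"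
    unfolding mass_def supp_signed_count[OF r]
  proof (rule sum.cong[OF refl])
    fix x
    have "count_list as x = 0 \<or> count_list bs x = 0" using d by (auto simp: count_list_0_iff)
    then show "nat \<bar>signed_count as bs x\<bar> = count_list bs x + count_list as x"
      by (auto simp: signed_count_def)
  qed
  also have "\<dots> = (\<Sum>x\<in>set bs. count_list bs x) + (\<Sum>x\<in>set as. count_list as x)"
    unfolding sum.distrib
    by (intro arg_cong2[of _ _ _ _ "(+)"] sum.mono_neutral_right) (auto simp: count_list_0_iff)
  finally show ?thesis using l by (simp add: sum_count_set)
qed

text \<open>The fractional part of (k + 1/2)/m, minus 1/2. For m = M / a this is the sawtooth of a
  at the midpoint (k + 1/2)/M of a cell of length 1/M. Midpoints avoid all jumps and are symmetric
  about 1/2, and finite sums over them replace integrals.\<close>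

definition saw :: "nat \<Rightarrow> nat \<Rightarrow> real" where
  "saw m k = (real (k mod m) + 1/2) / m - 1/2"

section \<open>Correlations of sampled sawtooth functions\<close>

lemma sum_lessThan_add: "(\<Sum>k<a + b. F k) = (\<Sum>k<a. F k) + (\<Sum>i<b. F (a + i :: nat) :: real)"
  by (induction b) (auto simp: algebra_simps)

lemma sum_lessThan_mult: "(\<Sum>k<m * s. F k) = (\<Sum>i<m. \<Sum>j<s. F (i + m * j :: nat) :: real)"
proof (induction s)
  case (Suc s)
  have "(\<Sum>k<m * Suc s. F k) = (\<Sum>k<m * s. F k) + (\<Sum>i<m. F (m * s + i))"
    using sum_lessThan_add[of F "m * s" m] by (simp add: add.commute)
  then show ?case using Suc by (simp add: sum.distrib add.commute)
qed simp

lemma sum_lessThan_real: "(\<Sum>i<s. real i) = s * (real s - 1) / 2"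
  by (induction s) (auto simp: algebra_simps)

lemma sum_lessThan_real_square: "(\<Sum>i<s. (real i)\<^sup>2) = s * (real s - 1) * (2 * real s - 1) / 6"
  by (induction s) (auto simp: algebra_simps power2_eq_square)

text \<open>The distribution relation of the first Bernoulli polynomial. The t numbers r + m j are
  distinct modulo n = g t and all congruent to r modulo g, hence they exhaust that class.\<close>

lemma saw_distribution:
  assumes n: "n = g * t" "g > 0" "t > 0"
    and inj: "\<And>i j. i < t \<Longrightarrow> j < t \<Longrightarrow> (r + m * i) mod n = (r + m * j) mod n \<Longrightarrow> i = j"
    and g: "g dvd m"
  shows "(\<Sum>j<t. saw n (r + m * j)) = saw g r"
proof -
  define F where "F = (\<lambda>x. (real x + 1/2) / n - 1/2)"
  let ?R = "(\<lambda>i. r mod g + g * i) ` {..<t}"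
  have n0: "n > 0" using n by simp
  have injR: "inj_on (\<lambda>i. r mod g + g * i) {..<t}" using n by (auto simp: inj_on_def)
  have inj': "inj_on (\<lambda>j. (r + m * j) mod n) {..<t}"
    using inj by (auto simp: inj_on_def)
  have sub: "(\<lambda>j. (r + m * j) mod n) ` {..<t} \<subseteq> ?R"
  proof
    fix x assume "x \<in> (\<lambda>j. (r + m * j) mod n) ` {..<t}"
    then obtain j where j: "x = (r + m * j) mod n" by auto
    have "x mod g = (r + m * j) mod g" using n(1) j by (simp add: mod_mod_cancel)
    also have "\<dots> = r mod g" using g by (metis dvd_mult2 mod_add_right_eq add_0_right dvd_imp_mod_0)
    finally have "x = r mod g + g * (x div g)" by (metis mult_div_mod_eq add.commute)
    moreover have "x div g < t" using j n n0 by (simp add: less_mult_imp_div_less mult.commute)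
    ultimately show "x \<in> ?R" by blast
  qed
  have eq: "(\<lambda>j. (r + m * j) mod n) ` {..<t} = ?R"
    by (rule card_subset_eq) (use sub card_image[OF injR] card_image[OF inj'] in auto)
  have "(\<Sum>j<t. saw n (r + m * j)) = (\<Sum>j<t. F ((r + m * j) mod n))"
    by (simp add: saw_def F_def)
  also have "\<dots> = sum F ((\<lambda>j. (r + m * j) mod n) ` {..<t})"
    using sum.reindex[OF inj', of F] by (simp add: o_def)
  also have "\<dots> = (\<Sum>i<t. F (r mod g + g * i))"
    unfolding eq using sum.reindex[OF injR, of F] by (simp add: o_def)
  also have "\<dots> = saw g r"
  proof -
    have "F (r mod g + g * i) = ((real (r mod g) + 1/2) / n - 1/2) + g / n * i" for i
      using n0 by (simp add: F_def field_simps)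
    then have "(\<Sum>i<t. F (r mod g + g * i)) = t * ((real (r mod g) + 1/2) / n - 1/2) + g / n * (t * (real t - 1) / 2)"
      by (simp only: sum.distrib sum_constant sum_distrib_left[symmetric] sum_lessThan_real card_lessThan)
    also have "\<dots> = saw g r"
      using n(2,3) unfolding saw_def n(1) by (simp add: field_simps)
    finally show ?thesis .
  qed
  finally show ?thesis .
qed

lemma sum_saw_square:
  assumes "g > 0"
  shows "(\<Sum>i<g. (saw g i)\<^sup>2) = ((real g)\<^sup>2 - 1) / (12 * g)"
proof -
  have "(\<Sum>i<g. (saw g i)\<^sup>2)
      = (\<Sum>i<g. 1 / (real g)\<^sup>2 * (real i)\<^sup>2 + (1 / (real g)\<^sup>2 - 1 / g) * i + (1 / (2 * real g) - 1 / 2)\<^sup>2)"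
    using assms by (intro sum.cong refl) (simp add: saw_def field_simps power2_eq_square)
  also have "\<dots> = ((real g)\<^sup>2 - 1) / (12 * g)"
    using assms unfolding sum.distrib sum_distrib_left[symmetric] sum_lessThan_real sum_lessThan_real_square
    by (simp add: field_simps power2_eq_square)
  finally show ?thesis .
qed

lemma mod_mult_inj:
  fixes m n :: nat
  assumes n: "n > 0" and ij: "i < n div gcd m n" "j < n div gcd m n"
    and eq: "(r + m * i) mod n = (r + m * j) mod n"
  shows "i = j"
proof -
  have *: "i = j" if "i \<le> j" "(r + m * i) mod n = (r + m * j) mod n" "j < n div gcd m n" for i j
  proof (rule ccontr)
    assume "i \<noteq> j"
    have "r + m * i \<le> r + m * j" using that by simp
    then have "n dvd (r + m * j) - (r + m * i)" using that(2) mod_eq_dvd_iff_nat by metis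
    then have "n dvd m * (j - i)" by (simp add: diff_mult_distrib2)
    moreover obtain n' m' where nm: "n = n' * gcd n m" "m = m' * gcd n m" "coprime n' m'"
      using gcd_coprime_exists[of n m] n by auto
    ultimately have "gcd n m * n' dvd gcd n m * (m' * (j - i))" by (metis mult.assoc mult.commute)
    then have "n' dvd m' * (j - i)" using n by simp
    then have "n' dvd j - i" using nm(3) by (simp add: coprime_dvd_mult_right_iff)
    moreover have "n div gcd m n = n'" using nm(1) n by (metis gcd.commute gcd_eq_0_iff less_numeral_extra(3) nonzero_mult_div_cancel_right)
    ultimately have "n div gcd m n dvd j - i" by simp
    then have "n div gcd m n \<le> j - i" using that \<open>i \<noteq> j\<close> by (intro dvd_imp_le) auto
    then show False using that by linarith
  qed
  show ?thesis using *[of i j] *[of j i] ij eq by (cases "i \<le> j") auto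
qed

text \<open>Write k = i + m j. The first factor depends on i only, and summing the second over j
  collapses it to a multiple of \<open>saw g i\<close>; splitting i in the same way modulo g leaves
  the sum of squares of \<open>saw g\<close>. The -1 beside the squared gcd is the sampling
  error.\<close>

lemma sum_saw_mult:
  assumes m: "m dvd M" "n dvd M" and M: "M > 0"
  shows "(\<Sum>k<M. saw m k * saw n k) = M * ((real (gcd m n))\<^sup>2 - 1) / (12 * m * n)"
proof -
  define g where "g = gcd m n"
  define t where "t = n div g"
  obtain s where s: "M = m * s" using m by auto
  have pos: "m > 0" "n > 0" "g > 0" using m M by (auto simp: g_def intro!: Nat.gr0I)
  have nt: "n = g * t" by (simp add: t_def g_def)
  have t0: "t > 0" using nt pos by (intro Nat.gr0I) auto
  obtain l where l: "m = g * l" using g_def by (metis gcd_dvd1 dvdE)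
  have l0: "l > 0" using l pos by (intro Nat.gr0I) auto
  have "coprime t l" 
    using nt l pos g_def by (metis coprime_commute gcd_mult_distrib_nat gcd_eq_1_imp_coprime mult_cancel1 mult.right_neutral less_numeral_extra(3))
  moreover have "t dvd l * s" using m(2) s nt l pos by (simp add: mult.assoc)
  ultimately have "t dvd s" by (simp add: coprime_dvd_mult_right_iff)
  then obtain c where c: "s = t * c" by auto
  have inner: "(\<Sum>j<s. saw n (i + m * j)) = c * saw g i" for i
  proof -
    have "(\<Sum>j<s. saw n (i + m * j)) = (\<Sum>j<t. \<Sum>q<c. saw n (i + m * (j + t * q)))"
      unfolding c by (rule sum_lessThan_mult)
    also have "\<dots> = (\<Sum>j<t. \<Sum>q<c. saw n (i + m * j))"
    proof (intro sum.cong refl)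
      fix j q
      have "i + m * (j + t * q) = i + m * j + n * (l * q)" by (simp add: nt l algebra_simps)
      then show "saw n (i + m * (j + t * q)) = saw n (i + m * j)"
        by (simp only: saw_def mod_mult_self2)
    qed
    also have "\<dots> = c * (\<Sum>j<t. saw n (i + m * j))" by (simp add: sum_distrib_left)
    also have "(\<Sum>j<t. saw n (i + m * j)) = saw g i"
      by (rule saw_distribution[OF nt pos(3) t0])
        (use mod_mult_inj[OF pos(2), of _ m _ i] in \<open>auto simp: t_def g_def\<close>)
    finally show ?thesis .
  qed
  have inner2: "(\<Sum>j<l. saw m (i + g * j)) = saw g i" for i
  proof (rule saw_distribution[OF l pos(3) l0])
    show "x = y" if "x < l" "y < l" "(i + g * x) mod m = (i + g * y) mod m" for x y
    proof (rule mod_mult_inj[OF pos(1)])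
      have "gcd g m = g" by (simp add: g_def gcd.commute gcd.left_commute)
      then have "m div gcd g m = l" using l pos by simp
      then show "x < m div gcd g m" "y < m div gcd g m" using that by auto
    qed (use that in auto)
  qed auto
  have "(\<Sum>k<M. saw m k * saw n k) = (\<Sum>i<m. \<Sum>j<s. saw m (i + m * j) * saw n (i + m * j))"
    unfolding s by (rule sum_lessThan_mult)
  also have "\<dots> = (\<Sum>i<m. saw m i * (\<Sum>j<s. saw n (i + m * j)))"
    by (simp add: saw_def sum_distrib_left)
  also have "\<dots> = (\<Sum>i<m. c * (saw m i * saw g i))"
    by (intro sum.cong refl) (simp add: inner)
  also have "\<dots> = c * (\<Sum>i<m. saw m i * saw g i)"
    by (rule sum_distrib_left[symmetric])
  also have "(\<Sum>i<m. saw m i * saw g i) = (\<Sum>i<g. \<Sum>j<l. saw m (i + g * j) * saw g (i + g * j))"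
    by (subst l) (rule sum_lessThan_mult)
  also have "\<dots> = (\<Sum>i<g. saw g i * (\<Sum>j<l. saw m (i + g * j)))"
    by (intro sum.cong refl) (simp add: saw_def[of g] sum_distrib_right[symmetric] mult.commute)
  also have "\<dots> = (\<Sum>i<g. (saw g i)\<^sup>2)" by (simp add: inner2 power2_eq_square)
  also have "\<dots> = ((real g)\<^sup>2 - 1) / (12 * g)" by (rule sum_saw_square[OF pos(3)])
  finally have "(\<Sum>k<M. saw m k * saw n k) = c * (((real g)\<^sup>2 - 1) / (12 * g))" .
  also have "\<dots> = M * ((real g)\<^sup>2 - 1) / (12 * m * n)"
    using pos t0 l0 unfolding s c nt l by (simp add: field_simps)
  finally show ?thesis by (simp add: g_def)
qed

text \<open>As functions of k the sawtooths of x and y have periods M / x and M / y. The identity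
  behind the formula is gcd(M/x, M/y) x y = M gcd(x, y).\<close>

lemma kern_dual:
  assumes xy: "x dvd M" "y dvd M" and M: "M > 0"
  shows "(real (gcd (M div x) (M div y)))\<^sup>2 / (real (M div x) * real (M div y)) = kern x y"
proof -
  obtain m where m: "M = x * m" using xy(1) by (rule dvdE)
  obtain n where n: "M = y * n" using xy(2) by (rule dvdE)
  have pos: "x > 0" "y > 0" "m > 0" "n > 0" using m n M by (auto intro!: Nat.gr0I)
  have d: "M div x = m" "M div y = n" using m n pos by (metis nonzero_mult_div_cancel_left less_numeral_extra(3))+
  have "gcd m n * (x * y) = gcd (x * m * y) (y * n * x)"
    by (simp add: gcd_mult_distrib_nat mult_ac)
  also have "\<dots> = gcd (M * y) (M * x)" using m n by simp
  also have "\<dots> = M * gcd x y" by (simp add: gcd_mult_distrib_nat gcd.commute)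
  finally have "real (gcd m n) * (real x * real y) = real M * real (gcd x y)"
    by (metis of_nat_mult)
  then have "(real (gcd m n))\<^sup>2 * (real x * real y)\<^sup>2 = (real M)\<^sup>2 * (real (gcd x y))\<^sup>2"
    by (metis power_mult_distrib)
  moreover have "(real M)\<^sup>2 = (real x * real m) * (real y * real n)"
    by (metis m n of_nat_mult power2_eq_square)
  ultimately have "(real x * real y) * ((real (gcd m n))\<^sup>2 * (real x * real y))
      = (real x * real y) * ((real (gcd x y))\<^sup>2 * (real m * real n))"
    by (simp add: power2_eq_square mult_ac)
  then have "(real (gcd m n))\<^sup>2 * (real x * real y) = (real (gcd x y))\<^sup>2 * (real m * real n)"
    using pos by simp
  then show ?thesis
    unfolding d kern_def using pos by (simp add: frac_eq_eq)
qed

text \<open>Weighted with the coefficients, the sampling errors of the correlations add up to a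
  multiple of the square of the sum of f(x) x, which vanishes by balance. The sampled mean square is
  therefore exact.\<close>

lemma sum_square_samples:
  assumes f: "admissible f" and M: "M > 0" "\<And>x. x \<in> supp f \<Longrightarrow> x dvd M"
    and bal: "(\<Sum>x\<in>supp f. f x * int x) = 0"
  shows "(\<Sum>k<M. (\<Sum>x\<in>supp f. real_of_int (f x) * saw (M div x) k)\<^sup>2) = M / 12 * energy f"
proof -
  let ?S = "supp f" and ?c = "\<lambda>x. real_of_int (f x)"
  have bal': "(\<Sum>x\<in>?S. ?c x * real x) = 0"
    using arg_cong[OF bal, of real_of_int] by simp
  have corr: "(\<Sum>k<M. saw (M div x) k * saw (M div y) k) = M / 12 * (kern x y - real x * real y / (real M)\<^sup>2)"
    if "x \<in> ?S" "y \<in> ?S" for x y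
  proof -
    have d: "x dvd M" "y dvd M" using M that by auto
    have pos: "x > 0" "y > 0" using admissible_pos[OF f] that by auto
    have "real (M div x) = M / x" "real (M div y) = M / y" using d by (simp_all add: real_of_nat_div)
    then have "1 / (real (M div x) * real (M div y)) = real x * real y / (real M)\<^sup>2"
      using pos by (simp add: power2_eq_square)
    moreover have "(\<Sum>k<M. saw (M div x) k * saw (M div y) k)
        = M / 12 * ((real (gcd (M div x) (M div y)))\<^sup>2 / (real (M div x) * real (M div y))
            - 1 / (real (M div x) * real (M div y)))"
      using d M(1) by (subst sum_saw_mult) (auto simp: div_dvd_iff_mult diff_divide_distrib[symmetric])
    ultimately show ?thesis using kern_dual[OF d M(1)] by simp
  qed
  have "(\<Sum>k<M. (\<Sum>x\<in>?S. ?c x * saw (M div x) k)\<^sup>2)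
      = (\<Sum>k<M. \<Sum>x\<in>?S. \<Sum>y\<in>?S. ?c x * ?c y * (saw (M div x) k * saw (M div y) k))"
    by (simp add: power2_eq_square sum_product mult_ac)
  also have "\<dots> = (\<Sum>x\<in>?S. \<Sum>k<M. \<Sum>y\<in>?S. ?c x * ?c y * (saw (M div x) k * saw (M div y) k))"
    by (rule sum.swap)
  also have "\<dots> = (\<Sum>x\<in>?S. \<Sum>y\<in>?S. \<Sum>k<M. ?c x * ?c y * (saw (M div x) k * saw (M div y) k))"
    by (rule sum.cong[OF refl], rule sum.swap)
  also have "\<dots> = (\<Sum>x\<in>?S. \<Sum>y\<in>?S. ?c x * ?c y * (M / 12 * (kern x y - real x * real y / (real M)\<^sup>2)))"
    by (intro sum.cong refl) (simp add: sum_distrib_left[symmetric] corr)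
  also have "\<dots> = M / 12 * (\<Sum>x\<in>?S. \<Sum>y\<in>?S. ?c x * ?c y * kern x y)
      - M / 12 / (real M)\<^sup>2 * (\<Sum>x\<in>?S. \<Sum>y\<in>?S. (?c x * real x) * (?c y * real y))"
    unfolding sum_distrib_left sum_subtractf[symmetric]
    by (intro sum.cong refl) (simp add: algebra_simps)
  also have "(\<Sum>x\<in>?S. \<Sum>y\<in>?S. (?c x * real x) * (?c y * real y)) = 0"
    unfolding sum_product[symmetric] bal' by simp
  finally show ?thesis by (simp add: energy_def form_def)
qed

lemma balanced_signed_count:
  assumes r: "integral_factorial_ratio K L as bs"
  shows "(\<Sum>x\<in>supp (signed_count as bs). signed_count as bs x * int x) = 0"
proof -
  have "real_of_int (\<Sum>x\<in>supp (signed_count as bs). signed_count as bs x * int x)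
      = (\<Sum>b\<leftarrow>bs. real b) - (\<Sum>a\<leftarrow>as. real a)"
    using sum_signed_count[OF r, of real] by simp
  also have "\<dots> = real (sum_list bs) - real (sum_list as)"
    by (simp add: sum_list_of_nat)
  also have "\<dots> = 0" using r by (simp add: integral_factorial_ratio_def)
  finally show ?thesis by linarith
qed

text \<open>At every sample point the sawtooth sum equals -F - D/2 with F in [-D, 0], so its square
  is at most (D/2)^2, and 12 (D/2)^2 = 3 D^2.\<close>

lemma energy_le:
  assumes r: "integral_factorial_ratio K (K + D) as bs"
  shows "energy (signed_count as bs) \<le> 3 * (real D)\<^sup>2"
proof -
  let ?f = "signed_count as bs"
  let ?S = "supp ?f"
  define M where "M = prod_list (as @ bs)"
  have S: "?S = set (as @ bs)" using supp_signed_count[OF r] by simp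
  have pos: "x > 0" if "x \<in> set (as @ bs)" for x
    using that r by (fastforce simp: integral_factorial_ratio_def)
  have M0: "M > 0"
  proof -
    have "prod_list xs > 0" if "\<forall>x\<in>set xs. x > 0" for xs :: "nat list"
      using that by (induction xs) auto
    then show ?thesis using pos unfolding M_def by blast
  qed
  have dvd: "x dvd M" if "x \<in> set (as @ bs)" for x
  proof -
    have "y dvd prod_list xs" if "y \<in> set xs" for y :: nat and xs
      using that by (induction xs) auto
    then show ?thesis using that unfolding M_def by blast
  qed
  define F where "F = (\<lambda>k. \<Sum>x\<in>?S. real_of_int (?f x) * real (k div (M div x)))"
  \<comment> \<open>The point (2k + 1)/(2M) is the midpoint of the k-th cell; its extra half does
    not change the floor because M / x is an integer.\<close>
  have fl: "x * (2 * k + 1) div (2 * M) = k div (M div x)" if x': "x \<in> set (as @ bs)" for x k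
  proof -
    obtain m where m: "M = x * m" using dvd[OF x'] by auto
    have x: "x > 0" using pos[OF x'] .
    have "x * (2 * k + 1) div (2 * M) = x * (2 * k + 1) div (x * (2 * m))"
      unfolding m by (simp add: mult.left_commute)
    also have "\<dots> = (2 * k + 1) div (2 * m)" by (rule div_mult_mult1) (use x in auto)
    also have "\<dots> = (2 * k + 1) div 2 div m" by (rule div_mult2_eq)
    also have "\<dots> = k div (M div x)" using m x by simp
    finally show ?thesis .
  qed
  have F_nonpos: "F k \<le> 0" if k: "k < M" for k
  proof -
    have *: "(\<Sum>x\<leftarrow>xs. real (k div (M div x))) = real (\<Sum>x\<leftarrow>xs. x * (2 * k + 1) div (2 * M))"
      if "set xs \<subseteq> set (as @ bs)" for xs
      using that fl by (induction xs) auto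
    have "(\<Sum>b\<leftarrow>bs. b * (2 * k + 1) div (2 * M)) \<le> (\<Sum>a\<leftarrow>as. a * (2 * k + 1) div (2 * M))"
      by (rule sum_floor_le[OF r]) (use k in auto)
    then show ?thesis
      unfolding F_def sum_signed_count[OF r] by (simp add: *)
  qed
  have sumf: "(\<Sum>x\<in>?S. real_of_int (?f x)) = D"
    using sum_signed_count[OF r, of "\<lambda>_. 1"] r
    by (simp add: integral_factorial_ratio_def sum_list_triv)
  have bal: "(\<Sum>x\<in>?S. real_of_int (?f x) * real x) = 0"
    using arg_cong[OF balanced_signed_count[OF r], of real_of_int] by simp
  \<comment> \<open>Replacing t by 1 - t turns floor(x t) into x - 1 - floor(x t), since x t is
    never an integer at a midpoint. Balance and the coefficient sum D then convert the upper bound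
    for F into a lower one.\<close>
  have reflect: "F (M - 1 - k) = - real D - F k" if k: "k < M" for k
  proof -
    have "real ((M - 1 - k) div (M div x)) = real x - 1 - real (k div (M div x))" if x: "x \<in> ?S" for x
    proof -
      obtain m where m: "M = x * m" using dvd x S by auto
      have x0: "x > 0" using pos x S by auto
      have m0: "m > 0" using m M0 by (intro Nat.gr0I) auto
      have d: "M div x = m" using m x0 by simp
      define q e where "q = k div m" and "e = k mod m"
      have k': "k = q * m + e" "e < m" using m0 by (simp_all add: q_def e_def)
      have "q < x" using k m unfolding q_def by (simp add: less_mult_imp_div_less)
      then obtain y where y: "x = Suc (q + y)" using less_imp_Suc_add by blast
      have "M - 1 - k = y * m + (m - 1 - e)" unfolding m y k'(1) using k'(2) by (simp add: algebra_simps)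
      then have "(M - 1 - k) div m = y" using m0 by simp
      then show ?thesis unfolding d using y by (simp add: q_def)
    qed
    then have "F (M - 1 - k) = (\<Sum>x\<in>?S. real_of_int (?f x) * (real x - 1 - real (k div (M div x))))"
      unfolding F_def by (intro sum.cong refl) simp
    also have "\<dots> = (\<Sum>x\<in>?S. real_of_int (?f x) * real x) - (\<Sum>x\<in>?S. real_of_int (?f x)) - F k"
      unfolding F_def sum_subtractf[symmetric] by (intro sum.cong refl) (simp add: algebra_simps)
    finally show ?thesis using bal sumf by simp
  qed
  have F_ge: "F k \<ge> - real D" if k: "k < M" for k
    using reflect[OF k] F_nonpos[of "M - 1 - k"] k by simp
  have saw: "(\<Sum>x\<in>?S. real_of_int (?f x) * saw (M div x) k) = - F k - D / 2" for k
  proof -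
    have saw_eq: "saw (M div x) k = (2 * real k + 1) / (2 * M) * x - real (k div (M div x)) - 1 / 2" if x: "x \<in> ?S" for x
    proof -
      have d: "x dvd M" "x > 0" using dvd pos x S by auto
      then have rd: "real (M div x) = M / x" by (simp add: real_of_nat_div)
      have "k = (k div (M div x)) * (M div x) + k mod (M div x)" by (rule div_mult_mod_eq[symmetric])
      then have "real k = real (k div (M div x)) * real (M div x) + real (k mod (M div x))"
        by (metis of_nat_add of_nat_mult)
      then have "real (k mod (M div x)) = real k - real (k div (M div x)) * (M / x)" unfolding rd by simp
      then show ?thesis unfolding saw_def rd using d M0 by (simp add: field_simps)
    qed
    have "(\<Sum>x\<in>?S. real_of_int (?f x) * saw (M div x) k)
        = (\<Sum>x\<in>?S. real_of_int (?f x) * ((2 * real k + 1) / (2 * M) * x - real (k div (M div x)) - 1 / 2))"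
    proof (rule sum.cong[OF refl])
      fix x assume x: "x \<in> ?S"
      show "real_of_int (?f x) * saw (M div x) k
          = real_of_int (?f x) * ((2 * real k + 1) / (2 * M) * x - real (k div (M div x)) - 1 / 2)"
        unfolding saw_eq[OF x] ..
    qed
    also have "\<dots> = (2 * real k + 1) / (2 * M) * (\<Sum>x\<in>?S. real_of_int (?f x) * real x) - F k
        - 1 / 2 * (\<Sum>x\<in>?S. real_of_int (?f x))"
      unfolding F_def sum_subtractf[symmetric] sum_distrib_left
      by (intro sum.cong refl) (simp add: algebra_simps)
    finally show ?thesis using bal sumf by simp
  qed
  have "M / 12 * energy ?f = (\<Sum>k<M. (\<Sum>x\<in>?S. real_of_int (?f x) * saw (M div x) k)\<^sup>2)"
    using S dvd by (intro sum_square_samples[symmetric] admissible_signed_count[OF r] M0 balanced_signed_count[OF r]) auto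
  also have "\<dots> \<le> (\<Sum>k<M. (D / 2)\<^sup>2)"
  proof (rule sum_mono)
    fix k assume "k \<in> {..<M}"
    then have "F k \<ge> - real D" "F k \<le> 0" using F_ge F_nonpos by auto
    then have "\<bar>- F k - D / 2\<bar> \<le> real D / 2" by (intro abs_leI) linarith+
    then have "\<bar>- F k - D / 2\<bar> \<le> \<bar>real D / 2\<bar>" by linarith
    then show "(\<Sum>x\<in>?S. real_of_int (?f x) * saw (M div x) k)\<^sup>2 \<le> (real D / 2)\<^sup>2"
      unfolding saw by (simp only: abs_le_square_iff)
  qed
  also have "\<dots> = M / 12 * (3 * (real D)\<^sup>2)" by (simp add: power2_eq_square)
  finally show ?thesis using M0 by simp
qed

section \<open>Explicit lower bounds for the energy\<close>

text \<open>Lower bounds, scaled by \<open>10\<^sup>4\<close> and rounded down, for the energy of a function of mass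
  \<open>n \<le> 110\<close> (the list index) whose valuations vary only at the primes up to 2, 3 and 5.
  They solve the recursion of \<open>lower_bound_insert_prime\<close> by dynamic programming, made
  monotone in steps of 2.\<close>
definition table2 :: "int list" where
  "table2 = [
    0, 10000, 10000, 15000, 17500, 21250, 24375, 27812, 31093, 34452, 37772, 41112, 44442,
     47777, 51109, 54443, 57776, 61109, 64442, 67775, 71108, 74441, 77774, 81107, 84440, 87773,
     91106, 94439, 97772, 101105, 104438, 107771, 111104, 114437, 117770, 121103, 124436,
     127769, 131102, 134435, 137768, 141101, 144434, 147767, 151100, 154433, 157766, 161099,
     164432, 167765, 171098, 174431, 177764, 181097, 184430, 187763, 191096, 194429, 197762,
     201095, 204428, 207761, 211094, 214427, 217760, 221093, 224426, 227759, 231092, 234425,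
     237758, 241091, 244424, 247757, 251090, 254423, 257756, 261089, 264422, 267755, 271088,
     274421, 277754, 281087, 284420, 287753, 291086, 294419, 297752, 301085, 304418, 307751,
     311084, 314417, 317750, 321083, 324416, 327749, 331082, 334415, 337748, 341081, 344414,
     347747, 351080, 354413, 357746, 361079, 364412, 367745, 371078]"

definition table3 :: "int list" where
  "table3 = [
    0, 10000, 10000, 15000, 13333, 20000, 18888, 22222, 20555, 26388, 26666, 30092, 28842,
     32870, 33286, 35578, 34432, 40004, 40560, 43911, 42958, 47152, 47469, 49969, 48856, 53330,
     53764, 57029, 56263, 59806, 60014, 62583, 61472, 67027, 67408, 70916, 70001, 74157, 74457,
     77155, 76044, 80605, 81062, 84106, 83495, 87198, 87384, 89975, 88864, 93580, 94068, 97121,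
     96580, 100639, 100978, 103801, 102690, 106904, 107274, 110607, 109634, 113384, 113569,
     116162, 115050, 120606, 120976, 124361, 123452, 127735, 128012, 130736, 129624, 134268,
     134617, 137654, 137039, 140875, 141060, 143652, 142541, 147393, 147804, 150934, 150330,
     154362, 154582, 157508, 156396, 160717, 161087, 164378, 163433, 167198, 167382, 169975,
     168864, 173852, 174230, 177370, 176777, 180889, 181034, 184007, 182896, 187423, 187824,
     190928, 190272, 194191, 194376]"

definition table5 :: "int list" where
  "table5 = [
    0, 10000, 10000, 15000, 13333, 20000, 18888, 22222, 20555, 26388, 26666, 30092, 28842,
     32870, 32888, 35578, 32888, 39554, 39776, 43517, 42184, 46740, 46147, 49147, 46147, 51369,
     51384, 54384, 52050, 55606, 53856, 56772, 53856, 60313, 60758, 64439, 63343, 68032, 68063,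
     70657, 68113, 73365, 73143, 76046, 73950, 77639, 76002, 78892, 76002, 81581, 81928, 84787,
     83219, 86824, 85947, 88337, 86280, 90193, 89873, 92708, 90761, 93929, 92262, 95151, 92262,
     98706, 99011, 102817, 101752, 106410, 106428, 109253, 106675, 112000, 112194, 115223,
     113157, 116816, 115325, 118214, 115325, 120974, 121305, 124108, 122570, 126145, 125414,
     127803, 125747, 129730, 129428, 132086, 130264, 133560, 131892, 134781, 131892, 137665,
     138056, 141498, 140220, 144012, 143626, 145807, 143839, 148123, 147888, 150442, 148954,
     152271, 151478]"

definition table1 :: "int list" where
  "table1 = map (\<lambda>i. 10000 * i * i) [0..110]"

text \<open>Primes beyond 5 do not lower the bounds any further. The cap at 12.001 lets a finite table
  serve all masses.\<close>
definition table_all :: "int list" where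
  "table_all = map (min 120010) (take 82 table5) @ replicate 81 120010"

section \<open>Checking the recursion on tables\<close>

fun row_ok :: "int \<Rightarrow> int \<Rightarrow> int list \<Rightarrow> int list \<Rightarrow> int list \<Rightarrow> bool" where
  "row_ok p x (y # ys) (z # zs) (w # ws) \<longleftrightarrow> p * w \<le> (p - 1) * (x + y) + z \<and> row_ok p x ys zs ws"
| "row_ok p x _ _ _ \<longleftrightarrow> True"

text \<open>In row \<open>a\<close> the list \<open>acc\<close> is \<open>G (a - 1), \<dots>, G 0\<close>, so that \<open>acc @ tl G\<close> enumerates
  \<open>G \<bar>a - b\<bar>\<close> for \<open>b \<ge> 1\<close>.\<close>
fun rows_ok :: "int \<Rightarrow> int list \<Rightarrow> int list \<Rightarrow> int list \<Rightarrow> int list \<Rightarrow> bool" where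
  "rows_ok p G (x # xs) acc (w # ws) \<longleftrightarrow> row_ok p x (tl G) (acc @ tl G) ws \<and> rows_ok p G xs (w # acc) ws"
| "rows_ok p G _ _ _ \<longleftrightarrow> True"

lemma row_okD:
  "\<lbrakk>row_ok p x ys zs ws; i < length ys; i < length zs; i < length ws\<rbrakk>
    \<Longrightarrow> p * ws ! i \<le> (p - 1) * (x + ys ! i) + zs ! i"
proof (induction p x ys zs ws arbitrary: i rule: row_ok.induct)
  case (1 p x y ys z zs w ws)
  then show ?case by (cases i) auto
qed auto

lemma rows_okD:
  assumes "rows_ok p G (drop c g) (rev (take c G)) (drop c G)" "length g = length G"
    and "c \<le> a" "b \<ge> 1" "a + b < length G"
  shows "p * G ! (a + b) \<le> (p - 1) * (g ! a + G ! b) + G ! (if b \<le> a then a - b else b - a)"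
  using assms(1,3)
proof (induction "a - c" arbitrary: c)
  case 0
  then have c: "c = a" by simp
  have "row_ok p (g ! a) (tl G) (rev (take a G) @ tl G) (drop (Suc a) G)"
    using 0(2) assms unfolding c
    by (simp add: Cons_nth_drop_Suc[symmetric, of a g] Cons_nth_drop_Suc[symmetric, of a G])
  then have "p * drop (Suc a) G ! (b - 1)
      \<le> (p - 1) * (g ! a + tl G ! (b - 1)) + (rev (take a G) @ tl G) ! (b - 1)"
    by (rule row_okD) (use assms in auto)
  moreover have "drop (Suc a) G ! (b - 1) = G ! (a + b)" "tl G ! (b - 1) = G ! b"
    using assms by (auto simp: nth_tl)
  moreover have "(rev (take a G) @ tl G) ! (b - 1) = G ! (if b \<le> a then a - b else b - a)"
    using assms by (auto simp: nth_append rev_nth nth_tl Suc_diff_Suc Suc_diff_le)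
  ultimately show ?case by simp
next
  case (Suc n)
  have c: "c < a" "c < length G" using Suc(2) assms by auto
  have "rows_ok p G (drop (Suc c) g) (rev (take (Suc c) G)) (drop (Suc c) G)"
    using Suc(3) c assms(2)
    by (simp add: Cons_nth_drop_Suc[symmetric, of c g] Cons_nth_drop_Suc[symmetric, of c G] take_Suc_conv_app_nth)
  then show ?case using Suc(1)[of "Suc c"] Suc(2) c by simp
qed

text \<open>Only the smallest admissible j = |a - b| is tested. All admissible j have the same
  parity, so monotonicity in steps of 2 covers the others.\<close>

definition table_ok :: "int \<Rightarrow> int list \<Rightarrow> int list \<Rightarrow> bool" where
  "table_ok p g G \<longleftrightarrow> length g = length G \<and> list_all2 (\<le>) G g
     \<and> list_all2 (\<le>) (take (length G - 2) G) (drop 2 G)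
     \<and> rows_ok p G (tl g) [hd G] (tl G) \<and> G \<noteq> []"

lemma table_ok_mono:
  assumes ok: "table_ok p g G" and ij: "i \<le> j" "even (i + j)" "j < length G"
  shows "G ! i \<le> G ! j"
proof -
  obtain k where k: "j = i + 2 * k" using ij by (metis add_diff_inverse_nat dvdE even_diff_nat not_less add.commute)
  have "i + 2 * k < length G \<Longrightarrow> G ! i \<le> G ! (i + 2 * k)"
  proof (induction k)
    case (Suc k)
    have "list_all2 (\<le>) (take (length G - 2) G) (drop 2 G)" using ok by (simp add: table_ok_def)
    then have "take (length G - 2) G ! (i + 2 * k) \<le> drop 2 G ! (i + 2 * k)"
      by (rule list_all2_nthD) (use Suc.prems in simp)
    then have "G ! (i + 2 * k) \<le> G ! (i + 2 * Suc k)" using Suc.prems by (simp add: add.commute)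
    then show ?case using Suc by simp
  qed simp
  then show ?thesis using ij k by simp
qed

lemma table_okD:
  assumes ok: "table_ok p g G" and ab: "a \<ge> 1" "b \<ge> 1" "a + b < length G"
    and j: "a \<le> j + b" "b \<le> j + a" "j \<le> a + b" "even (j + a + b)"
  shows "p * G ! (a + b) \<le> (p - 1) * (g ! a + G ! b) + G ! j"
proof -
  have G: "rows_ok p G (drop 1 g) (rev (take 1 G)) (drop 1 G)" "length g = length G"
    using ok by (cases G; auto simp: table_ok_def drop_Suc)+
  define i where "i = (if b \<le> a then a - b else b - a)"
  have "i \<le> j" "even (i + j)" using j by (auto simp: i_def)
  then have "G ! i \<le> G ! j" using table_ok_mono[OF ok] j ab by simp
  then show ?thesis using rows_okD[OF G ab] by (simp add: i_def)
qed

lemma table_ok1: "table_ok 2 table1 table2"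
  unfolding table1_def table2_def by code_simp

lemma table_ok2: "table_ok 3 table2 table3"
  unfolding table2_def table3_def by code_simp

lemma table_ok3: "table_ok 5 table3 table5"
  unfolding table3_def table5_def by code_simp

lemma table_ok4: "table_ok 7 table_all table_all"
  unfolding table_all_def table5_def by code_simp

lemma length_tables: "length table1 = 111" "length table2 = 111" "length table3 = 111" "length table5 = 111"
  "length table_all = 163"
  by (simp_all add: table1_def table2_def table3_def table5_def table_all_def)

lemma table_bound_insert_prime:
  assumes p: "prime p" and ok: "table_ok (int p) g G" and len: "length G = 111"
    and base: "\<And>f. admissible f \<Longrightarrow> varies_in Q f \<Longrightarrow> mass f \<le> 110 \<Longrightarrow> of_int (g ! mass f) / 10000 \<le> energy f"
    and f: "admissible f" "varies_in (insert p Q) f" "mass f \<le> 110"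
  shows "of_int (G ! mass f) / 10000 \<le> energy f"
proof (rule lower_bound_insert_prime[OF p, where g = "\<lambda>n. of_int (g ! n) / 10000"
      and G = "\<lambda>n. of_int (G ! n) / 10000", OF base _ _ f])
  have "list_all2 (\<le>) G g" using ok by (simp add: table_ok_def)
  then show "real_of_int (G ! n) / 10000 \<le> real_of_int (g ! n) / 10000" if "n \<le> 110" for n
    using list_all2_nthD[of "(\<le>)" G g n] that len by simp
  have p1: "real p > 1" using prime_gt_1_nat[OF p] by simp
  fix a b j :: nat
  assume "a > 0" "b > 0" "a + b \<le> 110" "a \<le> j + b" "b \<le> j + a" "j \<le> a + b" "even (j + a + b)"
  then have "int p * G ! (a + b) \<le> (int p - 1) * (g ! a + G ! b) + G ! j"
    using len by (intro table_okD[OF ok]) auto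
  then have "real_of_int (int p * G ! (a + b)) \<le> real_of_int ((int p - 1) * (g ! a + G ! b) + G ! j)"
    by (simp only: of_int_le_iff)
  then have "real p * real_of_int (G ! (a + b)) \<le> (real p - 1) * (real_of_int (g ! a) + real_of_int (G ! b)) + real_of_int (G ! j)"
    by simp
  then show "real_of_int (G ! (a + b)) / 10000
      \<le> (1 - 1 / p) * (real_of_int (g ! a) / 10000 + real_of_int (G ! b) / 10000) + 1 / p * (real_of_int (G ! j) / 10000)"
    using p1 by (simp add: field_simps)
qed

lemma energy_ge_table5:
  assumes "admissible f" "varies_in {2, 3, 5} f" "mass f \<le> 110"
  shows "of_int (table5 ! mass f) / 10000 \<le> energy f"
proof -
  have 0: "of_int (table1 ! mass f) / 10000 \<le> energy f"
    if "admissible f" "varies_in {} f" "mass f \<le> 110" for f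
  proof -
    have "table1 ! mass f = 10000 * int (mass f) * int (mass f)" using that(3) by (simp add: table1_def nth_upto)
    then show ?thesis using energy_ge_mass_no_primes(1)[OF that(1,2)] by (simp add: power2_eq_square)
  qed
  have 1: "of_int (table2 ! mass f) / 10000 \<le> energy f"
    if "admissible f" "varies_in {2} f" "mass f \<le> 110" for f
    by (rule table_bound_insert_prime[of 2 table1 table2 "{}"]) (use 0 that table_ok1 length_tables in auto)
  have 2: "of_int (table3 ! mass f) / 10000 \<le> energy f"
    if "admissible f" "varies_in {3, 2} f" "mass f \<le> 110" for f
    by (rule table_bound_insert_prime[of 3 table2 table3 "{2}"]) (use 1 that table_ok2 length_tables in auto)
  have "{2, 3, 5} = insert 5 {3, 2::nat}" by auto
  then show ?thesis
    using table_bound_insert_prime[of 5 table3 table5 "{3, 2}" f] 2 assms table_ok3 length_tables by auto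
qed

text \<open>Serves the masses beyond the tables. The constant is (1/3)(1/2)(2/3), the product of (p
  - 1)/(p + 1) over 2, 3, 5, and from mass 111 on the bound exceeds 12.001.\<close>

lemma energy_ge_linear5:
  assumes "admissible f" "varies_in {2, 3, 5} f"
  shows "mass f / 9 \<le> energy f"
proof -
  have p: "prime (2::nat)" "prime (3::nat)" "prime (5::nat)" by simp_all
  have 1: "1 / 3 * mass g \<le> energy g" if "admissible g" "varies_in {2} g" "mass g \<le> mass f" for g
    using linear_bound_insert_prime[OF p(1), of 1 "{}" "mass f" g] energy_ge_mass_no_primes(2) that by simp
  have 2: "1 / 6 * mass g \<le> energy g" if "admissible g" "varies_in {3, 2} g" "mass g \<le> mass f" for g
    using linear_bound_insert_prime[OF p(2), of "1 / 3" "{2}" "mass f" g] 1 that by simp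
  have "{2, 3, 5} = insert 5 {3, 2::nat}" by auto
  then show ?thesis
    using linear_bound_insert_prime[OF p(3), of "1 / 6" "{3, 2}" "mass f" f] 2 assms by simp
qed

section \<open>A bound for all primes and all masses\<close>

definition energy_bound :: "nat \<Rightarrow> real" where
  "energy_bound n = (if n < 82 then of_int (table_all ! n) / 10000 else 120010 / 10000)"

text \<open>The 163 entries cover every sum a + b with a, b < 82, the range in which the recursion
  is verified on the table.\<close>

lemma energy_bound_nth: "n < 163 \<Longrightarrow> energy_bound n = of_int (table_all ! n) / 10000"
  by (simp add: energy_bound_def table_all_def nth_append length_tables)

text \<open>The value 1 serves every nonempty piece and 1.3 every balanced one; 1.85 and 11 are what
  the recursion needs once the cap is reached.\<close>

lemma table_all_ge:
  "list_all (\<lambda>x. 10000 \<le> x) (tl table_all)" "list_all (\<lambda>x. 13000 \<le> x) (drop 3 table_all)"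
  "list_all (\<lambda>x. 18500 \<le> x) (drop 6 table_all)" "list_all (\<lambda>x. 110000 \<le> x) (drop 76 table_all)"
  "list_all (\<lambda>x. 120010 \<le> x) (drop 82 table5)" "hd table_all = 0"
  unfolding table_all_def table5_def by code_simp+

lemma energy_bound_ge:
  "energy_bound 0 = 0" "n \<ge> 1 \<Longrightarrow> energy_bound n \<ge> 1" "n \<ge> 3 \<Longrightarrow> energy_bound n \<ge> 1.3"
  "n \<ge> 6 \<Longrightarrow> energy_bound n \<ge> 1.85" "n \<ge> 76 \<Longrightarrow> energy_bound n \<ge> 11"
proof -
  have drop: "c \<le> table_all ! n" if "list_all (\<lambda>x. c \<le> x) (drop k table_all)" "k \<le> n" "n < 82" for c k n
  proof -
    have "\<forall>i<length (drop k table_all). c \<le> drop k table_all ! i"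
      using that(1) by (simp only: list_all_length)
    then have "c \<le> drop k table_all ! (n - k)"
      using that length_tables by (elim allE[of _ "n - k"]) auto
    then show ?thesis using that length_tables by simp
  qed
  show "energy_bound 0 = 0"
  proof -
    have "table_all \<noteq> []" using length_tables(5) by (intro notI) simp
    then show ?thesis using table_all_ge(6) by (simp add: energy_bound_def hd_conv_nth)
  qed
  have d1: "list_all (\<lambda>x. 10000 \<le> x) (drop 1 table_all)" using table_all_ge(1) by (simp add: drop_Suc)
  show "n \<ge> 1 \<Longrightarrow> energy_bound n \<ge> 1" using drop[OF d1, of n] by (auto simp: energy_bound_def)
  show "n \<ge> 3 \<Longrightarrow> energy_bound n \<ge> 1.3" using drop[OF table_all_ge(2), of n] by (auto simp: energy_bound_def)
  show "n \<ge> 6 \<Longrightarrow> energy_bound n \<ge> 1.85" using drop[OF table_all_ge(3), of n] by (auto simp: energy_bound_def)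
  show "n \<ge> 76 \<Longrightarrow> energy_bound n \<ge> 11" using drop[OF table_all_ge(4), of n] by (auto simp: energy_bound_def)
qed

lemma energy_bound_nonneg: "energy_bound n \<ge> 0"
  using energy_bound_ge(1) energy_bound_ge(2)[of n] by (cases "n = 0") auto

lemma energy_ge_bound5:
  assumes f: "admissible f" "varies_in {2, 3, 5} f"
  shows "energy_bound (mass f) \<le> energy f"
proof (cases "mass f \<le> 110")
  case True
  have "energy_bound (mass f) \<le> of_int (table5 ! mass f) / 10000"
  proof (cases "mass f < 82")
    case True
    then show ?thesis by (simp add: energy_bound_def table_all_def nth_append length_tables)
  next
    case False
    have "\<forall>i<length (drop 82 table5). 120010 \<le> drop 82 table5 ! i"
      using table_all_ge(5) by (simp only: list_all_length)
    then have "120010 \<le> drop 82 table5 ! (mass f - 82)"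
      using True False length_tables by (elim allE[of _ "mass f - 82"]) auto
    then show ?thesis using True False length_tables by (simp add: energy_bound_def)
  qed
  then show ?thesis using energy_ge_table5[OF f True] by simp
next
  case False
  then have "energy_bound (mass f) \<le> mass f / 9" by (simp add: energy_bound_def)
  then show ?thesis using energy_ge_linear5[OF f] by simp
qed

text \<open>The right-hand side is affine in 1/p, so 0 < 1/p \<le> 1/7 is settled at the endpoints:
  \<open>key\<close> is the inequality at 1/7 together with that at 0, which is
  subadditivity.\<close>

lemma energy_bound_step:
  assumes p: "p \<ge> (7::nat)" and ab: "a > 0" "b > 0"
    and j: "a \<le> j + b" "b \<le> j + a" "j \<le> a + b" "even (j + a + b)"
  shows "energy_bound (a + b) \<le> (1 - 1 / p) * (energy_bound a + energy_bound b) + 1 / p * energy_bound j"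
proof -
  let ?E = energy_bound
  have key: "7 * ?E (a + b) \<le> 6 * (?E a + ?E b) + ?E j \<and> ?E (a + b) \<le> ?E a + ?E b"
  proof (cases "a < 82 \<and> b < 82")
    case True
    define i where "i = (if b \<le> a then a - b else b - a)"
    have i: "a \<le> i + b" "b \<le> i + a" "i \<le> a + b" "even (i + a + b)" "i \<le> j" "even (i + j)"
      using j by (auto simp: i_def)
    have len: "a + b < length table_all" using True length_tables by simp
    have t: "7 * table_all ! (a + b) \<le> 6 * (table_all ! a + table_all ! b) + table_all ! k"
      if "a \<le> k + b" "b \<le> k + a" "k \<le> a + b" "even (k + a + b)" for k
      using table_okD[OF table_ok4 _ _ len that] ab by simp
    have "table_all ! i \<le> table_all ! (a + b)"
      by (rule table_ok_mono[OF table_ok4]) (use i len in \<open>auto simp: add.assoc\<close>)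
    \<comment> \<open>Subadditivity comes out of the recursion itself, because the entry at |a - b|
      is at most the entry at a + b.\<close>
    moreover have "x \<le> y + z" if "w \<le> x" "7 * x \<le> 6 * (y + z) + w" for x y z w :: int
      using that by presburger
    ultimately have "table_all ! (a + b) \<le> table_all ! a + table_all ! b"
      using t[OF i(1-4)] by blast
    moreover have "7 * table_all ! (a + b) \<le> 6 * (table_all ! a + table_all ! b) + table_all ! j"
      using t[OF j] by simp
    ultimately have "real_of_int (7 * table_all ! (a + b)) \<le> real_of_int (6 * (table_all ! a + table_all ! b) + table_all ! j)"
      "real_of_int (table_all ! (a + b)) \<le> real_of_int (table_all ! a + table_all ! b)"
      by (simp_all only: of_int_le_iff)
    then show ?thesis using True j by (simp add: energy_bound_nth)
  next
    case False
    have *: "7 * ?E (x + y) \<le> 6 * (?E x + ?E y) + ?E k \<and> ?E (x + y) \<le> ?E x + ?E y"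
      if x: "x \<ge> 82" and y: "y > 0" and k: "x \<le> k + y" for x y k
    proof -
      have e: "?E x = 120010 / 10000" "?E (x + y) = 120010 / 10000" using x by (simp_all add: energy_bound_def)
      \<comment> \<open>What remains of the inequality at 1/7 when x and x + y are both capped. For
        y \<ge> 6 and k > 0 the value 6 * 1.85 + 1 suffices; k = 0 forces y \<ge> x, and y < 6
        forces k \<ge> 77.\<close>
      have "120010 / 10000 \<le> 6 * ?E y + ?E k"
      proof (cases "y \<ge> 6")
        case True
        show ?thesis
        proof (cases "k = 0")
          case True
          then have "y \<ge> 76" using x k by simp
          then show ?thesis using energy_bound_ge(5)[of y] energy_bound_nonneg[of k] by linarith
        next
          case False
          then show ?thesis using energy_bound_ge(4)[OF \<open>y \<ge> 6\<close>] energy_bound_ge(2)[of k] by simp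
        qed
      next
        case False
        then have "k \<ge> 76" using x k by linarith
        then show ?thesis using energy_bound_ge(5)[of k] energy_bound_ge(2)[of y] y by simp
      qed
      then show ?thesis unfolding e using energy_bound_nonneg[of y] by simp
    qed
    show ?thesis
    proof (cases "a \<ge> 82")
      case True
      then show ?thesis using *[of a b j] ab j by simp
    next
      case False
      then have "b \<ge> 82" using \<open>\<not> (a < 82 \<and> b < 82)\<close> by simp
      then show ?thesis using *[of b a j] ab j by (simp add: add.commute)
    qed
  qed
  define S where "S = ?E a + ?E b"
  define r where "r = 1 / real p"
  have r: "0 \<le> r" "7 * r \<le> 1" using p by (simp_all add: r_def)
  have "0 \<le> (1 - 7 * r) * (S - ?E (a + b)) + r * (6 * S + ?E j - 7 * ?E (a + b))"
    using r key by (intro add_nonneg_nonneg mult_nonneg_nonneg) (auto simp: S_def)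
  also have "\<dots> = (1 - r) * S + r * ?E j - ?E (a + b)" by (simp add: algebra_simps)
  finally show ?thesis by (simp add: S_def r_def)
qed

lemma prime_ge_7:
  assumes "prime (p::nat)" "p \<notin> {2, 3, 5}"
  shows "p \<ge> 7"
proof (rule ccontr)
  assume "\<not> p \<ge> 7"
  then have "p \<in> {0, 1, 2, 3, 4, 5, 6}" by auto
  moreover have "\<not> prime (4::nat)" "\<not> prime (6::nat)" by (auto simp: prime_nat_iff intro: exI[of _ 2])
  ultimately show False using assms by auto
qed

lemma energy_ge_bound:
  assumes "admissible f"
  shows "energy_bound (mass f) \<le> energy f"
proof (rule lower_bound_all_primes[where Q = "{2, 3, 5}" and R = UNIV])
  show "energy_bound (a + b) \<le> (1 - 1 / p) * (energy_bound a + energy_bound b) + 1 / p * energy_bound j"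
    if "prime p" "p \<in> UNIV - {2, 3, 5}" "a > 0" "b > 0" "a \<le> j + b" "b \<le> j + a" "j \<le> a + b" "even (j + a + b)"
    for p a b j :: nat
    using that prime_ge_7[of p] by (intro energy_bound_step) auto
qed (use assms energy_ge_bound5 in auto)

text \<open>Positivity of the form is a by-product of the lower bound. It permits dropping the
  merged term after a cut.\<close>

lemma energy_nonneg: "admissible f \<Longrightarrow> energy f \<ge> 0"
  using energy_ge_bound energy_bound_nonneg order_trans by blast

lemma energy_ge_1: "admissible f \<Longrightarrow> supp f \<noteq> {} \<Longrightarrow> energy f \<ge> 1"
  using energy_ge_bound[of f] energy_bound_ge(2)[of "mass f"] mass_pos[of f] by simp

text \<open>Reversal pairs mass a with mass n - a. The minimum 12.0008 occurs for 76 = 4 + 72, with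
  values 1.3333 and 10.6675.\<close>

definition split_ok :: "nat \<Rightarrow> bool" where
  "split_ok n \<longleftrightarrow> list_all2 (\<lambda>x y. 120008 \<le> x + y) (take (n - 1) (tl table_all)) (rev (take (n - 1) (tl table_all)))"

lemma split_ok: "split_ok 76" "split_ok 78" "split_ok 80"
  unfolding split_ok_def table_all_def table5_def by code_simp+

lemma energy_bound_split:
  assumes ab: "a > 0" "b > 0" and n: "a + b \<in> {76, 78, 80}"
  shows "energy_bound a + energy_bound b \<ge> 12.0008"
proof -
  let ?n = "a + b" and ?t = "take (a + b - 1) (tl table_all)"
  have "split_ok ?n" using n split_ok by auto
  then have l: "list_all2 (\<lambda>x y. 120008 \<le> x + y) ?t (rev ?t)" by (simp add: split_ok_def)
  have len: "length ?t = ?n - 1" using n length_tables by auto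
  then have "a - 1 < length ?t" using ab by linarith
  with l have "120008 \<le> ?t ! (a - 1) + rev ?t ! (a - 1)" by (rule list_all2_nthD)
  moreover have "?t ! (a - 1) = table_all ! a" using ab n length_tables by (auto simp: nth_tl)
  moreover have "rev ?t ! (a - 1) = table_all ! b"
  proof -
    have "rev ?t ! (a - 1) = ?t ! (length ?t - Suc (a - 1))" using len ab by (intro rev_nth) auto
    also have "length ?t - Suc (a - 1) = b - 1" using len ab by auto
    finally show ?thesis using ab n length_tables by (auto simp: nth_tl)
  qed
  ultimately have "120008 \<le> table_all ! a + table_all ! b" by simp
  then have "real_of_int 120008 \<le> real_of_int (table_all ! a + table_all ! b)" by (simp only: of_int_le_iff)
  then show ?thesis using ab n by (auto simp: energy_bound_nth)
qed

section \<open>Mertens' third theorem\<close>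

definition primes_upto :: "nat \<Rightarrow> nat set" where
  "primes_upto n = {p. prime p \<and> p \<le> n}"

lemma finite_primes_upto [simp]: "finite (primes_upto n)"
  by (rule finite_subset[of _ "{..n}"]) (auto simp: primes_upto_def)

lemma primes_upto_ge_2: "p \<in> primes_upto n \<Longrightarrow> p \<ge> 2"
  by (simp add: primes_upto_def prime_ge_2_nat)

section \<open>Chebyshev's upper bound\<close>

lemma prod_primes_dvd:
  fixes x :: nat
  assumes "finite P" "\<And>p. p \<in> P \<Longrightarrow> prime p \<and> p dvd x"
  shows "\<Prod>P dvd x"
  using assms
proof (induction P)
  case (insert q P)
  have "coprime q (\<Prod>P)"
    using insert by (intro prod_coprime_right) (metis insertCI primes_coprime)
  then show ?case using insert by (simp add: divides_mult)
qed simp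

text \<open>Erdos's argument: the primes in (m + 1, 2m + 1] divide a binomial coefficient that
  occurs twice in a row with sum 2^(2m+1), hence is at most 4^m; the primes up to m + 1 are left to
  induction.\<close>

lemma primorial_le: "\<Prod>(primes_upto n) \<le> 4 ^ n"
proof (induction n rule: less_induct)
  case (less n)
  have "n \<le> 1 \<or> n = 2 \<or> n > 2 \<and> even n \<or> (\<exists>m\<ge>1. n = 2 * m + 1)" by presburger
  then consider "n \<le> 1" | "n = 2" | "n > 2" "even n" | m where "n = 2 * m + 1" "m \<ge> 1" by blast
  then show ?case
  proof cases
    case 1
    then have "primes_upto n = {}" by (auto simp: primes_upto_def dest: prime_ge_2_nat)
    then show ?thesis by simp
  next
    case 2
    have "p = 2" if "p \<in> primes_upto 2" for p
      using primes_upto_ge_2[OF that] that by (simp add: primes_upto_def)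
    then have "primes_upto 2 = {2}" by (auto simp: primes_upto_def)
    then show ?thesis using 2 by simp
  next
    case 3
    have "\<not> prime n" using 3 by (metis prime_odd_nat)
    then have "primes_upto n = primes_upto (n - 1)"
      using 3 by (auto simp: primes_upto_def le_eq_less_or_eq)
    then have "\<Prod>(primes_upto n) \<le> 4 ^ (n - 1)" using less[of "n - 1"] 3 by simp
    also have "\<dots> \<le> 4 ^ n" by (rule power_increasing) auto
    finally show ?thesis .
  next
    case (4 m)
    define S where "S = {p. prime p \<and> m + 1 < p \<and> p \<le> 2 * m + 1}"
    have finS: "finite S" by (rule finite_subset[of _ "{..2 * m + 1}"]) (auto simp: S_def)
    have eq: "primes_upto n = primes_upto (m + 1) \<union> S" "primes_upto (m + 1) \<inter> S = {}"
      using 4 by (auto simp: primes_upto_def S_def)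
    have "\<Prod>S dvd (2 * m + 1 choose m)"
    proof (rule prod_primes_dvd[OF finS])
      fix p assume p: "p \<in> S"
      have "fact m * fact (m + 1) * (2 * m + 1 choose m) = (fact (2 * m + 1) :: nat)"
        using binomial_fact_lemma[of m "2 * m + 1"] by simp
      moreover have "p dvd (fact (2 * m + 1) :: nat)" using p by (subst prime_dvd_fact_iff) (auto simp: S_def)
      ultimately have "p dvd fact m * fact (m + 1) * (2 * m + 1 choose m)" by simp
      moreover have "\<not> p dvd (fact m :: nat)" "\<not> p dvd (fact (m + 1) :: nat)"
        using p by (subst prime_dvd_fact_iff; auto simp: S_def)+
      ultimately show "prime p \<and> p dvd (2 * m + 1 choose m)"
        using p by (auto simp: S_def prime_dvd_mult_iff)
    qed
    then have "\<Prod>S \<le> (2 * m + 1 choose m)" by (rule dvd_imp_le) simp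
    also have "\<dots> \<le> 4 ^ m"
    proof -
      have "(\<Sum>k\<in>{m, m + 1}. (2 * m + 1 choose k)) \<le> (\<Sum>k\<le>2 * m + 1. (2 * m + 1 choose k))"
        by (rule sum_mono2) auto
      moreover have "(2 * m + 1 choose (m + 1)) = (2 * m + 1 choose m)"
        using binomial_symmetric[of m "2 * m + 1"] by simp
      ultimately have "2 * (2 * m + 1 choose m) \<le> 2 ^ (2 * m + 1)"
        by (simp only: choose_row_sum) simp
      also have "(2::nat) ^ (2 * m + 1) = 2 * 4 ^ m" by (simp add: power_mult)
      finally show ?thesis by simp
    qed
    finally have S: "\<Prod>S \<le> 4 ^ m" .
    have "\<Prod>(primes_upto n) = \<Prod>(primes_upto (m + 1)) * \<Prod>S"
      unfolding eq(1) using finS eq(2) by (intro prod.union_disjoint) auto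
    also have "\<dots> \<le> 4 ^ (m + 1) * 4 ^ m" using less[of "m + 1"] 4 S by (intro mult_mono) auto
    also have "\<dots> = 4 ^ n" using 4 by (simp add: power_add[symmetric] mult_2)
    finally show ?thesis .
  qed
qed

lemma sum_ln_primes_le: "(\<Sum>p\<in>primes_upto n. ln (real p)) \<le> n * ln 4"
proof -
  have pos: "real p > 0" if "p \<in> primes_upto n" for p using primes_upto_ge_2[OF that] by simp
  have "(\<Sum>p\<in>primes_upto n. ln (real p)) = ln (\<Prod>p\<in>primes_upto n. real p)"
    using pos by (intro ln_prod[symmetric]) auto
  also have "\<dots> \<le> ln (4 ^ n)"
  proof -
    have "(\<Prod>p\<in>primes_upto n. real p) = real (\<Prod>(primes_upto n))" by simp
    also have "\<dots> \<le> real (4 ^ n)" using primorial_le[of n] by (simp only: of_nat_le_iff)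
    finally have "(\<Prod>p\<in>primes_upto n. real p) \<le> 4 ^ n" by simp
    moreover have "(\<Prod>p\<in>primes_upto n. real p) > 0" using pos by (intro prod_pos) auto
    ultimately show ?thesis by simp
  qed
  finally show ?thesis by (simp add: ln_realpow)
qed

section \<open>Mertens' first theorem\<close>

lemma ln_fact_eq_sum_primes:
  "ln (fact n :: real) = (\<Sum>p\<in>primes_upto n. real (multiplicity p (fact n :: nat)) * ln p)"
proof -
  have pf: "prime_factors (fact n :: nat) = primes_upto n"
    by (auto simp: primes_upto_def prime_factors_dvd prime_dvd_fact_iff)
  have "(fact n :: nat) = (\<Prod>p\<in>primes_upto n. p ^ multiplicity p (fact n :: nat))"
    unfolding pf[symmetric] by (rule prime_factorization_nat) simp
  then have "real (fact n) = (\<Prod>p\<in>primes_upto n. real p ^ multiplicity p (fact n :: nat))"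
    by (metis (mono_tags, lifting) of_nat_power of_nat_prod prod.cong)
  then have "ln (fact n :: real) = ln (\<Prod>p\<in>primes_upto n. real p ^ multiplicity p (fact n :: nat))" by simp
  also have "\<dots> = (\<Sum>p\<in>primes_upto n. ln (real p ^ multiplicity p (fact n :: nat)))"
    by (rule ln_prod) (auto dest: primes_upto_ge_2)
  also have "\<dots> = (\<Sum>p\<in>primes_upto n. real (multiplicity p (fact n :: nat)) * ln p)"
    by (intro sum.cong refl) (auto dest: primes_upto_ge_2 simp: ln_realpow)
  finally show ?thesis .
qed

lemma multiplicity_fact_le:
  assumes p: "prime (p::nat)"
  shows "multiplicity p (fact n :: nat) * (p - 1) \<le> n"
proof (induction n rule: less_induct)
  case (less n)
  show ?case
  proof (cases "n = 0")
    case False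
    have p1: "p > 1" using p prime_gt_1_nat by blast
    have "multiplicity p (fact n :: nat) * (p - 1)
        = n div p * (p - 1) + multiplicity p (fact (n div p) :: nat) * (p - 1)"
      using multiplicity_fact_rec[OF p, of n] by (simp add: add_mult_distrib)
    also have "\<dots> \<le> n div p * (p - 1) + n div p"
      using less[of "n div p"] False p1 by simp
    also have "\<dots> = n div p * p" using p1 by (metis add.commute mult_eq_if mult.commute not_one_less_zero)
    also have "\<dots> \<le> n" by simp
    finally show ?thesis .
  qed simp
qed

text \<open>A convergent majorant for the sum of ln p / (p (p - 1)), obtained from ln p \<le> 2 sqrt
  p and p - 1 \<ge> p/2. The second-order errors below are measured against it.\<close>

definition ln_sum_bound :: real where
  "ln_sum_bound = suminf (\<lambda>n. 4 * real n powr (- 3/2))"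

lemma sum_ln_over_square_le:
  assumes "finite P" "\<And>p. p \<in> P \<Longrightarrow> p \<ge> 2"
  shows "(\<Sum>p\<in>P. ln (real p) / (real p * (real p - 1))) \<le> ln_sum_bound"
proof -
  have *: "ln (real p) / (real p * (real p - 1)) \<le> 4 * real p powr (- 3/2)" if "p \<in> P" for p
  proof -
    have p: "real p \<ge> 2" using assms(2)[OF that] by simp
    have "ln (real p) = 2 * ln (sqrt p)" using p by (simp add: ln_sqrt)
    also have "\<dots> \<le> 2 * sqrt p" using p ln_le_minus_one[of "sqrt p"] by simp
    finally have "ln (real p) / (real p * (real p - 1)) \<le> 2 * sqrt p / (real p * (real p / 2))"
      using p by (intro frac_le mult_left_mono) auto
    also have "\<dots> = 4 * (real p powr (1/2) / real p powr 2)"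
      using p by (simp add: powr_half_sqrt power2_eq_square)
    also have "\<dots> = 4 * real p powr (1/2 - 2)" by (simp only: powr_diff)
    also have "\<dots> = 4 * real p powr (- 3/2)" by simp
    finally show ?thesis .
  qed
  have s: "summable (\<lambda>n. 4 * real n powr (- 3/2))"
    by (intro summable_mult) (simp add: summable_real_powr_iff)
  have "(\<Sum>p\<in>P. ln (real p) / (real p * (real p - 1))) \<le> (\<Sum>p\<in>P. 4 * real p powr (- 3/2))"
    by (rule sum_mono[OF *])
  also have "\<dots> \<le> ln_sum_bound"
    unfolding ln_sum_bound_def using s assms(1) by (intro sum_le_suminf) auto
  finally show ?thesis .
qed

lemma ln_fact_ge: "n * ln (real n) - n \<le> ln (fact n :: real)"
proof (induction n)
  case (Suc n)
  show ?case
  proof (cases "n = 0")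
    case False
    have "real n * (ln (real (Suc n)) - ln (real n)) \<le> 1"
    proof -
      have "ln (real (Suc n)) - ln (real n) = ln (1 + 1 / n)"
      proof -
        have "1 + 1 / real n = real (Suc n) / real n" using False by (simp add: field_simps)
        then show ?thesis using False ln_div[of "real (Suc n)" "real n"] by simp
      qed
      also have "\<dots> \<le> 1 / n" using ln_add_one_self_le_self[of "1 / n"] by simp
      finally show ?thesis using False by (simp add: field_simps)
    qed
    moreover have "ln (fact (Suc n) :: real) = ln (real (Suc n)) + ln (fact n)"
      by (simp add: ln_mult)
    ultimately show ?thesis using Suc by (simp add: algebra_simps)
  qed simp
qed simp

text \<open>The valuation of n! at p lies between n/p - 1 and n/(p - 1). Weighted with ln p this
  compares n A with ln n!: the loss of 1 in each floor costs at most n ln 4 in total, and the excess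
  of 1/(p - 1) over 1/p costs \<open>ln_sum_bound\<close>.\<close>

lemma mertens_first:
  assumes n: "n \<ge> 1"
  shows "\<bar>(\<Sum>p\<in>primes_upto n. ln (real p) / p) - ln n\<bar> \<le> 2 + ln_sum_bound"
proof -
  define A where "A = (\<Sum>p\<in>primes_upto n. ln (real p) / p)"
  let ?P = "primes_upto n"
  have S0: "ln_sum_bound \<ge> 0" using sum_ln_over_square_le[of "{}"] by simp
  have "n * A - (\<Sum>p\<in>?P. ln (real p)) = (\<Sum>p\<in>?P. (n / p - 1) * ln (real p))"
    by (simp add: A_def sum_distrib_left sum_subtractf[symmetric] algebra_simps)
  also have "\<dots> \<le> ln (fact n)"
    unfolding ln_fact_eq_sum_primes
  proof (rule sum_mono)
    fix p assume p: "p \<in> ?P"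
    then have pp: "prime p" "real p \<ge> 2" using primes_upto_ge_2 by (auto simp: primes_upto_def)
    have "n div p \<le> multiplicity p (fact n :: nat)" using multiplicity_fact_rec[OF pp(1), of n] by simp
    moreover have "real n / p - 1 \<le> real (n div p)"
    proof -
      have "n = n div p * p + n mod p" "n mod p < p" using pp(2) by simp_all
      then have "real n = real (n div p) * p + real (n mod p)" "real (n mod p) < p"
        by (metis of_nat_add of_nat_mult, simp)
      then show ?thesis using pp(2) by (simp add: field_simps)
    qed
    ultimately have "real n / p - 1 \<le> real (multiplicity p (fact n :: nat))" by linarith
    then show "(real n / p - 1) * ln (real p) \<le> real (multiplicity p (fact n :: nat)) * ln p"
      using pp by (intro mult_right_mono) auto
  qed
  also have "\<dots> \<le> n * ln n"
  proof -
    have "fact n \<le> real n ^ n" using fact_le_power[of n] by simp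
    then have "ln (fact n :: real) \<le> ln (real n ^ n)" using n by (subst ln_le_cancel_iff) auto
    then show ?thesis using n by (simp add: ln_realpow)
  qed
  finally have "n * A \<le> n * (ln n + ln 4)"
    using sum_ln_primes_le[of n] by (simp add: algebra_simps)
  then have up: "A \<le> ln n + ln 4" using n by simp
  have "ln (4::real) = 2 * ln 2" using ln_realpow[of "2::real" 2] by simp
  then have ln4: "ln (4::real) \<le> 2" using ln_less_self[of 2] ln_2_less_1 by simp
  have "n * ln n - n \<le> ln (fact n)" by (rule ln_fact_ge)
  also have "\<dots> \<le> (\<Sum>p\<in>?P. real n * (ln (real p) / p + ln (real p) / (real p * (real p - 1))))"
    unfolding ln_fact_eq_sum_primes
  proof (rule sum_mono)
    fix p assume p: "p \<in> ?P"
    then have pp: "prime p" "real p \<ge> 2" using primes_upto_ge_2 by (auto simp: primes_upto_def)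
    have "real (multiplicity p (fact n :: nat) * (p - 1)) \<le> real n"
      using multiplicity_fact_le[OF pp(1), of n] by (simp only: of_nat_le_iff)
    then have "real (multiplicity p (fact n :: nat)) \<le> n / (real p - 1)"
      using pp by (simp add: of_nat_diff field_simps)
    then have "real (multiplicity p (fact n :: nat)) * ln p \<le> n / (real p - 1) * ln p"
      using pp by (intro mult_right_mono) auto
    also have "\<dots> = real n * (ln (real p) / p + ln (real p) / (real p * (real p - 1)))"
      using pp by (simp add: field_simps)
    finally show "real (multiplicity p (fact n :: nat)) * ln p
        \<le> real n * (ln (real p) / p + ln (real p) / (real p * (real p - 1)))" .
  qed
  also have "\<dots> = n * (A + (\<Sum>p\<in>?P. ln (real p) / (real p * (real p - 1))))"
    by (simp add: A_def sum.distrib sum_distrib_left distrib_left)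
  also have "\<dots> \<le> n * (A + ln_sum_bound)"
    by (intro mult_left_mono add_left_mono sum_ln_over_square_le) (auto dest: primes_upto_ge_2)
  finally have "n * (ln n - 1) \<le> n * (A + ln_sum_bound)" by (simp add: algebra_simps)
  then have "ln n - 1 \<le> A + ln_sum_bound" using n by simp
  then show ?thesis using up ln4 S0 unfolding A_def by linarith
qed

section \<open>Euler products over finitely many primes and Abel summation\<close>

lemma euler_product_partial:
  fixes s :: real
  assumes s: "s > 1" and P: "finite P" "\<And>p. p \<in> P \<Longrightarrow> prime p"
  defines "f \<equiv> (\<lambda>n::nat. real n powr (- s))"
  shows "infsum f UNIV * (\<Prod>p\<in>P. 1 - f p) = infsum f {n. \<forall>p\<in>P. \<not> p dvd n}"
proof -
  have "summable f" using s by (simp add: f_def summable_real_powr_iff)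
  then have sm: "f summable_on UNIV"
    by (intro norm_summable_imp_summable_on) (simp add: f_def)
  have sub: "f summable_on A" for A using sm summable_on_subset_banach by blast
  show ?thesis using P
  proof (induction P)
    case (insert q P)
    let ?N = "{n. \<forall>p\<in>P. \<not> p dvd n}" and ?N' = "{n. \<forall>p\<in>insert q P. \<not> p dvd n}"
    have q: "prime q" "q > 0" using insert prime_gt_0_nat by auto
    \<comment> \<open>A number free of P is either free of q as well or q times a number free of P;
      the second kind contributes f q times the whole sum.\<close>
    have N: "?N = ?N' \<union> (\<lambda>m. q * m) ` ?N"
    proof (intro equalityI subsetI)
      fix n assume n: "n \<in> ?N"
      show "n \<in> ?N' \<union> (\<lambda>m. q * m) ` ?N"
      proof (cases "q dvd n")
        case True
        then obtain m where m: "n = q * m" by auto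
        then have "m \<in> ?N" using n by auto
        then show ?thesis using m by blast
      qed (use n in auto)
    next
      fix n assume "n \<in> ?N' \<union> (\<lambda>m. q * m) ` ?N"
      then show "n \<in> ?N"
      proof
        assume "n \<in> (\<lambda>m. q * m) ` ?N"
        then obtain m where m: "n = q * m" "m \<in> ?N" by auto
        have "\<not> p dvd q * m" if "p \<in> P" for p
        proof -
          have "prime p" "p \<noteq> q" using that insert by auto
          then have "\<not> p dvd q" using q(1) primes_dvd_imp_eq by blast
          then show ?thesis using that m(2) \<open>prime p\<close> by (auto simp: prime_dvd_mult_iff)
        qed
        then show ?thesis using m by auto
      qed auto
    qed
    have "infsum f ?N = infsum f ?N' + infsum f ((\<lambda>m. q * m) ` ?N)"
      by (subst N, rule infsum_Un_disjoint) (auto intro: sub)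
    also have "infsum f ((\<lambda>m. q * m) ` ?N) = infsum (f \<circ> (\<lambda>m. q * m)) ?N"
      by (rule infsum_reindex) (use q in \<open>auto simp: inj_on_def\<close>)
    also have "f \<circ> (\<lambda>m. q * m) = (\<lambda>m. f q * f m)"
      by (auto simp: f_def powr_mult)
    also have "infsum (\<lambda>m. f q * f m) ?N = f q * infsum f ?N"
      by (rule infsum_cmult_right) (auto intro: sub)
    finally have e: "infsum f ?N = infsum f ?N' + f q * infsum f ?N" .
    have "infsum f ?N * (1 - f q) = infsum f ?N - f q * infsum f ?N"
      by (simp add: algebra_simps)
    with e have "infsum f ?N' = infsum f ?N * (1 - f q)" by linarith
    also have "\<dots> = infsum f UNIV * (\<Prod>p\<in>insert q P. 1 - f p)"
    proof -
      have "(\<Prod>p\<in>insert q P. 1 - f p) = (\<Prod>p\<in>P. 1 - f p) * (1 - f q)"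
        using insert.hyps by (simp add: mult.commute)
      moreover have "infsum f ?N = infsum f UNIV * (\<Prod>p\<in>P. 1 - f p)"
        using insert by simp
      ultimately show ?thesis by (simp only: mult.assoc)
    qed
    finally show ?case by simp
  qed simp
qed

lemma sum_powr_le:
  assumes d: "\<delta> > 0"
  shows "(\<Sum>n=1..N. real n powr (- (1 + \<delta>))) \<le> 1 + 1 / \<delta>"
proof (cases N)
  case (Suc M)
  \<comment> \<open>The subtracted term is the integral of x^(-1-\<delta>) from \<open>Suc M\<close>
    to infinity; with it the induction telescopes.\<close>
  have "(\<Sum>n=1..Suc M. real n powr (- (1 + \<delta>))) \<le> 1 + 1 / \<delta> - real (Suc M) powr (- \<delta>) / \<delta>"
  proof (induction M)
    case (Suc M)
    let ?n = "real (Suc (Suc M))" and ?m = "real (Suc M)"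
    have n: "?n > 1" "?m = ?n * (1 - 1 / ?n)" by (simp_all add: field_simps)
    have "1 + \<delta> / ?n \<le> 1 + (- \<delta> * ln (1 - 1 / ?n))"
    proof -
      have "ln (1 - 1 / ?n) \<le> - (1 / ?n)" 
      proof -
        have "1 - 1 / ?n > 0" using n(1) by simp
        from ln_le_minus_one[OF this] show ?thesis by linarith
      qed
      then have "\<delta> * ln (1 - 1 / ?n) \<le> \<delta> * - (1 / ?n)" using d by (intro mult_left_mono) auto
      then show ?thesis by simp
    qed
    also have "\<dots> \<le> exp (- \<delta> * ln (1 - 1 / ?n))" by (rule exp_ge_add_one_self)
    also have "\<dots> = (1 - 1 / ?n) powr (- \<delta>)"
    proof -
      have "1 - 1 / ?n \<noteq> 0" using n(1) by simp
      then show ?thesis by (simp only: powr_def if_False)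
    qed
    finally have "?n powr (- \<delta>) * (1 + \<delta> / ?n) \<le> ?n powr (- \<delta>) * (1 - 1 / ?n) powr (- \<delta>)"
      by (intro mult_left_mono) auto
    also have "\<dots> = ?m powr (- \<delta>)" unfolding n(2) using n(1) by (subst powr_mult[symmetric]) auto
    finally have "?n powr (- \<delta>) * \<delta> / ?n \<le> ?m powr (- \<delta>) - ?n powr (- \<delta>)"
      by (simp add: algebra_simps)
    moreover have "?n powr (- (1 + \<delta>)) = ?n powr (- \<delta>) / ?n"
    proof -
      have "- (1 + \<delta>) = - \<delta> - 1" by simp
      then show ?thesis using n(1) by (simp only: powr_diff) simp
    qed
    ultimately have "\<delta> * ?n powr (- (1 + \<delta>)) \<le> ?m powr (- \<delta>) - ?n powr (- \<delta>)" by (simp add: mult.commute)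
    then have "?n powr (- (1 + \<delta>)) \<le> ?m powr (- \<delta>) / \<delta> - ?n powr (- \<delta>) / \<delta>"
      using d by (simp add: field_simps)
    then show ?case using Suc by simp
  qed simp
  also have "\<dots> \<le> 1 + 1 / \<delta>" using d by simp
  finally show ?thesis using Suc by simp
qed (use d in simp)

text \<open>The integers free of P include 1, so the sieved sum is at least 1, while zeta(1 +
  \<delta>) is at most 1 + 1/\<delta>. The bound is uniform in P.\<close>

lemma sum_neg_ln_primes_le:
  assumes d: "\<delta> > 0" and P: "finite P" "\<And>p. p \<in> P \<Longrightarrow> prime p"
  shows "(\<Sum>p\<in>P. - ln (1 - real p powr (- (1 + \<delta>)))) \<le> ln (1 + 1 / \<delta>)"
proof -
  define f where "f = (\<lambda>n::nat. real n powr (- (1 + \<delta>)))"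
  let ?N = "{n. \<forall>p\<in>P. \<not> p dvd n}"
  have sm: "summable f" using d by (simp add: f_def summable_real_powr_iff)
  then have smo: "f summable_on A" for A
    by (intro summable_on_subset_banach[OF norm_summable_imp_summable_on]) (auto simp: f_def)
  have nn: "f n \<ge> 0" for n by (simp add: f_def)
  have fin: "sum f F \<le> 1 + 1 / \<delta>" if F: "finite F" for F
  proof -
    obtain N where N: "F \<subseteq> {..N}" using F finite_nat_iff_bounded_le by blast
    have "sum f F \<le> sum f {..N}" by (rule sum_mono2) (use N nn in auto)
    also have "\<dots> = sum f {1..N}"
      by (rule sum.mono_neutral_right) (auto simp: f_def)
    also have "\<dots> \<le> 1 + 1 / \<delta>" unfolding f_def by (rule sum_powr_le[OF d])
    finally show ?thesis .
  qed
  have Z: "infsum f UNIV \<le> 1 + 1 / \<delta>"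
    by (rule infsum_le_finite_sums[OF smo fin]) auto
  have "1 = sum f {1}" by (simp add: f_def)
  also have "\<dots> \<le> infsum f ?N"
  proof (rule finite_sum_le_infsum[OF smo])
    show "{1} \<subseteq> ?N" using P(2)[of 1] by auto
  qed (use nn in auto)
  also have "\<dots> = infsum f UNIV * (\<Prod>p\<in>P. 1 - f p)"
    unfolding f_def by (rule euler_product_partial[symmetric]) (use d P in auto)
  finally have 1: "1 \<le> infsum f UNIV * (\<Prod>p\<in>P. 1 - f p)" .
  have lt: "f p < 1" if "p \<in> P" for p
    using P(2)[OF that] prime_gt_1_nat[of p] d by (auto simp: f_def powr_less_one)
  have pos: "(\<Prod>p\<in>P. 1 - f p) > 0" using lt by (intro prod_pos) auto
  have "1 \<le> (1 + 1 / \<delta>) * (\<Prod>p\<in>P. 1 - f p)"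
    using 1 mult_right_mono[OF Z less_imp_le[OF pos]] by (rule order_trans)
  then have "ln 1 \<le> ln ((1 + 1 / \<delta>) * (\<Prod>p\<in>P. 1 - f p))"
    by (subst ln_le_cancel_iff) (auto intro: less_le_trans[OF zero_less_one])
  also have "\<dots> = ln (1 + 1 / \<delta>) + ln (\<Prod>p\<in>P. 1 - f p)"
    using d pos by (intro ln_mult_pos) (auto intro: add_pos_pos)
  also have "ln (\<Prod>p\<in>P. 1 - f p) = (\<Sum>p\<in>P. ln (1 - f p))"
    by (intro ln_prod P(1)) (use lt in fastforce)
  finally show ?thesis by (simp add: f_def sum_negf)
qed

text \<open>Abel's theorem in one-sided form: the power series at exp(-\<delta>) tends to the sum of
  the series as \<delta> tends to 0, so a bound of order \<delta> excludes a positive sum.\<close>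

lemma abel_limit_nonpos:
  fixes c :: "nat \<Rightarrow> real"
  assumes lim: "(\<lambda>n. \<Sum>i\<le>n. c i) \<longlonglongrightarrow> \<tau>"
    and le: "\<And>\<delta>. \<delta> > 0 \<Longrightarrow> suminf (\<lambda>n. c n * exp (- \<delta>) ^ n) \<le> B * \<delta>"
  shows "\<tau> \<le> 0"
proof (rule ccontr)
  assume "\<not> \<tau> \<le> 0"
  then have \<tau>: "\<tau> > 0" by simp
  define T where "T = (\<lambda>n. \<Sum>i\<le>n. c i)"
  have lim': "T \<longlonglongrightarrow> \<tau>" using lim by (simp add: T_def)
  have "Bseq T" by (rule convergent_imp_Bseq[OF convergentI[OF lim']])
  then obtain C where C: "\<And>n. \<bar>T n\<bar> \<le> C" by (auto simp: Bseq_def)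
  have C0: "C \<ge> 0" using C[of 0] by linarith
  have "eventually (\<lambda>n. T n > \<tau> / 2) sequentially"
    by (rule order_tendstoD(1)[OF lim']) (use \<tau> in simp)
  then obtain J where J: "\<And>n. n \<ge> J \<Longrightarrow> T n > \<tau> / 2" unfolding eventually_sequentially by blast
  define M where "M = C + \<tau> / 2"
  \<comment> \<open>M bounds the possible deficit of each of the first J partial sums; \<delta> is
    so small that all errors together stay within \<tau>/4.\<close>
  define \<delta> where "\<delta> = \<tau> / (4 * (\<bar>B\<bar> + J * M + 1))"
  have M0: "M \<ge> 0" using C0 \<tau> by (simp add: M_def)
  then have den: "\<bar>B\<bar> + J * M + 1 > 0" by (intro add_nonneg_pos) auto
  have \<delta>: "\<delta> > 0" using \<tau> den by (simp add: \<delta>_def)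
  define x where "x = exp (- \<delta>)"
  have x: "0 < x" "x < 1" using \<delta> by (simp_all add: x_def)
  have x1: "1 - x \<le> \<delta>" using exp_ge_add_one_self[of "- \<delta>"] by (simp add: x_def)
  have cb: "\<bar>c n\<bar> \<le> 2 * C" for n
  proof (cases n)
    case 0
    then show ?thesis using C[of 0] C0 by (simp add: T_def)
  next
    case (Suc m)
    then have "c n = T n - T m" by (simp add: T_def)
    then show ?thesis using C[of n] C[of m] by linarith
  qed
  have sx: "summable (\<lambda>n. x ^ n)" using x by (intro summable_geometric) simp
  have sc: "summable (\<lambda>n. norm (c n * x ^ n))"
  proof (rule summable_comparison_test')
    show "summable (\<lambda>n. 2 * C * x ^ n)" using sx by (rule summable_mult)
    show "norm (norm (c n * x ^ n)) \<le> 2 * C * x ^ n" if "n \<ge> 0" for n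
      using cb[of n] x by (simp add: abs_mult mult_right_mono)
  qed
  \<comment> \<open>The Cauchy product with the geometric series replaces the coefficients by their
    partial sums.\<close>
  have "(\<lambda>k. \<Sum>i\<le>k. (c i * x ^ i) * x ^ (k - i)) sums (suminf (\<lambda>n. c n * x ^ n) * suminf (\<lambda>n. x ^ n))"
    using sx x by (intro Cauchy_product_sums sc) simp
  moreover have "(\<Sum>i\<le>k. (c i * x ^ i) * x ^ (k - i)) = T k * x ^ k" for k
    unfolding T_def sum_distrib_right
    by (intro sum.cong refl) (simp add: mult.assoc power_add[symmetric])
  ultimately have Y: "(\<lambda>k. T k * x ^ k) sums (suminf (\<lambda>n. c n * x ^ n) * (1 / (1 - x)))"
    using x by (simp add: suminf_geometric)
  have lower_sums: "(\<lambda>k. \<tau> / 2 * x ^ k - (if k \<in> {..<J} then M else 0)) sums (\<tau> / 2 * (1 / (1 - x)) - (\<Sum>k\<in>{..<J}. M))"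
    using x by (intro sums_diff sums_mult geometric_sums sums_If_finite_set) auto
  have lower_le: "\<tau> / 2 * x ^ k - (if k \<in> {..<J} then M else 0) \<le> T k * x ^ k" for k
  proof (cases "k < J")
    case True
    have "\<tau> / 2 * x ^ k - T k * x ^ k = (\<tau> / 2 - T k) * x ^ k" by (simp add: left_diff_distrib)
    also have "\<dots> \<le> M * x ^ k" 
    proof (rule mult_right_mono)
      show "\<tau> / 2 - T k \<le> M" using C[of k] unfolding M_def by linarith
    qed (use x in simp)
    also have "\<dots> \<le> M * 1" using x M0 by (intro mult_left_mono power_le_one) auto
    finally show ?thesis using True by simp
  next
    case False
    then show ?thesis using J[of k] x by (simp add: mult_right_mono)
  qed
  have "\<tau> / 2 * (1 / (1 - x)) - (\<Sum>k\<in>{..<J}. M) \<le> suminf (\<lambda>n. c n * x ^ n) * (1 / (1 - x))"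
    by (rule sums_le[OF lower_le lower_sums Y])
  then have "(\<tau> / 2 * (1 / (1 - x)) - J * M) * (1 - x) \<le> suminf (\<lambda>n. c n * x ^ n) * (1 / (1 - x)) * (1 - x)"
    by (intro mult_right_mono) (use x in simp_all)
  moreover have "1 / (1 - x) * (1 - x) = 1" using x by simp
  ultimately have "\<tau> / 2 - (1 - x) * (J * M) \<le> suminf (\<lambda>n. c n * x ^ n)"
    by (simp only: left_diff_distrib mult.assoc mult_1_right) (simp add: algebra_simps)
  moreover have "suminf (\<lambda>n. c n * x ^ n) \<le> B * \<delta>" using le[OF \<delta>] by (simp add: x_def)
  moreover have "(1 - x) * (J * M) \<le> \<delta> * (J * M)" using x1 M0 by (intro mult_right_mono) auto
  moreover have "B * \<delta> \<le> \<bar>B\<bar> * \<delta>" using \<delta> by (intro mult_right_mono) auto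
  ultimately have "\<tau> / 2 \<le> \<delta> * (\<bar>B\<bar> + J * M)" by (simp add: algebra_simps)
  also have "\<dots> \<le> \<delta> * (\<bar>B\<bar> + J * M + 1)" using \<delta> by (intro mult_left_mono) auto
  also have "\<dots> = \<tau> / 4"
  proof -
    have "\<tau> / (4 * X) * X = \<tau> / 4" if "X > 0" for X :: real using that by simp
    then show ?thesis unfolding \<delta>_def using den by blast
  qed
  finally show False using \<tau> by simp
qed

text \<open>Moving p^(-\<delta>) inside the logarithm costs \<delta> times the term of a convergent
  series, so the total over all primes is of order \<delta>.\<close>

lemma neg_ln_prime_le:
  assumes p: "p \<ge> (2::nat)" and d: "\<delta> > 0"
  shows "- ln (1 - 1 / p) * real p powr (- \<delta>)
    \<le> - ln (1 - real p powr (- (1 + \<delta>))) + \<delta> * (ln (real p) / (real p * (real p - 1)))"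
proof -
  define t \<theta> where "t = 1 / real p" and "\<theta> = real p powr (- \<delta>)"
  have t: "0 < t" "t < 1" using p by (simp_all add: t_def)
  have \<theta>: "0 < \<theta>" "\<theta> < 1" using p d by (simp_all add: \<theta>_def powr_less_one)
  have q: "real p powr (- (1 + \<delta>)) = t * \<theta>"
  proof -
    have "- (1 + \<delta>) = - \<delta> - 1" by simp
    then have "real p powr (- (1 + \<delta>)) = real p powr (- \<delta>) / real p powr 1" by (simp only: powr_diff)
    then show ?thesis using p by (simp add: t_def \<theta>_def)
  qed
  have tq: "t * \<theta> < t" using t \<theta> by simp
  then have tq1: "t * \<theta> < 1" using t by linarith
  have "1 - \<theta> \<le> \<delta> * ln p"
    using exp_ge_add_one_self[of "- \<delta> * ln p"] p by (simp add: \<theta>_def powr_def)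
  then have td: "t - t * \<theta> \<le> t * (\<delta> * ln p)"
    using mult_left_mono[of "1 - \<theta>" "\<delta> * ln p" t] t by (simp add: right_diff_distrib)
  have "ln ((1 - t * \<theta>) / (1 - t)) \<le> (1 - t * \<theta>) / (1 - t) - 1"
    using t tq1 by (intro ln_le_minus_one) (auto intro!: divide_pos_pos)
  also have "\<dots> = (t - t * \<theta>) / (1 - t)" using t by (simp add: field_simps)
  finally have "ln (1 - t * \<theta>) - ln (1 - t) \<le> (t - t * \<theta>) / (1 - t)"
    using t tq1 by (simp add: ln_div)
  moreover have "(t - t * \<theta>) / (1 - t) - (t - t * \<theta>) = (t - t * \<theta>) * (t / (1 - t))"
    using t by (simp add: field_simps)
  moreover have "(t - t * \<theta>) * (t / (1 - t)) \<le> t * (\<delta> * ln p) * (t / (1 - t))"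
    using td t by (intro mult_right_mono) auto
  moreover have "t * (t / (1 - t)) = 1 / (real p * (real p - 1))"
    using p by (simp add: t_def field_simps)
  then have "t * (\<delta> * ln p) * (t / (1 - t)) = \<delta> * (ln (real p) / (real p * (real p - 1)))"
    by (metis (no_types, lifting) mult.assoc mult.commute mult.left_commute times_divide_eq_right mult.right_neutral)
  ultimately have "ln (1 - t * \<theta>) - ln (1 - t) - (t - t * \<theta>) \<le> \<delta> * (ln (real p) / (real p * (real p - 1)))"
    by linarith
  moreover have "- ln (1 - t) \<ge> t" using ln_le_minus_one[of "1 - t"] t by simp
  then have "(- ln (1 - t) - t) * \<theta> \<le> (- ln (1 - t) - t) * 1" using \<theta> by (intro mult_left_mono) auto
  then have "- ln (1 - t) * \<theta> \<le> t * \<theta> - ln (1 - t) - t" by (simp add: algebra_simps)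
  ultimately show ?thesis unfolding q unfolding t_def[symmetric] \<theta>_def[symmetric] by linarith
qed

section \<open>Blocks of primes between consecutive powers of e\<close>

definition primes_below_exp :: "nat \<Rightarrow> nat set" where
  "primes_below_exp k = primes_upto (nat \<lfloor>exp (real k)\<rfloor>)"

lemma primes_below_exp: "p \<in> primes_below_exp k \<longleftrightarrow> prime p \<and> real p \<le> exp k"
  by (auto simp: primes_below_exp_def primes_upto_def le_nat_floor) (simp add: le_floor_iff le_nat_iff)

lemma finite_primes_below_exp [simp]: "finite (primes_below_exp k)"
  by (simp add: primes_below_exp_def)

text \<open>For n \<ge> 1 a block has n - 1 < ln p \<le> n, which turns sums over primes into series
  over n comparable with the harmonic series. Truncated subtraction makes block 0 empty, in
  agreement with the absence of primes up to e^0.\<close>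

definition prime_block :: "nat \<Rightarrow> nat set" where
  "prime_block n = primes_below_exp n - primes_below_exp (n - 1)"

lemma sum_prime_blocks:
  fixes F :: "nat \<Rightarrow> real"
  shows "(\<Sum>i\<le>n. sum F (prime_block i)) = sum F (primes_below_exp n)"
proof (induction n)
  case 0
  have "p \<notin> primes_below_exp 0" for p using prime_ge_2_nat[of p] by (auto simp: primes_below_exp)
  then have "primes_below_exp 0 = {}" by auto
  then show ?case by (simp add: prime_block_def)
next
  case (Suc n)
  have "primes_below_exp n \<subseteq> primes_below_exp (Suc n)"
  proof
    fix p assume "p \<in> primes_below_exp n"
    then have "prime p" "real p \<le> exp (real n)" by (auto simp: primes_below_exp)
    moreover have "exp (real n) \<le> exp (real (Suc n))" by simp
    ultimately show "p \<in> primes_below_exp (Suc n)" unfolding primes_below_exp by linarith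
  qed
  then have "sum F (primes_below_exp (Suc n)) = sum F (prime_block (Suc n)) + sum F (primes_below_exp n)"
    unfolding prime_block_def by (simp add: sum.subset_diff)
  then show ?case using Suc by simp
qed

lemma prime_blockD:
  assumes "p \<in> prime_block n"
  shows "prime p" "p \<ge> 2" "real p \<le> exp n" "n \<ge> 1 \<Longrightarrow> real p > exp (real n - 1)" "ln (real p) \<le> n"
proof -
  show p: "prime p" "real p \<le> exp n" using assms by (auto simp: prime_block_def primes_below_exp)
  show "p \<ge> 2" using p prime_ge_2_nat by blast
  then show "ln (real p) \<le> n" 
    using p ln_le_cancel_iff[of "real p" "exp n"] by simp
  show "real p > exp (real n - 1)" if "n \<ge> 1"
    using assms that p by (auto simp: prime_block_def primes_below_exp of_nat_diff not_le)
qed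

definition prime_weight :: "nat \<Rightarrow> real" where
  "prime_weight p = - ln (1 - 1 / p)"

text \<open>The factor 2 ln p \<ge> 1 is inserted into the second bound to give the error the shape
  that \<open>ln_sum_bound\<close> majorizes.\<close>

lemma prime_weight_bounds:
  assumes p: "p \<ge> (2::nat)"
  shows "1 / p \<le> prime_weight p" "prime_weight p - 1 / p \<le> 2 * (ln (real p) / (real p * (real p - 1)))"
proof -
  have p2: "real p \<ge> 2" using p by simp
  have "ln (1 - 1 / p) \<le> - (1 / p)" using ln_le_minus_one[of "1 - 1 / p"] p2 by simp
  then show "1 / p \<le> prime_weight p" by (simp add: prime_weight_def)
  have "prime_weight p = ln (1 + 1 / (real p - 1))"
  proof -
    have "1 + 1 / (real p - 1) = inverse (1 - 1 / p)" using p2 by (simp add: field_simps)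
    then show ?thesis using p2 by (simp add: prime_weight_def ln_inverse)
  qed
  also have "\<dots> \<le> 1 / (real p - 1)" using p2 by (intro ln_add_one_self_le_self) simp
  finally have "prime_weight p - 1 / p \<le> 1 / (real p - 1) - 1 / p" by simp
  also have "\<dots> = 1 / (real p * (real p - 1))" using p2 by (simp add: field_simps)
  also have "\<dots> \<le> 2 * ln p / (real p * (real p - 1))"
  proof (rule divide_right_mono)
    have "ln (inverse (2::real)) \<le> inverse 2 - 1" by (rule ln_le_minus_one) simp
    then have "1 / 2 \<le> ln (2::real)" by (simp add: ln_div)
    moreover have "ln (2::real) \<le> ln p" using p2 by simp
    ultimately show "1 \<le> 2 * ln (real p)" by simp
  qed (use p2 in simp)
  finally show "prime_weight p - 1 / p \<le> 2 * (ln (real p) / (real p * (real p - 1)))" by simp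
qed

text \<open>Block n has weight about 1/n. The partial sums are minus the logarithm of the product of
  1 - 1/p, less the harmonic number; the term at 0 vanishes because division by zero gives
  0.\<close>

definition block_defect :: "nat \<Rightarrow> real" where
  "block_defect n = sum prime_weight (prime_block n) - 1 / n"

lemma finite_prime_block [simp]: "finite (prime_block n)"
  by (simp add: prime_block_def)

text \<open>By \<open>mertens_first\<close> the function R, the excess of the sum of ln p / p up to
  e^k over k, is bounded. A block sum of ln p / p is 1 plus an increment of R, and increments of R
  divided by n are summable by parts. E is the error of replacing \<open>prime_weight p\<close> by
  ln p / (p n).\<close>

lemma summable_block_defect: "summable block_defect"
proof -
  define A where "A = (\<lambda>k. \<Sum>p\<in>primes_below_exp k. ln (real p) / p)"
  define R where "R = (\<lambda>k. A k - real k)"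
  define C where "C = 3 + ln_sum_bound"
  define a where "a = (\<lambda>n. \<Sum>p\<in>prime_block n. ln (real p) / p)"
  define s where "s = (\<lambda>n. \<Sum>p\<in>prime_block n. ln (real p) / (real p * (real p - 1)))"
  define E where "E = (\<lambda>n. \<Sum>p\<in>prime_block n. prime_weight p - ln (real p) / p / n)"
  have R: "\<bar>R k\<bar> \<le> C" for k
  proof -
    define n where "n = nat \<lfloor>exp (real k)\<rfloor>"
    have e: "exp (real k) \<ge> 1" by simp
    have n1: "n \<ge> 1" using e unfolding n_def by linarith
    have n2: "real n \<le> exp k" "exp k < real n + 1" using e unfolding n_def by linarith+
    have "ln n \<le> k" using n1 n2 ln_le_cancel_iff[of "real n" "exp k"] by simp
    moreover have "k \<le> ln n + 1"
    proof -
      have "exp (real k) \<le> exp 1 * n"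
      proof -
        have "2 * real n \<le> exp 1 * n" using exp_ge_add_one_self[of 1] by (intro mult_right_mono) auto
        then show ?thesis using n1 n2 by linarith
      qed
      then have "ln (exp (real k)) \<le> ln (exp 1 * real n)"
        using n1 by (subst ln_le_cancel_iff) auto
      then show ?thesis using n1 by (simp add: ln_mult)
    qed
    ultimately show ?thesis
      using mertens_first[OF n1] unfolding R_def A_def C_def primes_below_exp_def n_def[symmetric] by linarith
  qed
  have R0: "R 0 = 0"
  proof -
    have "p \<notin> primes_below_exp 0" for p using prime_ge_2_nat[of p] by (auto simp: primes_below_exp)
    then have "primes_below_exp 0 = {}" by auto
    then show ?thesis by (simp add: R_def A_def)
  qed
  have C0: "C \<ge> 0" using R[of 0] by linarith
  have aR: "a (Suc m) = 1 + (R (Suc m) - R m)" for m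
    using sum_prime_blocks[of "\<lambda>p. ln (real p) / p" "Suc m"] sum_prime_blocks[of "\<lambda>p. ln (real p) / p" m]
    by (simp add: a_def R_def A_def)
  have cE: "block_defect (Suc m) = (R (Suc m) - R m) / real (Suc m) + E (Suc m)" for m
  proof -
    have "E (Suc m) = sum prime_weight (prime_block (Suc m)) - a (Suc m) / real (Suc m)"
      by (simp add: E_def a_def sum_subtractf sum_divide_distrib)
    then show ?thesis unfolding block_defect_def aR by (simp add: add_divide_distrib)
  qed
  have s0: "s n \<ge> 0" for n
    unfolding s_def by (intro sum_nonneg divide_nonneg_nonneg mult_nonneg_nonneg) (auto dest: prime_blockD(2))
  have sums: "summable s"
  proof (rule bounded_imp_summable)
    show "(\<Sum>k\<le>n. s k) \<le> ln_sum_bound" for n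
      unfolding s_def sum_prime_blocks
      by (rule sum_ln_over_square_le) (auto simp: primes_below_exp prime_ge_2_nat)
  qed (rule s0)
  have sq: "summable (\<lambda>n. inverse (real n ^ 2))" by (rule inverse_power_summable) simp
  have E0: "E n \<ge> 0" for n
    unfolding E_def
  proof (rule sum_nonneg)
    fix p assume p: "p \<in> prime_block n"
    have p2: "real p \<ge> 2" using prime_blockD(2)[OF p] by simp
    have "ln p / n \<le> 1" using prime_blockD(5)[OF p] by (cases "n = 0") (auto simp: field_simps)
    then have "ln p / n / p \<le> 1 / p" using p2 by (intro divide_right_mono) auto
    then show "0 \<le> prime_weight p - ln (real p) / p / n"
      using prime_weight_bounds(1)[OF prime_blockD(2)[OF p]] by (simp add: field_simps)
  qed
  have Ele: "E n \<le> 2 * s n + 2 * (1 + 2 * C) * inverse (real n ^ 2)" if n: "n \<ge> 2" for n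
  proof -
    have n': "real n \<ge> 2" using n by simp
    have "E n \<le> (\<Sum>p\<in>prime_block n. 2 * (ln (real p) / (real p * (real p - 1))) + ln (real p) / p * (1 / (n * (real n - 1))))"
      unfolding E_def
    proof (rule sum_mono)
      fix p assume p: "p \<in> prime_block n"
      have p2: "real p \<ge> 2" using prime_blockD(2)[OF p] by simp
      have "ln (exp (real n - 1)) \<le> ln (real p)"
        using prime_blockD(4)[OF p] n p2 by (subst ln_le_cancel_iff) auto
      then have l: "real n - 1 \<le> ln p" by simp
      have "1 / p - ln p / p / n = (real n - ln p) / (p * n)" using p2 n' by (simp add: field_simps)
      also have "\<dots> \<le> 1 / (p * n)" using l p2 n' by (intro divide_right_mono) auto
      \<comment> \<open>The factor ln p / (n - 1) \<ge> 1 is brought in because it is the block sum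
        of ln p / p that is known to be bounded.\<close>
      also have "\<dots> = (real n - 1) / (p * n * (real n - 1))" using n' by simp
      also have "\<dots> \<le> ln p / (p * n * (real n - 1))" using l p2 n' by (intro divide_right_mono) auto
      also have "\<dots> = ln (real p) / p * (1 / (n * (real n - 1)))" by simp
      finally show "prime_weight p - ln (real p) / p / n
          \<le> 2 * (ln (real p) / (real p * (real p - 1))) + ln (real p) / p * (1 / (n * (real n - 1)))"
        using prime_weight_bounds(2)[OF prime_blockD(2)[OF p]] by linarith
    qed
    also have "\<dots> = 2 * s n + a n * (1 / (n * (real n - 1)))"
      by (simp only: sum.distrib s_def a_def sum_distrib_left sum_distrib_right)
    also have "a n * (1 / (n * (real n - 1))) \<le> (1 + 2 * C) * (2 * inverse (real n ^ 2))"
    proof (rule mult_mono)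
      obtain m where m: "n = Suc m" using n by (cases n) auto
      show "a n \<le> 1 + 2 * C" using R[of n] R[of m] unfolding m aR by linarith
      show "1 / (n * (real n - 1)) \<le> 2 * inverse (real n ^ 2)"
        using n' by (simp add: field_simps power2_eq_square)
    qed (use n' C0 in auto)
    finally show ?thesis by (simp add: algebra_simps)
  qed
  have sE: "summable E"
  proof (rule summable_comparison_test'[where N = 2])
    show "summable (\<lambda>n. 2 * s n + 2 * (1 + 2 * C) * inverse (real n ^ 2))"
      by (intro summable_add summable_mult sums sq)
    show "norm (E n) \<le> 2 * s n + 2 * (1 + 2 * C) * inverse (real n ^ 2)" if "n \<ge> 2" for n
      using Ele[OF that] E0[of n] by simp
  qed
  \<comment> \<open>Summation by parts for the increments of R.\<close>
  define u where "u = (\<lambda>m. R m / real m)"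
  have u0: "u \<longlonglongrightarrow> 0"
  proof (rule Lim_null_comparison)
    show "eventually (\<lambda>m. norm (u m) \<le> C * (1 / real m)) sequentially"
      using R by (intro always_eventually allI) (simp add: u_def divide_right_mono)
    show "(\<lambda>m. C * (1 / real m)) \<longlonglongrightarrow> 0" using tendsto_mult_right_zero[OF lim_1_over_n, of C] by simp
  qed
  have "(R (Suc m) - R m) / real (Suc m) = (u (Suc m) - u m) + R m / (real m * real (Suc m))" for m
  proof (cases "m = 0")
    case False
    then have "R m / real (Suc m) = R m / real m - R m / (real m * real (Suc m))"
    proof -
      have "R m / real m - R m / (real m * real (Suc m)) = (R m * real (Suc m) - R m) / (real m * real (Suc m))"
        by (simp add: diff_divide_distrib)
      also have "R m * real (Suc m) - R m = real m * R m" by (simp add: algebra_simps)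
      finally show ?thesis using False by simp
    qed
    then show ?thesis by (simp add: u_def diff_divide_distrib)
  qed (use R0 in \<open>simp add: u_def\<close>)
  moreover have "summable (\<lambda>m. u (Suc m) - u m)" using telescope_summable[OF u0] .
  moreover have "summable (\<lambda>m. R m / (real m * real (Suc m)))"
  proof (rule summable_comparison_test'[where N = 1])
    show "summable (\<lambda>n. C * inverse (real n ^ 2))" by (intro summable_mult sq)
    show "norm (R n / (real n * real (Suc n))) \<le> C * inverse (real n ^ 2)" if "n \<ge> 1" for n
    proof -
      have "\<bar>R n\<bar> / (real n * real (Suc n)) \<le> C / (real n * real n)"
        using R[of n] that C0 by (intro frac_le mult_left_mono) auto
      then show ?thesis by (simp add: abs_mult power2_eq_square divide_inverse)
    qed
  qed
  ultimately have "summable (\<lambda>m. (R (Suc m) - R m) / real (Suc m))"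
    using summable_add by (simp only:)
  moreover have "summable (\<lambda>m. E (Suc m))" using sE by (simp only: summable_Suc_iff)
  ultimately have "summable (\<lambda>m. block_defect (Suc m))"
    unfolding cE by (rule summable_add)
  then show ?thesis by (simp only: summable_Suc_iff)
qed

text \<open>On block n one has exp(-\<delta> n) \<le> p^(-\<delta>), so the weights are controlled
  by the Euler product at 1 + \<delta>. The harmonic part is the series of -ln(1 - x), at least -ln
  \<delta>, and it cancels ln(1 + 1/\<delta>) up to \<delta>.\<close>

lemma suminf_block_defect_le:
  assumes d: "\<delta> > 0"
  shows "suminf (\<lambda>n. block_defect n * exp (- \<delta>) ^ n) \<le> (1 + ln_sum_bound) * \<delta>"
proof -
  define x where "x = exp (- \<delta>)"
  define V where "V = (\<lambda>n. sum prime_weight (prime_block n))"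
  define Z where "Z = ln (1 + 1 / \<delta>) + \<delta> * ln_sum_bound"
  have x: "0 < x" "x < 1" using d by (simp_all add: x_def)
  have w0: "prime_weight p \<ge> 0" if "p \<in> prime_block n" for p n
    using prime_weight_bounds(1)[OF prime_blockD(2)[OF that]] by (rule order_trans[rotated]) simp
  have V0: "V n * x ^ n \<ge> 0" for n
    unfolding V_def using w0 x by (intro mult_nonneg_nonneg sum_nonneg) auto
  have part: "(\<Sum>i\<le>n. V i * x ^ i) \<le> Z" for n
  proof -
    have "(\<Sum>i\<le>n. V i * x ^ i) \<le> (\<Sum>i\<le>n. \<Sum>p\<in>prime_block i. prime_weight p * real p powr (- \<delta>))"
      unfolding V_def sum_distrib_right
    proof (intro sum_mono mult_left_mono)
      fix i p assume p: "p \<in> prime_block i"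
      have "x ^ i = exp (- \<delta> * i)" unfolding x_def by (simp add: exp_of_nat_mult[symmetric] mult.commute)
      also have "\<dots> \<le> exp (- \<delta> * ln p)" using prime_blockD(5)[OF p] d by simp
      also have "\<dots> = real p powr (- \<delta>)" using prime_blockD(2)[OF p] by (simp add: powr_def)
      finally show "x ^ i \<le> real p powr (- \<delta>)" .
      show "prime_weight p \<ge> 0" by (rule w0[OF p])
    qed
    also have "\<dots> = (\<Sum>p\<in>primes_below_exp n. prime_weight p * real p powr (- \<delta>))"
      by (rule sum_prime_blocks)
    also have "\<dots> \<le> (\<Sum>p\<in>primes_below_exp n. - ln (1 - real p powr (- (1 + \<delta>)))
        + \<delta> * (ln (real p) / (real p * (real p - 1))))"
      unfolding prime_weight_def
      by (intro sum_mono neg_ln_prime_le[OF _ d]) (auto simp: primes_below_exp prime_ge_2_nat)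
    also have "\<dots> = (\<Sum>p\<in>primes_below_exp n. - ln (1 - real p powr (- (1 + \<delta>))))
        + \<delta> * (\<Sum>p\<in>primes_below_exp n. ln (real p) / (real p * (real p - 1)))"
      by (simp only: sum.distrib sum_distrib_left)
    also have "\<dots> \<le> Z"
      unfolding Z_def using d
      by (intro add_mono mult_left_mono sum_neg_ln_primes_le sum_ln_over_square_le)
        (auto simp: primes_below_exp prime_ge_2_nat)
    finally show ?thesis .
  qed
  have sV: "summable (\<lambda>n. V n * x ^ n)" by (rule bounded_imp_summable[OF V0 part])
  have "suminf (\<lambda>n. V n * x ^ n) \<le> Z"
  proof (rule suminf_le_const[OF sV])
    show "(\<Sum>i<n. V i * x ^ i) \<le> Z" for n
      using part[of n] V0[of n] by (simp add: lessThan_Suc_atMost[symmetric])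
  qed
  moreover have lg: "(\<lambda>n. x ^ n / n) sums - ln (1 - x)"
    using sums_minus[OF ln_series'[of "- x"]] x by simp
  have "block_defect n * x ^ n = V n * x ^ n - x ^ n / n" for n
    by (simp add: block_defect_def V_def algebra_simps)
  then have "suminf (\<lambda>n. block_defect n * x ^ n) = suminf (\<lambda>n. V n * x ^ n) - (- ln (1 - x))"
    using suminf_diff[OF sV sums_summable[OF lg]] sums_unique[OF lg] by simp
  moreover have "ln (1 - x) \<le> ln \<delta>"
    using x d exp_ge_add_one_self[of "- \<delta>"] by (subst ln_le_cancel_iff) (auto simp: x_def)
  moreover have "ln (1 + 1 / \<delta>) + ln \<delta> \<le> \<delta>"
  proof -
    have "ln (1 + 1 / \<delta>) + ln \<delta> = ln ((1 + 1 / \<delta>) * \<delta>)" using d by (intro ln_mult_pos[symmetric]) (auto intro: add_pos_pos)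
    also have "(1 + 1 / \<delta>) * \<delta> = 1 + \<delta>" using d by (simp add: field_simps)
    also have "ln (1 + \<delta>) \<le> \<delta>" using d by (intro ln_add_one_self_le_self) simp
    finally show ?thesis .
  qed
  ultimately have "suminf (\<lambda>n. block_defect n * x ^ n) \<le> \<delta> + \<delta> * ln_sum_bound"
    unfolding Z_def by linarith
  then show ?thesis by (simp add: x_def algebra_simps)
qed

text \<open>The Euler product of 1/zeta(2). An integer n with 2 \<le> n < y has a prime factor below
  y, so the sieved sum lies between 1 and 1 plus the tail of zeta(2) from y on.\<close>

lemma prod_one_minus_inverse_square:
  "(\<lambda>k. \<Prod>p\<in>primes_below_exp k. 1 - 1 / (real p)\<^sup>2) \<longlonglongrightarrow> 6 / pi\<^sup>2"
proof -
  define f where "f = (\<lambda>n::nat. real n powr (- 2))"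
  have f: "f n = 1 / (real n)\<^sup>2" for n
    by (cases "n = 0") (simp_all add: f_def powr_minus_divide)
  have "(\<lambda>n. f (Suc n)) sums (pi\<^sup>2 / 6)" using inverse_squares_sums by (simp add: f add.commute)
  then have sums: "f sums (pi\<^sup>2 / 6)" using sums_Suc[of f "pi\<^sup>2 / 6"] by (simp add: f)
  then have hs: "(f has_sum (pi\<^sup>2 / 6)) UNIV"
  proof (intro norm_summable_imp_has_sum)
    have "(\<lambda>n. norm (f n)) = f" by (auto simp: f_def)
    then show "summable (\<lambda>n. norm (f n))" using sums_summable[OF sums] by simp
  qed
  have smo: "f summable_on A" for A
    using hs summable_on_subset_banach[of f UNIV A] by (auto simp: summable_on_def)
  have Z: "infsum f UNIV = pi\<^sup>2 / 6" using hs by (rule infsumI)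
  have nn: "f n \<ge> 0" for n by (simp add: f)
  define y where "y = (\<lambda>k::nat. nat \<lfloor>exp (real k)\<rfloor>)"
  define P where "P = (\<lambda>k. \<Prod>p\<in>primes_below_exp k. 1 - 1 / (real p)\<^sup>2)"
  define N where "N = (\<lambda>k. {n. \<forall>p\<in>primes_below_exp k. \<not> p dvd n})"
  have PN: "pi\<^sup>2 / 6 * P k = infsum f (N k)" for k
    using euler_product_partial[of 2 "primes_below_exp k"] unfolding P_def N_def Z[symmetric] f[symmetric] f_def
    by (auto simp: primes_below_exp)
  have lower: "1 \<le> infsum f (N k)" for k
  proof -
    have "1 = sum f {1}" by (simp add: f)
    also have "\<dots> \<le> infsum f (N k)"
    proof (rule finite_sum_le_infsum[OF smo])
      have "1 \<notin> primes_below_exp k" by (auto simp: primes_below_exp)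
      then show "{1} \<subseteq> N k" by (auto simp: N_def)
    qed (use nn in auto)
    finally show ?thesis .
  qed
  have upper: "infsum f (N k) \<le> pi\<^sup>2 / 6 - (sum f {..<y k} - 1)" for k
  proof -
    have disj: "N k \<inter> {2..<y k} = {}"
    proof (intro equals0I)
      fix n assume n: "n \<in> N k \<inter> {2..<y k}"
      then obtain p where p: "prime p" "p dvd n" using prime_factor_nat[of n] by auto
      then have "p \<le> n" using n by (intro dvd_imp_le) auto
      then have "p \<le> y k" using n by auto
      then have "p \<in> primes_below_exp k" using p by (simp add: primes_below_exp_def primes_upto_def y_def)
      then show False using n p by (auto simp: N_def)
    qed
    have "infsum f (N k) + sum f {2..<y k} = infsum f (N k \<union> {2..<y k})"
      using infsum_Un_disjoint[OF smo smo disj] by simp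
    also have "\<dots> \<le> infsum f UNIV" by (rule infsum_mono2[OF smo smo]) (use nn in auto)
    finally have "infsum f (N k) \<le> pi\<^sup>2 / 6 - sum f {2..<y k}" by (simp add: Z)
    moreover have "sum f {..<y k} \<le> sum f ({0, 1} \<union> {2..<y k})"
      by (rule sum_mono2) (use nn in auto)
    moreover have "sum f ({0, 1} \<union> {2..<y k}) = 1 + sum f {2..<y k}"
      by (subst sum.union_disjoint) (auto simp: f)
    ultimately show ?thesis by linarith
  qed
  have "filterlim y at_top sequentially"
  proof -
    have "y k \<ge> k" for k
      using exp_ge_add_one_self[of "real k"] unfolding y_def by linarith
    then show ?thesis by (intro filterlim_at_top_mono[OF filterlim_ident]) auto
  qed
  then have "(\<lambda>k. sum f {..<y k}) \<longlonglongrightarrow> pi\<^sup>2 / 6"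
    using sums unfolding sums_def by (rule filterlim_compose[rotated])
  then have "(\<lambda>k. pi\<^sup>2 / 6 - (sum f {..<y k} - 1)) \<longlonglongrightarrow> pi\<^sup>2 / 6 - (pi\<^sup>2 / 6 - 1)"
    by (intro tendsto_intros)
  then have up: "(\<lambda>k. pi\<^sup>2 / 6 - (sum f {..<y k} - 1)) \<longlonglongrightarrow> 1" by simp
  have "(\<lambda>k. infsum f (N k)) \<longlonglongrightarrow> 1"
    by (rule real_tendsto_sandwich[OF _ _ tendsto_const up]; intro always_eventually allI lower upper)
  then have "(\<lambda>k. 6 / pi\<^sup>2 * infsum f (N k)) \<longlonglongrightarrow> 6 / pi\<^sup>2 * 1" by (intro tendsto_intros)
  moreover have "6 / pi\<^sup>2 * infsum f (N k) = P k" for k unfolding PN[symmetric] by simp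
  ultimately show ?thesis by (simp add: P_def)
qed

text \<open>The constant in Mertens' third theorem is identified by comparing the logarithm of the Euler
  product at \<open>1 + \<delta>\<close> with the logarithmic series \<open>\<Sum> e\<^sup>-\<^sup>\<delta>\<^sup>n / n\<close>, whose partial sums
  at \<open>\<delta> = 0\<close> are the harmonic numbers.\<close>
lemma prod_primes_tendsto:
  obtains l where "(\<lambda>k. (\<Prod>p\<in>primes_below_exp k. (real p + 1) / (real p - 1)) / (real k)\<^sup>2) \<longlonglongrightarrow> l"
    "l \<le> 6 * exp (2 * euler_mascheroni) / pi\<^sup>2"
proof -
  define \<tau> where "\<tau> = suminf block_defect"
  define W where "W = (\<lambda>k. sum prime_weight (primes_below_exp k))"
  have lim: "(\<lambda>n. \<Sum>i\<le>n. block_defect i) \<longlonglongrightarrow> \<tau>"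
    unfolding \<tau>_def by (rule summable_LIMSEQ'[OF summable_block_defect])
  then have \<tau>: "\<tau> \<le> 0" by (rule abel_limit_nonpos[OF _ suminf_block_defect_le])
  have T: "(\<Sum>i\<le>n. block_defect i) = W n - harm n" for n
  proof -
    have "(\<Sum>i\<le>n. 1 / real i) = (\<Sum>i=1..n. 1 / real i)"
      by (rule sum.mono_neutral_right) auto
    then show ?thesis
      by (simp add: block_defect_def sum_subtractf sum_prime_blocks W_def harm_def inverse_eq_divide)
  qed
  have "(\<lambda>k. (W k - harm k) + (harm k - ln (real k))) \<longlonglongrightarrow> \<tau> + euler_mascheroni"
    using lim unfolding T by (intro tendsto_add euler_mascheroni_LIMSEQ)
  then have "(\<lambda>k. W k - ln (real k)) \<longlonglongrightarrow> \<tau> + euler_mascheroni" by simp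
  then have "(\<lambda>k. exp (2 * (W k - ln (real k)))) \<longlonglongrightarrow> exp (2 * (\<tau> + euler_mascheroni))"
    by (rule tendsto_exp[OF tendsto_mult_left])
  then have "(\<lambda>k. (\<Prod>p\<in>primes_below_exp k. 1 - 1 / (real p)\<^sup>2) * exp (2 * (W k - ln (real k))))
      \<longlonglongrightarrow> 6 / pi\<^sup>2 * exp (2 * (\<tau> + euler_mascheroni))"
    by (intro tendsto_mult prod_one_minus_inverse_square)
  moreover have "eventually (\<lambda>k. (\<Prod>p\<in>primes_below_exp k. 1 - 1 / (real p)\<^sup>2) * exp (2 * (W k - ln (real k)))
      = (\<Prod>p\<in>primes_below_exp k. (real p + 1) / (real p - 1)) / (real k)\<^sup>2) sequentially"
    using eventually_gt_at_top[of 0]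
  proof eventually_elim
    case (elim k)
    have "exp (2 * (W k - ln (real k))) = exp (2 * W k) / (exp (ln (real k)))\<^sup>2"
      by (simp add: right_diff_distrib exp_diff exp_double)
    also have "exp (2 * W k) = (\<Prod>p\<in>primes_below_exp k. exp (2 * prime_weight p))"
      by (simp add: W_def sum_distrib_left exp_sum)
    finally have "(\<Prod>p\<in>primes_below_exp k. 1 - 1 / (real p)\<^sup>2) * exp (2 * (W k - ln (real k)))
        = (\<Prod>p\<in>primes_below_exp k. (1 - 1 / (real p)\<^sup>2) * exp (2 * prime_weight p)) / (real k)\<^sup>2"
      using elim by (simp add: prod.distrib)
    also have "(\<Prod>p\<in>primes_below_exp k. (1 - 1 / (real p)\<^sup>2) * exp (2 * prime_weight p))
        = (\<Prod>p\<in>primes_below_exp k. (real p + 1) / (real p - 1))"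
    proof (rule prod.cong[OF refl])
      fix p assume "p \<in> primes_below_exp k"
      then have p: "real p \<ge> 2" using prime_ge_2_nat[of p] by (simp add: primes_below_exp)
      have "exp (2 * prime_weight p) = inverse ((1 - 1 / p)\<^sup>2)"
        using p by (simp add: prime_weight_def exp_double exp_minus power_inverse)
      also have "(1 - 1 / real p)\<^sup>2 = (real p - 1)\<^sup>2 / (real p)\<^sup>2" using p by (simp add: power_divide[symmetric] diff_divide_distrib)
      finally have e: "exp (2 * prime_weight p) = (real p)\<^sup>2 / (real p - 1)\<^sup>2" by simp
      have "1 - 1 / (real p)\<^sup>2 = (real p - 1) * (real p + 1) / (real p)\<^sup>2"
        using p by (simp add: field_simps power2_eq_square)
      then show "(1 - 1 / (real p)\<^sup>2) * exp (2 * prime_weight p) = (real p + 1) / (real p - 1)"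
        unfolding e using p by (simp add: power2_eq_square)
    qed
    finally show ?case .
  qed
  ultimately have "(\<lambda>k. (\<Prod>p\<in>primes_below_exp k. (real p + 1) / (real p - 1)) / (real k)\<^sup>2)
      \<longlonglongrightarrow> 6 / pi\<^sup>2 * exp (2 * (\<tau> + euler_mascheroni))"
    by (rule Lim_transform_eventually)
  moreover have "6 / pi\<^sup>2 * exp (2 * (\<tau> + euler_mascheroni)) \<le> 6 / pi\<^sup>2 * exp (2 * euler_mascheroni)"
    using \<tau> by (intro mult_left_mono) auto
  ultimately show ?thesis using that by simp
qed

section \<open>The asymptotic bound\<close>

lemma linear_bound_primes:
  fixes c :: real
  assumes c: "c \<ge> 0"
    and base: "\<And>f. admissible f \<Longrightarrow> varies_in Q f \<Longrightarrow> mass f \<le> M \<Longrightarrow> c * mass f \<le> energy f"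
    and P: "finite P" "\<And>p. p \<in> P \<Longrightarrow> prime p"
    and f: "admissible f" "varies_in (P \<union> Q) f" "mass f \<le> M"
  shows "c * (\<Prod>p\<in>P. (real p - 1) / (real p + 1)) * mass f \<le> energy f"
  using P f
proof (induction P arbitrary: f rule: finite_induct)
  case empty
  then show ?case using base by simp
next
  case (insert p P)
  let ?d = "c * (\<Prod>p\<in>P. (real p - 1) / (real p + 1))"
  have "?d \<ge> 0"
  proof (intro mult_nonneg_nonneg c prod_nonneg)
    fix q assume "q \<in> P"
    then show "0 \<le> (real q - 1) / (real q + 1)" using insert.prems(1)[of q] prime_ge_1_nat[of q] by simp
  qed
  then have "?d * ((real p - 1) / (real p + 1)) * mass f \<le> energy f"
    using insert.prems insert.IH
    by (intro linear_bound_insert_prime[of p ?d "P \<union> Q" M f]) auto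
  then show ?case using insert.hyps by (simp add: mult_ac)
qed

text \<open>The left side is the chord from t = 0 to t = 1 of the concave function on the right. The
  proof goes through convexity of x^(1/\<theta>).\<close>

lemma powr_midpoint_ge:
  fixes t \<theta> :: real
  assumes t: "0 \<le> t" "t \<le> 1" and \<theta>: "0 < \<theta>" "\<theta> \<le> 1"
  shows "(1 - t) + t * 2 powr (- \<theta>) \<le> (1 - t / 2) powr \<theta>"
proof -
  define v where "v = (2::real) powr (- \<theta>)"
  have v: "v > 0" by (simp add: v_def)
  have conv: "((1 - t) *\<^sub>R 1 + t *\<^sub>R v) powr (1 / \<theta>) \<le> (1 - t) * 1 powr (1 / \<theta>) + t * v powr (1 / \<theta>)"
    using powr_convex[of "1 / \<theta>"] t \<theta> v by (intro convex_onD) auto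
  have le: "((1 - t) + t * v) powr (1 / \<theta>) \<le> 1 - t / 2"
  proof -
    have "v powr (1 / \<theta>) = 2 powr (- 1)" using \<theta> by (simp add: v_def powr_powr)
    then have half: "v powr (1 / \<theta>) = 1 / 2" by (simp add: powr_minus_divide)
    show ?thesis using conv unfolding half by simp
  qed
  have pos: "(1 - t) + t * v > 0"
  proof (cases "t = 1")
    case False
    then have "1 - t > 0" "t * v \<ge> 0" using t v by auto
    then show ?thesis by linarith
  qed (use v in simp)
  have "(1 - t) + t * v = (((1 - t) + t * v) powr (1 / \<theta>)) powr \<theta>"
    using pos \<theta> by (simp add: powr_powr)
  also have "\<dots> \<le> (1 - t / 2) powr \<theta>"
    using le \<theta> by (intro powr_mono2) auto
  finally show ?thesis by (simp add: v_def)
qed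

text \<open>For fixed \<open>a + b\<close> the right-hand side with \<open>j = a - b\<close> is concave in \<open>b\<close>, so it suffices to look
  at \<open>b = 0\<close> and at \<open>b = a\<close>, where the condition on \<open>\<theta>\<close> is used.\<close>
lemma powr_step:
  fixes a b j :: nat and r \<theta> :: real
  assumes r: "0 \<le> r" "r \<le> 1" and \<theta>: "0 < \<theta>" "\<theta> \<le> 1" "(1 - r) * 2 powr (1 - \<theta>) \<ge> 1"
    and ab: "a > 0" "b > 0" and j: "a \<le> j + b" "b \<le> j + a"
  shows "real (a + b) powr \<theta> \<le> (1 - r) * (real a powr \<theta> + real b powr \<theta>) + r * real j powr \<theta>"
proof -
  have *: "real (a + b) powr \<theta> \<le> (1 - r) * (real a powr \<theta> + real b powr \<theta>) + r * real j powr \<theta>"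
    if b: "0 < b" "b \<le> a" and j: "a \<le> j + b" for a b
  proof -
    define n t where "n = real (a + b)" and "t = 2 * real b / n"
    have n: "n > 0" using b by (simp add: n_def)
    have t: "0 \<le> t" "t \<le> 1" using b n by (simp_all add: t_def n_def field_simps)
    have a': "real a = n * (1 - t / 2)" and b': "real b = n * (t / 2)"
      using n by (simp_all add: t_def n_def field_simps)
    have "real a - real b = n * (1 - t)" unfolding a' b' by (simp add: algebra_simps)
    then have j': "n * (1 - t) \<le> real j" using j by linarith
    have 1: "n powr \<theta> * ((1 - t) + t * 2 powr (- \<theta>)) \<le> real a powr \<theta>"
      unfolding a' using n t powr_midpoint_ge[OF t \<theta>(1,2)]
      by (subst powr_mult) (auto intro!: mult_left_mono)
    have self: "x \<le> x powr \<theta>" if "0 \<le> x" "x \<le> 1" for x :: real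
      using that \<theta> powr_mono'[of \<theta> 1 x] by (cases "x = 0") auto
    have 2: "n powr \<theta> * (t * 2 powr (- \<theta>)) \<le> real b powr \<theta>"
    proof -
      have "(t / 2) powr \<theta> = t powr \<theta> * 2 powr (- \<theta>)"
        using t by (simp add: powr_divide powr_minus_divide)
      then show ?thesis unfolding b' using n t self[OF t]
        by (subst powr_mult) (auto intro!: mult_left_mono mult_right_mono)
    qed
    have 3: "n powr \<theta> * (1 - t) \<le> real j powr \<theta>"
    proof -
      have "n powr \<theta> * (1 - t) \<le> n powr \<theta> * (1 - t) powr \<theta>"
        using self[of "1 - t"] t by (intro mult_left_mono) auto
      also have "\<dots> = (n * (1 - t)) powr \<theta>" using n t by (subst powr_mult) auto
      also have "\<dots> \<le> real j powr \<theta>" using j' n t \<theta> by (intro powr_mono2) auto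
      finally show ?thesis .
    qed
    \<comment> \<open>All three powers are now bounded below by affine functions of t. The claim is
      an equality at t = 0 and the condition on \<theta> at t = 1.\<close>
    have "1 \<le> (1 - t) + t * ((1 - r) * 2 powr (1 - \<theta>))"
      using mult_left_mono[OF \<theta>(3) t(1)] by simp
    also have "\<dots> = (1 - r) * (((1 - t) + t * 2 powr (- \<theta>)) + t * 2 powr (- \<theta>)) + r * (1 - t)"
    proof -
      have "(2::real) powr (1 - \<theta>) = 2 * 2 powr (- \<theta>)" using powr_add[of 2 1 "- \<theta>"] by simp
      then show ?thesis by (simp add: algebra_simps)
    qed
    finally have "n powr \<theta> * 1 \<le> n powr \<theta> * ((1 - r) * (((1 - t) + t * 2 powr (- \<theta>)) + t * 2 powr (- \<theta>)) + r * (1 - t))"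
      by (rule mult_left_mono) simp
    also have "\<dots> = (1 - r) * (n powr \<theta> * ((1 - t) + t * 2 powr (- \<theta>)) + n powr \<theta> * (t * 2 powr (- \<theta>)))
        + r * (n powr \<theta> * (1 - t))"
      by (simp add: algebra_simps)
    also have "\<dots> \<le> (1 - r) * (real a powr \<theta> + real b powr \<theta>) + r * real j powr \<theta>"
      using 1 2 3 r by (intro add_mono mult_left_mono) auto
    finally show ?thesis by (simp add: n_def)
  qed
  show ?thesis
  proof (cases "b \<le> a")
    case True
    then show ?thesis using *[of b a] ab j by simp
  next
    case False
    then show ?thesis using *[of a b] ab j by (simp add: add.commute)
  qed
qed

text \<open>The condition on \<theta> at y carries over to every prime p \<ge> y, as 1 - 1/p
  increases with p. On one-point supports the energy is the squared mass, which dominates the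
  power.\<close>

lemma rough_bound:
  fixes y \<theta> :: real
  assumes y: "y > 1" and \<theta>: "0 < \<theta>" "\<theta> \<le> 1" "(1 - 1 / y) * 2 powr (1 - \<theta>) \<ge> 1"
    and f: "admissible f" "varies_in {p. y \<le> real p} f"
  shows "real (mass f) powr \<theta> \<le> energy f"
proof (rule lower_bound_all_primes[where Q = "{}" and R = "{p. y \<le> real p}", OF _ _ f])
  fix g assume g: "admissible g" "varies_in {} g"
  show "real (mass g) powr \<theta> \<le> energy g"
  proof (cases "mass g = 0")
    case True
    then show ?thesis using energy_ge_mass_no_primes(2)[OF g] by simp
  next
    case False
    then have "real (mass g) powr \<theta> \<le> real (mass g) powr 1" using \<theta> by (intro powr_mono) auto
    then show ?thesis using energy_ge_mass_no_primes(2)[OF g] by simp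
  qed
next
  fix p a b j :: nat
  assume p: "prime p" "p \<in> {p. y \<le> real p} - {}" and ab: "a > 0" "b > 0" and j: "a \<le> j + b" "b \<le> j + a"
  have "1 / real p \<le> 1 / y" using p y by (intro divide_left_mono) auto
  then have "(1 - 1 / y) * 2 powr (1 - \<theta>) \<le> (1 - 1 / real p) * 2 powr (1 - \<theta>)"
    by (intro mult_right_mono) auto
  then have "1 \<le> (1 - 1 / real p) * 2 powr (1 - \<theta>)" using \<theta>(3) by linarith
  then show "real (a + b) powr \<theta> \<le> (1 - 1 / real p) * (real a powr \<theta> + real b powr \<theta>) + 1 / real p * real j powr \<theta>"
    using p y \<theta> prime_ge_1_nat[OF p(1)] by (intro powr_step[OF _ _ _ _ _ ab j]) auto
qed

text \<open>The solution \<theta> of (1 - 1/y) 2^(1-\<theta>) = 1 for y = e^k.\<close>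

definition rough_exponent :: "nat \<Rightarrow> real" where
  "rough_exponent k = 1 + ln (1 - exp (- real k)) / ln 2"

lemma rough_exponent:
  assumes k: "k \<ge> 1"
  shows "0 < rough_exponent k" "rough_exponent k \<le> 1" "1 - rough_exponent k \<le> 4 * exp (- real k)"
    "(1 - exp (- real k)) * 2 powr (1 - rough_exponent k) = 1" "1 / 5 \<le> rough_exponent k"
proof -
  define z where "z = exp (- real k)"
  have "z \<le> exp (- 1)" using k by (simp add: z_def)
  moreover have e: "exp (- 1 :: real) \<le> 2 / 5"
  proof -
    have "(5 / 2 :: real) \<le> exp 1" using exp_lower_Taylor_quadratic[of 1] by simp
    then have "inverse (exp 1) \<le> inverse (5 / 2 :: real)" by (intro le_imp_inverse_le) auto
    then show ?thesis by (simp add: exp_minus)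
  qed
  ultimately have "z \<le> 2 / 5" by linarith
  then have z: "0 < z" "z \<le> 2 / 5" by (simp_all add: z_def)
  have "ln (inverse (2::real)) \<le> inverse 2 - 1" by (rule ln_le_minus_one) simp
  then have ln2: "1 / 2 \<le> ln (2::real)" by (simp add: ln_div)
  have "ln (1 / (1 - z)) \<le> 1 / (1 - z) - 1" using z by (intro ln_le_minus_one) auto
  also have "\<dots> = z / (1 - z)" using z by (simp add: field_simps)
  also have "\<dots> \<le> 2 * z"
    using z by (simp add: field_simps)
  finally have l: "- ln (1 - z) \<le> 2 * z" using z by (simp add: ln_div)
  have "- ln (1 - z) / ln 2 \<le> 2 * z / (1 / 2)"
    using l ln2 z by (intro frac_le) auto
  then show 1: "1 - rough_exponent k \<le> 4 * exp (- real k)"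
    by (simp add: rough_exponent_def z_def)
  have "ln (1 - z) \<le> 0" using z by simp
  then show "rough_exponent k \<le> 1" using ln2 by (simp add: rough_exponent_def z_def divide_nonpos_pos)
  have "ln (1 - z) \<ge> ln (3 / 5)" using z by (subst ln_le_cancel_iff) auto
  have "5 * (- ln (1 - z)) \<le> 4 * ln 2"
  proof -
    \<comment> \<open>From (5/3)^5 < 2^4 follows \<theta> \<ge> 1/5, a crude bound whose purpose is
      to keep 1/\<theta> bounded.\<close>
    have "ln ((5 / 3 :: real) ^ 5) \<le> ln (2 ^ 4)" by (subst ln_le_cancel_iff) (simp_all add: power_numeral_reduce)
    then have "5 * ln (5 / 3 :: real) \<le> 4 * ln 2"
      using ln_realpow[of "5 / 3 :: real" 5] ln_realpow[of "2::real" 4] by simp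
    moreover have "ln (3 / 5 :: real) = - ln (5 / 3)" by (simp add: ln_div)
    ultimately show ?thesis using \<open>ln (1 - z) \<ge> ln (3 / 5)\<close> by linarith
  qed
  then have "ln (1 - z) / ln 2 \<ge> - (4 / 5)" using ln2 by (simp add: field_simps)
  then show "1 / 5 \<le> rough_exponent k" unfolding rough_exponent_def z_def[symmetric] by linarith
  then show "0 < rough_exponent k" by simp
  have "2 powr (1 - rough_exponent k) = exp (- ln (1 - z))"
    using ln2 by (simp add: rough_exponent_def z_def powr_def)
  then have "2 powr (1 - rough_exponent k) = inverse (1 - z)" using z by (simp add: exp_minus)
  then show "(1 - exp (- real k)) * 2 powr (1 - rough_exponent k) = 1"
    unfolding z_def[symmetric] using z by simp
qed

section \<open>Combining small and large primes\<close>

definition prime_product :: "nat \<Rightarrow> real" where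
  "prime_product k = (\<Prod>p\<in>primes_below_exp k. (real p + 1) / (real p - 1))"

lemma prime_product_ge_1: "prime_product k \<ge> 1"
  unfolding prime_product_def
proof (rule prod_ge_1)
  fix p assume "p \<in> primes_below_exp k"
  then show "1 \<le> (real p + 1) / (real p - 1)"
    using prime_gt_1_nat[of p] by (simp add: primes_below_exp)
qed

text \<open>The power bound for large primes has to become linear before small primes can be
  inserted. With n = \<open>mass f\<close>, every mass m between 1 and n satisfies m^\<theta> \<ge>
  n^(\<theta>-1) m; inserting the primes up to e^k costs \<open>prime_product k\<close>, and
  evaluating the linear bound at n restores n^\<theta>.\<close>

lemma mass_powr_le:
  assumes k: "k \<ge> 1" and f: "admissible f"
  shows "real (mass f) powr rough_exponent k \<le> prime_product k * energy f"
proof (cases "mass f = 0")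
  case True
  then show ?thesis using mass_eq_0[OF f] energy_empty by simp
next
  case False
  define \<theta> where "\<theta> = rough_exponent k"
  define n where "n = real (mass f)"
  note \<theta> = rough_exponent[OF k, folded \<theta>_def]
  let ?P = "primes_below_exp k" and ?Q = "{p. exp (real k) \<le> real p}"
  have n: "n > 0" using False by (simp add: n_def)
  have base: "n powr (\<theta> - 1) * mass g \<le> energy g"
    if g: "admissible g" "varies_in ?Q g" "mass g \<le> mass f" for g
  proof -
    have "(1 - 1 / exp (real k)) * 2 powr (1 - \<theta>) \<ge> 1" using \<theta>(4) by (simp add: exp_minus inverse_eq_divide)
    then have *: "real (mass g) powr \<theta> \<le> energy g"
      by (intro rough_bound[of "exp (real k)"] \<theta> g) (use k in auto)
    show ?thesis
    proof (cases "mass g = 0")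
      case False
      have "n powr (\<theta> - 1) * mass g \<le> real (mass g) powr (\<theta> - 1) * mass g"
        using g False \<theta>(2) n by (intro mult_right_mono powr_mono2') (auto simp: n_def)
      also have "\<dots> = real (mass g) powr \<theta>"
        using False powr_mult_base[of "real (mass g)" "\<theta> - 1"] by (simp add: mult.commute)
      finally show ?thesis using * by simp
    qed (use * in simp)
  qed
  have v: "varies_in (?P \<union> ?Q) f"
    unfolding varies_in_def by (auto simp: primes_below_exp)
  have "n powr (\<theta> - 1) * (\<Prod>p\<in>?P. (real p - 1) / (real p + 1)) * mass f \<le> energy f"
    by (rule linear_bound_primes[OF _ base _ _ f v]) (auto simp: primes_below_exp)
  then have "prime_product k * (n powr (\<theta> - 1) * (\<Prod>p\<in>?P. (real p - 1) / (real p + 1)) * n) \<le> prime_product k * energy f"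
    using prime_product_ge_1[of k] by (intro mult_left_mono) (auto simp: n_def)
  moreover have "prime_product k * (\<Prod>p\<in>?P. (real p - 1) / (real p + 1)) = 1"
    unfolding prime_product_def prod.distrib[symmetric]
  proof (rule prod.neutral, rule ballI)
    fix p assume "p \<in> ?P"
    then have "real p > 1" using prime_gt_1_nat[of p] by (simp add: primes_below_exp)
    then show "(real p + 1) / (real p - 1) * ((real p - 1) / (real p + 1)) = 1" by simp
  qed
  then have "prime_product k * (n powr (\<theta> - 1) * (\<Prod>p\<in>?P. (real p - 1) / (real p + 1)) * n) = n powr (\<theta> - 1) * n"
    by (metis (no_types, lifting) mult.assoc mult.commute mult.right_neutral)
  moreover have "n powr (\<theta> - 1) * n = n powr \<theta>"
    using n powr_mult_base[of n "\<theta> - 1"] by (simp add: mult.commute)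
  ultimately show ?thesis unfolding n_def[symmetric] \<theta>_def[symmetric] by linarith
qed

text \<open>The primes are separated at y about ln D times exp(sqrt l). This outgrows ln D, so that
  the exponent costs nothing in the limit, while ln y is still asymptotic to l.\<close>

definition cutoff :: "nat \<Rightarrow> nat" where
  "cutoff D = (let l = ln (ln (real (D + 2))) in nat \<lceil>l + sqrt l\<rceil>)"

definition size_bound :: "nat \<Rightarrow> real" where
  "size_bound D = (3 * (real D)\<^sup>2 * prime_product (cutoff D)) powr (1 / rough_exponent (cutoff D))"

text \<open>The shift by 2 is what makes the inner logarithm exceed 1: D + 2 \<ge> 3 > e.\<close>

lemma ln_ln_pos: "D \<ge> 1 \<Longrightarrow> ln (ln (real (D + 2))) > 0"
proof -
  assume "D \<ge> 1"
  have "exp (1::real) < 3" using e_less_272 by simp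
  then have "exp 1 < real (D + 2)" using \<open>D \<ge> 1\<close> by simp
  then have "ln (exp 1) < ln (real (D + 2))" by (subst ln_less_cancel_iff) auto
  then show ?thesis by simp
qed

lemma size_le:
  assumes D: "D \<ge> 1" and r: "integral_factorial_ratio K (K + D) as bs"
  shows "real (K + (K + D)) \<le> size_bound D"
proof -
  let ?k = "cutoff D"
  have "ln (ln (real (D + 2))) + sqrt (ln (ln (real (D + 2)))) > 0" using ln_ln_pos[OF D] by (simp add: add_pos_pos)
  then have k: "?k \<ge> 1" unfolding cutoff_def Let_def by linarith
  note \<theta> = rough_exponent[OF k]
  let ?n = "real (K + (K + D))"
  have "?n powr rough_exponent ?k \<le> prime_product ?k * energy (signed_count as bs)"
    using mass_powr_le[OF k admissible_signed_count[OF r]] mass_signed_count[OF r] by simp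
  also have "\<dots> \<le> prime_product ?k * (3 * (real D)\<^sup>2)"
    using energy_le[OF r] prime_product_ge_1[of ?k] by (intro mult_left_mono) auto
  finally have "?n powr rough_exponent ?k \<le> 3 * (real D)\<^sup>2 * prime_product ?k" by (simp add: mult_ac)
  then have "(?n powr rough_exponent ?k) powr (1 / rough_exponent ?k) \<le> size_bound D"
    unfolding size_bound_def using \<theta>(1) by (intro powr_mono2) auto
  then show ?thesis using \<theta>(1) D by (simp add: powr_powr)
qed

lemma cutoff_asymp:
  defines "l \<equiv> (\<lambda>D::nat. ln (ln (real (D + 2))))"
  shows "filterlim l at_top sequentially" "(\<lambda>D. cutoff D / l D) \<longlonglongrightarrow> 1"
    "filterlim cutoff at_top sequentially"
proof -
  have "filterlim (\<lambda>D::nat. real (D + 2)) at_top sequentially"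
    by (rule filterlim_at_top_mono[OF filterlim_real_sequentially]) auto
  then show l: "filterlim l at_top sequentially"
    unfolding l_def by (intro filterlim_compose[OF ln_at_top])
  have sq: "filterlim (\<lambda>D. sqrt (l D)) at_top sequentially"
    by (rule filterlim_compose[OF sqrt_at_top l])
  have bounds: "l D + sqrt (l D) \<le> cutoff D" "cutoff D \<le> l D + sqrt (l D) + 1" if "l D \<ge> 0" for D
  proof -
    have "cutoff D = nat \<lceil>l D + sqrt (l D)\<rceil>" by (simp only: cutoff_def Let_def l_def)
    moreover have "l D + sqrt (l D) \<ge> 0" using that by simp
    ultimately show "l D + sqrt (l D) \<le> cutoff D" "cutoff D \<le> l D + sqrt (l D) + 1" by linarith+
  qed
  have ev: "eventually (\<lambda>D. l D > 0) sequentially"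
    using l by (simp add: filterlim_at_top_dense)
  have inv: "(\<lambda>D. 1 / sqrt (l D)) \<longlonglongrightarrow> 0" "(\<lambda>D. 1 / l D) \<longlonglongrightarrow> 0"
    using sq l by (auto intro!: tendsto_divide_0[OF tendsto_const] filterlim_at_top_imp_at_infinity)
  show "(\<lambda>D. cutoff D / l D) \<longlonglongrightarrow> 1"
  proof (rule real_tendsto_sandwich)
    show "eventually (\<lambda>D. 1 + 1 / sqrt (l D) \<le> cutoff D / l D) sequentially"
      using ev
    proof eventually_elim
      case (elim D)
      have "1 + 1 / sqrt (l D) = (l D + sqrt (l D)) / l D"
        using elim by (simp add: add_divide_distrib real_div_sqrt inverse_eq_divide) (metis divide_divide_eq_right elim less_imp_le mult.right_neutral nonzero_divide_eq_eq real_div_sqrt real_sqrt_eq_zero_cancel_iff less_irrefl times_divide_eq_right mult.commute)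
      also have "\<dots> \<le> cutoff D / l D" using bounds(1)[of D] elim by (intro divide_right_mono) auto
      finally show ?case .
    qed
    show "eventually (\<lambda>D. cutoff D / l D \<le> 1 + 1 / sqrt (l D) + 1 / l D) sequentially"
      using ev
    proof eventually_elim
      case (elim D)
      have "cutoff D / l D \<le> (l D + sqrt (l D) + 1) / l D" using bounds(2)[of D] elim by (intro divide_right_mono) auto
      also have "\<dots> = 1 + sqrt (l D) / l D + 1 / l D" using elim by (simp add: add_divide_distrib)
      also have "sqrt (l D) / l D = 1 / sqrt (l D)"
        using elim real_sqrt_mult_self[of "l D"] by (simp add: field_simps)
      finally show ?case .
    qed
    show "(\<lambda>D. 1 + 1 / sqrt (l D)) \<longlonglongrightarrow> 1" using tendsto_add[OF tendsto_const inv(1), of 1] by simp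
    show "(\<lambda>D. 1 + 1 / sqrt (l D) + 1 / l D) \<longlonglongrightarrow> 1"
      using tendsto_add[OF tendsto_add[OF tendsto_const inv(1)] inv(2), of 1] by simp
  qed
  have "filterlim (\<lambda>D. real (cutoff D)) at_top sequentially"
    by (rule filterlim_at_top_mono[OF l], rule eventually_mono[OF ev])
      (use bounds(1) real_sqrt_ge_zero in \<open>smt (verit)\<close>)
  then show "filterlim cutoff at_top sequentially" by (simp add: filterlim_sequentially_iff_filterlim_real)
qed

text \<open>\<open>size_bound D\<close> equals X exp((1/\<theta> - 1) ln X). The exponential tends
  to 1, and X contributes 3 D^2 times \<open>prime_product\<close>. The limit m may be below 1
  because the constant of the product is bounded from above only.\<close>

lemma size_bound_ratio:
  defines "c \<equiv> 18 * exp (2 * euler_mascheroni) / pi\<^sup>2"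
  shows "\<exists>m\<le>1. (\<lambda>D. size_bound D / (c * (real D)\<^sup>2 * (ln (ln (real (D + 2))))\<^sup>2)) \<longlonglongrightarrow> m"
proof -
  define l where "l = (\<lambda>D::nat. ln (ln (real (D + 2))))"
  define L where "L = (\<lambda>D::nat. ln (real (D + 2)))"
  define \<theta> where "\<theta> = (\<lambda>D. rough_exponent (cutoff D))"
  define X where "X = (\<lambda>D. 3 * (real D)\<^sup>2 * prime_product (cutoff D))"
  note asy = cutoff_asymp[folded l_def]
  have cutoff_ratio: "(\<lambda>D. cutoff D / l D) \<longlonglongrightarrow> 1"
    using cutoff_asymp(2) by (simp only: l_def)
  obtain m where m: "(\<lambda>k. prime_product k / (real k)\<^sup>2) \<longlonglongrightarrow> m" "m \<le> 6 * exp (2 * euler_mascheroni) / pi\<^sup>2"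
    using prod_primes_tendsto unfolding prime_product_def by blast
  have c: "c > 0" by (simp add: c_def)
  have lim1: "(\<lambda>D. prime_product (cutoff D) / (real (cutoff D))\<^sup>2) \<longlonglongrightarrow> m"
    by (rule filterlim_compose[OF m(1) asy(3)])
  obtain B where B: "B > 0" "\<And>k. norm (prime_product k / (real k)\<^sup>2) \<le> B"
    using convergent_imp_Bseq[OF convergentI[OF m(1)]] by (auto simp: Bseq_def)
  have ev: "eventually (\<lambda>D. l D \<ge> 1) sequentially" using asy(1) by (simp add: filterlim_at_top)
  have evD: "eventually (\<lambda>D. D \<ge> 1 \<and> l D \<ge> 1) sequentially"
    using ev eventually_ge_at_top[of 1] by eventually_elim auto
  have bounds: "l D + sqrt (l D) \<le> cutoff D" "cutoff D \<le> 3 * l D" "cutoff D \<ge> 1"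
    "L D \<ge> 1" "l D \<le> L D" "exp (l D) = L D" if "l D \<ge> 1" for D
  proof -
    have k: "cutoff D = nat \<lceil>l D + sqrt (l D)\<rceil>" by (simp only: cutoff_def Let_def l_def)
    have s: "sqrt (l D) \<ge> 1" "sqrt (l D) \<le> l D"
      using that real_sqrt_le_mono[of "l D" "(l D)\<^sup>2"] by (auto simp: power2_eq_square)
    show "l D + sqrt (l D) \<le> cutoff D" "cutoff D \<le> 3 * l D" "cutoff D \<ge> 1"
      using k s that by linarith+
    have "L D > 0" by (simp add: L_def)
    then show e: "exp (l D) = L D" by (simp add: l_def L_def)
    show "L D \<ge> 1" using exp_ge_add_one_self[of "l D"] that e by linarith
    show "l D \<le> L D" using exp_ge_add_one_self[of "l D"] e by linarith
  qed
  have X1: "X D \<ge> 1" if "D \<ge> 1" for D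
  proof -
    have "1 \<le> (real D)\<^sup>2" using that by (intro one_le_power) simp
    then have "1 \<le> 3 * (real D)\<^sup>2" by linarith
    then have "1 * 1 \<le> 3 * (real D)\<^sup>2 * prime_product (cutoff D)"
      using prime_product_ge_1[of "cutoff D"] by (intro mult_mono) auto
    then show ?thesis by (simp add: X_def)
  qed
  have lim3: "(\<lambda>D. (1 / \<theta> D - 1) * ln (X D)) \<longlonglongrightarrow> 0"
  proof (rule Lim_null_comparison)
    \<comment> \<open>1/\<theta> - 1 is at most 5 * 4 exp(-cutoff), hence at most 20 exp(-sqrt l)/L,
      and ln X is at most E L. The 8 consists of 2 for D^2 and 6 for the square of the cutoff, which
      is at most 3 L.\<close>
    define E where "E = ln 3 + \<bar>ln B\<bar> + 8"
    show "eventually (\<lambda>D. norm ((1 / \<theta> D - 1) * ln (X D)) \<le> 20 * E * exp (- sqrt (l D))) sequentially"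
      using evD
    proof eventually_elim
      case (elim D)
      then have l1: "l D \<ge> 1" and D1: "D \<ge> 1" by auto
      note b = bounds[OF l1]
      note t = rough_exponent[OF b(3), folded \<theta>_def]
      have "1 / \<theta> D - 1 = (1 - \<theta> D) / \<theta> D" using t by (simp add: \<theta>_def field_simps)
      also have "\<dots> \<le> (4 * exp (- real (cutoff D))) / (1 / 5)"
        using t by (intro frac_le) (auto simp: \<theta>_def)
      finally have 1: "1 / \<theta> D - 1 \<le> 20 * exp (- real (cutoff D))" by simp
      have "exp (- real (cutoff D)) \<le> exp (- (l D) - sqrt (l D))" using b(1) by simp
      also have "\<dots> = exp (- sqrt (l D)) / L D" using b(6) by (simp add: exp_diff exp_minus divide_inverse mult.commute)
      finally have 2: "1 / \<theta> D - 1 \<le> 20 * (exp (- sqrt (l D)) / L D)" using 1 by simp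
      have 0: "1 / \<theta> D - 1 \<ge> 0" using t by (simp add: \<theta>_def)
      have kpos: "real (cutoff D) > 0" using b(3) by simp
      have "prime_product (cutoff D) \<le> B * (real (cutoff D))\<^sup>2"
        using B(2)[of "cutoff D"] kpos prime_product_ge_1[of "cutoff D"] by (simp add: field_simps)
      then have "X D \<le> 3 * (real D)\<^sup>2 * (B * (real (cutoff D))\<^sup>2)"
        unfolding X_def by (intro mult_left_mono) auto
      then have "ln (X D) \<le> ln (3 * (real D)\<^sup>2 * (B * (real (cutoff D))\<^sup>2))"
        using X1[OF D1] B kpos D1 by (subst ln_le_cancel_iff) auto
      also have "\<dots> = ln 3 + 2 * ln (real D) + (ln B + 2 * ln (real (cutoff D)))"
        using B kpos D1 by (simp add: ln_mult ln_realpow)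
      also have "\<dots> \<le> ln 3 + 2 * L D + (\<bar>ln B\<bar> + 2 * (3 * L D))"
      proof -
        have "ln (real D) \<le> L D" using D1 unfolding L_def by (subst ln_le_cancel_iff) auto
        moreover have "ln (real (cutoff D)) \<le> real (cutoff D) - 1" using kpos by (rule ln_le_minus_one)
        ultimately show ?thesis using b(2,5) by linarith
      qed
      also have "\<dots> \<le> E * L D"
      proof -
        have "ln 3 * 1 \<le> ln 3 * L D" "\<bar>ln B\<bar> * 1 \<le> \<bar>ln B\<bar> * L D" using b(4) by (intro mult_left_mono; simp)+
        then show ?thesis by (simp only: E_def distrib_right)
      qed
      finally have 3: "ln (X D) \<le> E * L D" .
      have "(1 / \<theta> D - 1) * ln (X D) \<le> 20 * (exp (- sqrt (l D)) / L D) * (E * L D)"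
        using 0 2 3 X1[OF D1] b(4) by (intro mult_mono) auto
      also have "\<dots> = 20 * E * exp (- sqrt (l D))" using b(4) by simp
      finally show ?case using 0 X1[OF D1] by simp
    qed
    have "filterlim (\<lambda>D. sqrt (l D)) at_top sequentially" by (rule filterlim_compose[OF sqrt_at_top asy(1)])
    then have "(\<lambda>D. exp (- sqrt (l D))) \<longlonglongrightarrow> 0"
      by (intro filterlim_compose[OF exp_at_bot]) (simp add: filterlim_uminus_at_bot)
    then show "(\<lambda>D. 20 * E * exp (- sqrt (l D))) \<longlonglongrightarrow> 0" by (rule tendsto_mult_right_zero)
  qed
  have "(\<lambda>D. exp ((1 / \<theta> D - 1) * ln (X D))) \<longlonglongrightarrow> 1" using tendsto_exp[OF lim3] by simp
  then have "(\<lambda>D. 3 / c * (prime_product (cutoff D) / (real (cutoff D))\<^sup>2) * (cutoff D / l D)\<^sup>2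
      * exp ((1 / \<theta> D - 1) * ln (X D))) \<longlonglongrightarrow> 3 / c * m * 1\<^sup>2 * 1"
    by (intro tendsto_mult tendsto_const lim1 tendsto_power cutoff_ratio)
  moreover have "eventually (\<lambda>D. 3 / c * (prime_product (cutoff D) / (real (cutoff D))\<^sup>2) * (cutoff D / l D)\<^sup>2
      * exp ((1 / \<theta> D - 1) * ln (X D)) = size_bound D / (c * (real D)\<^sup>2 * (l D)\<^sup>2)) sequentially"
    using evD
  proof eventually_elim
    case (elim D)
    then have l1: "l D \<ge> 1" and D1: "D \<ge> 1" by auto
    note b = bounds[OF l1]
    have "size_bound D = X D powr (1 + (1 / \<theta> D - 1))" by (simp add: size_bound_def X_def \<theta>_def)
    also have "\<dots> = X D powr 1 * X D powr (1 / \<theta> D - 1)" by (rule powr_add)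
    also have "\<dots> = X D * exp ((1 / \<theta> D - 1) * ln (X D))" using X1[OF D1] by (simp add: powr_def)
    finally have s: "size_bound D = X D * exp ((1 / \<theta> D - 1) * ln (X D))" .
    have "3 / c * (prime_product (cutoff D) / (real (cutoff D))\<^sup>2) * (cutoff D / l D)\<^sup>2
        = X D / (c * (real D)\<^sup>2 * (l D)\<^sup>2)"
      using b(3) D1 l1 c unfolding X_def by (simp add: power_divide)
    then show ?case unfolding s by simp
  qed
  ultimately have "(\<lambda>D. size_bound D / (c * (real D)\<^sup>2 * (l D)\<^sup>2)) \<longlonglongrightarrow> 3 / c * m"
    by (simp add: Lim_transform_eventually)
  moreover have "3 / c * m \<le> 1"
  proof -
    have "3 * m \<le> c" using m(2) by (simp add: c_def)
    then show ?thesis using c by simp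
  qed
  ultimately show ?thesis unfolding l_def by blast
qed

lemma part_one:
  "\<exists>\<epsilon> :: nat \<Rightarrow> real. \<epsilon> \<longlonglongrightarrow> 0 \<and>
    (\<forall>K D L as bs. K \<ge> 1 \<longrightarrow> D \<ge> 1 \<longrightarrow> L = K + D \<longrightarrow>
       integral_factorial_ratio K L as bs \<longrightarrow>
       real (K + L) \<le> (1 + \<epsilon> D) * (18 * exp (2 * euler_mascheroni) / pi\<^sup>2)
                       * (real D)\<^sup>2 * (ln (ln (real (D + 2))))\<^sup>2)"
proof -
  define Y where "Y = (\<lambda>D::nat. (18 * exp (2 * euler_mascheroni) / pi\<^sup>2) * (real D)\<^sup>2 * (ln (ln (real (D + 2))))\<^sup>2)"
  obtain m where m: "m \<le> 1" "(\<lambda>D. size_bound D / Y D) \<longlonglongrightarrow> m"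
    using size_bound_ratio unfolding Y_def by blast
  \<comment> \<open>The maximum with 0 is for m < 1, where the ratio minus 1 does not tend to
    0.\<close>
  define \<epsilon> where "\<epsilon> = (\<lambda>D. max 0 (size_bound D / Y D - 1))"
  have "(\<lambda>D. max 0 (size_bound D / Y D - 1)) \<longlonglongrightarrow> max 0 (m - 1)"
    by (intro tendsto_max tendsto_const tendsto_diff m(2))
  then have lim: "\<epsilon> \<longlonglongrightarrow> 0" using m(1) by (simp add: \<epsilon>_def)
  have "real (K + L) \<le> (1 + \<epsilon> D) * Y D"
    if "D \<ge> 1" "L = K + D" "integral_factorial_ratio K L as bs" for K D L as bs
  proof -
    have Y: "Y D > 0" using ln_ln_pos[OF that(1)] that(1) by (simp add: Y_def)
    have "real (K + L) \<le> size_bound D" using size_le[OF that(1)] that by simp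
    also have "\<dots> = size_bound D / Y D * Y D" using Y by simp
    also have "\<dots> \<le> (1 + \<epsilon> D) * Y D" using Y by (intro mult_right_mono) (auto simp: \<epsilon>_def)
    finally show ?thesis .
  qed
  then show ?thesis using lim unfolding Y_def by (intro exI[of _ \<epsilon>]) (simp add: mult.assoc)
qed

section \<open>Tight components\<close>

text \<open>The threshold is on the size \<open>p ^ k\<close> of a gap, so one T governs all primes:
  those that are at least T do not vary at all on a tight support, and the smaller ones vary only in
  bounded steps.\<close>

definition tight :: "nat \<Rightarrow> (nat \<Rightarrow> int) \<Rightarrow> bool" where
  "tight T f \<longleftrightarrow> (\<forall>p k A. prime p \<longrightarrow> k > 0 \<longrightarrow> T \<le> p ^ k \<longrightarrow>
     (\<forall>a\<in>supp f \<inter> A. \<forall>b\<in>supp f - A. multiplicity p a + k \<le> multiplicity p b) \<longrightarrow>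
     supp f \<inter> A = {} \<or> supp f - A = {})"

text \<open>The merged function has nonnegative energy and is dropped, so a cut at a gap of size at
  least T makes the energy superadditive up to the factor 1 - 1/T.\<close>

lemma not_tight_cut:
  assumes f: "admissible f" and T: "T \<ge> 1" and nt: "\<not> tight T f"
  obtains A where "mass (restr f A) > 0" "mass (restr f (-A)) > 0"
    "mass (restr f A) + mass (restr f (-A)) = mass f"
    "(1 - 1 / T) * (energy (restr f A) + energy (restr f (-A))) \<le> energy f"
proof -
  obtain p k A where p: "prime p" "k > 0" "T \<le> p ^ k"
    and A: "\<And>a b. a \<in> supp f \<inter> A \<Longrightarrow> b \<in> supp f - A \<Longrightarrow> multiplicity p a + k \<le> multiplicity p b"
    and ne: "supp f \<inter> A \<noteq> {}" "supp f - A \<noteq> {}"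
    using nt unfolding tight_def by blast
  note c = cut[OF f p(1,2) A ne]
  have "real T \<le> real p ^ k" using p(3) by (metis of_nat_le_iff of_nat_power)
  then have "1 / real p ^ k \<le> 1 / real T" using T prime_gt_0_nat[OF p(1)] by (intro divide_left_mono) auto
  then have "(1 - 1 / T) * (energy (restr f A) + energy (restr f (-A)))
      \<le> (1 - 1 / real p ^ k) * (energy (restr f A) + energy (restr f (-A)))"
    using energy_nonneg[OF c(1)] energy_nonneg[OF c(2)] by (intro mult_right_mono) auto
  also have "\<dots> \<le> energy f"
  proof -
    have "0 \<le> 1 / real p ^ k * energy (merge (p ^ k) A f)" using energy_nonneg[OF c(3)] by simp
    then show ?thesis using c(4) by linarith
  qed
  finally show ?thesis using that c by blast
qed

lemma restr_restr: "S \<subseteq> A \<Longrightarrow> restr (restr f A) S = restr f S"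
  by (rule ext) (auto simp: restr_def)

lemma restr_supp: "restr f (supp f) = f"
  by (rule ext) (simp add: restr_def supp_def)

text \<open>Both parts of a cut have smaller mass, so the tree of cuts has depth at most
  \<open>mass f\<close>, and each level costs one factor 1 - 1/T.\<close>

lemma tight_decomposition:
  assumes f: "admissible f" and T: "T \<ge> 1"
  shows "\<exists>\<S>. finite \<S> \<and> \<Union>\<S> = supp f \<and> disjoint \<S> \<and> {} \<notin> \<S> \<and> (\<forall>S\<in>\<S>. tight T (restr f S))
    \<and> (1 - 1 / T) ^ mass f * (\<Sum>S\<in>\<S>. energy (restr f S)) \<le> energy f"
  using f
proof (induction "mass f" arbitrary: f rule: less_induct)
  case less
  note f = less.prems
  have q: "0 \<le> 1 - 1 / real T" "1 - 1 / real T \<le> 1" using T by auto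
  consider "supp f = {}" | "supp f \<noteq> {}" "tight T f" | "\<not> tight T f" by blast
  then show ?case
  proof cases
    case 1
    then show ?thesis by (intro exI[of _ "{}"]) (auto simp: energy_empty disjoint_def)
  next
    case 2
    have "(1 - 1 / real T) ^ mass f * energy f \<le> 1 * energy f"
      using q energy_nonneg[OF f] by (intro mult_right_mono power_le_one) auto
    then show ?thesis using 2 by (intro exI[of _ "{supp f}"]) (auto simp: restr_supp disjoint_def)
  next
    case 3
    then obtain A where A: "mass (restr f A) > 0" "mass (restr f (-A)) > 0"
      "mass (restr f A) + mass (restr f (-A)) = mass f"
      "(1 - 1 / T) * (energy (restr f A) + energy (restr f (-A))) \<le> energy f"
      using not_tight_cut[OF f T] by metis
    let ?g = "restr f A" and ?h = "restr f (-A)" and ?q = "1 - 1 / real T"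
    obtain \<G> where G: "finite \<G>" "\<Union>\<G> = supp ?g" "disjoint \<G>" "{} \<notin> \<G>" "\<forall>S\<in>\<G>. tight T (restr ?g S)"
      "?q ^ mass ?g * (\<Sum>S\<in>\<G>. energy (restr ?g S)) \<le> energy ?g"
      using less.hyps[of ?g] A admissible_restr[OF f] by auto
    obtain \<H> where H: "finite \<H>" "\<Union>\<H> = supp ?h" "disjoint \<H>" "{} \<notin> \<H>" "\<forall>S\<in>\<H>. tight T (restr ?h S)"
      "?q ^ mass ?h * (\<Sum>S\<in>\<H>. energy (restr ?h S)) \<le> energy ?h"
      using less.hyps[of ?h] A admissible_restr[OF f] by auto
    have sub: "S \<subseteq> A" if "S \<in> \<G>" for S using G(2) that by (auto simp: supp_restr)
    have sub': "S \<subseteq> - A" if "S \<in> \<H>" for S using H(2) that by (auto simp: supp_restr)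
    have disj: "\<G> \<inter> \<H> = {}"
    proof (intro equals0I)
      fix S assume S: "S \<in> \<G> \<inter> \<H>"
      then have "S = {}" using sub[of S] sub'[of S] by auto
      then show False using S G(4) by auto
    qed
    define X Y where "X = (\<Sum>S\<in>\<G>. energy (restr f S))" and "Y = (\<Sum>S\<in>\<H>. energy (restr f S))"
    have X: "(\<Sum>S\<in>\<G>. energy (restr ?g S)) = X" and Y: "(\<Sum>S\<in>\<H>. energy (restr ?h S)) = Y"
      unfolding X_def Y_def by (intro sum.cong refl; simp add: restr_restr sub sub')+
    have XY0: "X \<ge> 0" "Y \<ge> 0"
      unfolding X_def Y_def by (intro sum_nonneg energy_nonneg admissible_restr f)+
    have pw: "?q ^ mass f \<le> ?q * ?q ^ k" if "k < mass f" for k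
      using q that power_decreasing[of "Suc k" "mass f" ?q] by simp
    have "?q ^ mass f * (X + Y) = ?q ^ mass f * X + ?q ^ mass f * Y" by (simp add: distrib_left)
    also have "\<dots> \<le> ?q * ?q ^ mass ?g * X + ?q * ?q ^ mass ?h * Y"
      using A XY0 by (intro add_mono mult_right_mono pw) auto
    also have "\<dots> = ?q * (?q ^ mass ?g * X + ?q ^ mass ?h * Y)" by (simp add: algebra_simps)
    also have "\<dots> \<le> ?q * (energy ?g + energy ?h)"
      using G(6) H(6) q unfolding X Y by (intro mult_left_mono add_mono) auto
    also have "\<dots> \<le> energy f" by (rule A(4))
    finally have E: "?q ^ mass f * (\<Sum>S\<in>\<G> \<union> \<H>. energy (restr f S)) \<le> energy f"
      using G(1) H(1) disj by (simp add: sum.union_disjoint X_def Y_def)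
    have "S \<inter> S' = {}" if "S \<in> \<G>" "S' \<in> \<H>" for S S'
      using sub[OF that(1)] sub'[OF that(2)] by auto
    then have "disjoint (\<G> \<union> \<H>)"
      using G(3) H(3) unfolding disjoint_def by (metis Int_commute Un_iff)
    moreover have "\<Union>(\<G> \<union> \<H>) = supp f" using G(2) H(2) by (auto simp: supp_restr)
    moreover have "tight T (restr f S)" if "S \<in> \<G> \<union> \<H>" for S
      using that G(5) H(5) restr_restr[OF sub] restr_restr[OF sub'] by fastforce
    moreover have "finite (\<G> \<union> \<H>)" "{} \<notin> \<G> \<union> \<H>" using G(1,4) H(1,4) by simp_all
    ultimately show ?thesis using E by blast
  qed
qed

text \<open>Between consecutive values of the valuation on the support the gap k satisfies
  \<open>p ^ k < T\<close>, otherwise there would be a cut. The exponent on the right bounds the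
  number of such steps from c up to w.\<close>

lemma tight_power_le:
  assumes t: "tight T f" and f: "admissible f" and T: "T \<ge> 1" and p: "prime p"
    and w: "w \<in> supp f" and c: "c \<in> supp f"
  shows "p ^ (multiplicity p w - multiplicity p c) \<le> T ^ card {v \<in> multiplicity p ` supp f. v < multiplicity p w}"
  using w
proof (induction "multiplicity p w" arbitrary: w rule: less_induct)
  case less
  note w = less.prems
  let ?m = "multiplicity p"
  let ?V = "\<lambda>w. {v \<in> ?m ` supp f. v < ?m w}"
  have fin: "finite (?V w)" for w using f by (simp add: admissible_def)
  show ?case
  proof (cases "?m w \<le> ?m c")
    case True
    have "T ^ card (?V w) \<ge> 1" using T by simp
    then show ?thesis using True by simp
  next
    case False
    define u where "u = Max (?V w)"
    have cV: "?m c \<in> ?V w" using False c by auto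
    then have "?V w \<noteq> {}" by blast
    then have u: "u \<in> ?V w" unfolding u_def by (rule Max_in[OF fin])
    have uc: "?m c \<le> u" unfolding u_def using fin cV by (rule Max_ge)
    from u obtain w' where w': "w' \<in> supp f" "?m w' = u" "u < ?m w" by auto
    define k where "k = ?m w - u"
    have k: "k > 0" using w' by (simp add: k_def)
    have "\<forall>a\<in>supp f \<inter> {x. ?m x \<le> u}. \<forall>b\<in>supp f - {x. ?m x \<le> u}. ?m a + k \<le> ?m b"
    proof (intro ballI)
      fix a b assume a: "a \<in> supp f \<inter> {x. ?m x \<le> u}" and b: "b \<in> supp f - {x. ?m x \<le> u}"
      have "\<not> ?m b < ?m w"
      proof
        assume "?m b < ?m w"
        then have "?m b \<in> ?V w" using b by auto
        then have "?m b \<le> u" unfolding u_def using fin by simp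
        then show False using b by simp
      qed
      moreover have "?m a \<le> u" "u + k = ?m w" using a w' by (simp_all add: k_def)
      ultimately show "?m a + k \<le> ?m b" by linarith
    qed
    moreover have "supp f \<inter> {x. ?m x \<le> u} \<noteq> {}" "supp f - {x. ?m x \<le> u} \<noteq> {}" using w w' by auto
    ultimately have "p ^ k < T" using t p k unfolding tight_def by (meson not_le)
    moreover have "p ^ (u - ?m c) \<le> T ^ card (?V w')" using less.hyps[of w'] w' by simp
    ultimately have "p ^ k * p ^ (u - ?m c) \<le> T * T ^ card (?V w')" by (intro mult_mono) auto
    also have "\<dots> = T ^ card (insert u (?V w'))" using fin w'(2) by simp
    also have "\<dots> \<le> T ^ card (?V w)"
    proof (rule power_increasing)
      show "card (insert u (?V w')) \<le> card (?V w)"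
        using u w' by (intro card_mono fin) auto
    qed (rule T)
    also have "p ^ k * p ^ (u - ?m c) = p ^ (?m w - ?m c)"
      using uc w' by (simp add: k_def power_add[symmetric])
    finally show ?thesis .
  qed
qed

text \<open>Dividing by the gcd leaves finitely many shapes of given mass. For every prime p
  dividing the quotient some c in the support has exactly the valuation of the gcd at p; comparing a
  with c gives p < T and bounds the p-part of the quotient.\<close>

lemma tight_le:
  assumes t: "tight T f" and f: "admissible f" and T: "T \<ge> 1" and a: "a \<in> supp f"
  shows "a div Gcd (supp f) \<le> T ^ (mass f * T)"
proof -
  define g where "g = Gcd (supp f)"
  have fin: "finite (supp f)" using f by (simp add: admissible_def)
  have gd: "g dvd x" if "x \<in> supp f" for x using that by (simp add: g_def)
  have a0: "a > 0" using admissible_pos[OF f a] .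
  have g0: "g > 0" using gd[OF a] a0 by (intro Nat.gr0I) auto
  define b where "b = a div g"
  have ab: "a = g * b" using gd[OF a] by (simp add: b_def)
  have b0: "b > 0" using ab a0 by (intro Nat.gr0I) auto
  have key: "p < T \<and> p ^ multiplicity p b \<le> T ^ mass f" if "p \<in> prime_factors b" for p
  proof -
    have p: "prime p" "p dvd b" using that by auto
    have "\<exists>c\<in>supp f. \<not> p * g dvd c"
    proof (rule ccontr)
      assume "\<not> ?thesis"
      then have "p * g dvd g" unfolding g_def by (intro Gcd_greatest) (auto simp: g_def)
      then have "p dvd 1" using g0 by simp
      then show False using p by (simp add: not_prime_unit)
    qed
    then obtain c where c: "c \<in> supp f" "\<not> p * g dvd c" by blast
    obtain d where d: "c = g * d" using gd[OF c(1)] by blast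
    have nd: "\<not> p dvd d" using c(2) d g0 by (simp add: mult.commute)
    then have d0: "d > 0" by (intro Nat.gr0I) auto
    have mc: "multiplicity p c = multiplicity p g"
      unfolding d using p g0 d0 nd by (subst prime_elem_multiplicity_mult_distrib) (auto simp: not_dvd_imp_multiplicity_0)
    have ma: "multiplicity p a = multiplicity p g + multiplicity p b"
      unfolding ab using p g0 b0 by (subst prime_elem_multiplicity_mult_distrib) auto
    have pos: "multiplicity p b > 0" using p b0 by (simp add: prime_multiplicity_gt_zero_iff)
    have "p < T"
    proof (rule ccontr)
      assume "\<not> p < T"
      then have "T \<le> p ^ 1" by simp
      moreover have "\<forall>x\<in>supp f \<inter> {x. multiplicity p x \<le> multiplicity p c}.
          \<forall>y\<in>supp f - {x. multiplicity p x \<le> multiplicity p c}. multiplicity p x + 1 \<le> multiplicity p y" by auto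
      ultimately have "supp f \<inter> {x. multiplicity p x \<le> multiplicity p c} = {}
          \<or> supp f - {x. multiplicity p x \<le> multiplicity p c} = {}"
        using t p(1) unfolding tight_def by (metis less_numeral_extra(1))
      then show False using c a mc ma pos by auto
    qed
    have "p ^ multiplicity p b = p ^ (multiplicity p a - multiplicity p c)" using ma mc by simp
    also have "\<dots> \<le> T ^ card {v \<in> multiplicity p ` supp f. v < multiplicity p a}"
      by (rule tight_power_le[OF t f T p(1) a c(1)])
    also have "\<dots> \<le> T ^ mass f"
    proof (rule power_increasing[OF _ T])
      have "card {v \<in> multiplicity p ` supp f. v < multiplicity p a} \<le> card (multiplicity p ` supp f)"
        using fin by (intro card_mono) auto
      also have "\<dots> \<le> card (supp f)" using fin by (rule card_image_le)
      also have "\<dots> = (\<Sum>x\<in>supp f. 1)" by simp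
      also have "\<dots> \<le> mass f" unfolding mass_def by (intro sum_mono) (auto simp: supp_def)
      finally show "card {v \<in> multiplicity p ` supp f. v < multiplicity p a} \<le> mass f" .
    qed
    finally show ?thesis using \<open>p < T\<close> by simp
  qed
  have "b = (\<Prod>p\<in>prime_factors b. p ^ multiplicity p b)"
    using b0 by (intro prime_factorization_nat)
  also have "\<dots> \<le> (\<Prod>p\<in>prime_factors b. T ^ mass f)"
    using key by (intro prod_mono) auto
  also have "\<dots> = T ^ (mass f * card (prime_factors b))" by (simp add: power_mult)
  also have "\<dots> \<le> T ^ (mass f * T)"
  proof (intro power_increasing mult_le_mono T order_refl)
    have "card (prime_factors b) \<le> card {..<T}" using key by (intro card_mono) auto
    then show "card (prime_factors b) \<le> T" by simp
  qed
  finally show ?thesis by (simp add: b_def g_def)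
qed

text \<open>Mass at most 2 leaves one support point, or two with coefficients 1 or -1; neither
  balances, since the two points are distinct and positive.\<close>

lemma balanced_mass_ge_3:
  assumes f: "admissible f" and ne: "supp f \<noteq> {}" and bal: "(\<Sum>a\<in>supp f. f a * int a) = 0"
  shows "mass f \<ge> 3"
proof (rule ccontr)
  assume "\<not> mass f \<ge> 3"
  then have m: "mass f \<le> 2" by simp
  have fin: "finite (supp f)" using f by (simp add: admissible_def)
  obtain a where a: "a \<in> supp f" using ne by blast
  have a0: "a > 0" "f a \<noteq> 0" using admissible_pos[OF f a] a by (auto simp: supp_def)
  show False
  proof (cases "supp f = {a}")
    case True
    then show False using bal a0 by simp
  next
    case False
    then obtain b where b: "b \<in> supp f" "b \<noteq> a" using a by blast
    have b0: "b > 0" "f b \<noteq> 0" using admissible_pos[OF f b(1)] b by (auto simp: supp_def)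
    define R where "R = supp f - {a, b}"
    have s: "supp f = insert a (insert b R)" "a \<notin> insert b R" "b \<notin> R" "finite R"
      using a b fin by (auto simp: R_def)
    have "mass f = nat \<bar>f a\<bar> + (nat \<bar>f b\<bar> + (\<Sum>x\<in>R. nat \<bar>f x\<bar>))"
      unfolding mass_def s(1) using s(2-4) by simp
    then have 1: "\<bar>f a\<bar> = 1" "\<bar>f b\<bar> = 1" "(\<Sum>x\<in>R. nat \<bar>f x\<bar>) = 0" using m a0 b0 by linarith+
    then have "\<forall>x\<in>R. f x = 0" using s(4) by simp
    then have "R = {}" by (auto simp: R_def supp_def)
    then have "f a * int a + f b * int b = 0" using bal s by simp
    then show False using 1 a0 b0 b(2) by (auto simp: abs_if split: if_splits)
  qed
qed

section \<open>Coordinates and the balance functional\<close>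

lemma point_of_lookup: "Poly_Mapping.lookup (point_of ys) i = (if i < length ys then real (ys ! i) else 0)"
  by (simp add: point_of_def nth.rep_eq nth_default_def)

lemma lookup_scaleR: "Poly_Mapping.lookup (r *\<^sub>R v) i = r * Poly_Mapping.lookup (v :: nat \<Rightarrow>\<^sub>0 real) i"
proof -
  have "finite {i. r *\<^sub>R Poly_Mapping.lookup v i \<noteq> 0}"
    by (rule finite_subset[of _ "Poly_Mapping.keys v"]) (auto simp: in_keys_iff)
  then show ?thesis by (simp add: scaleR_poly_mapping_def)
qed

definition balance :: "nat \<Rightarrow> nat \<Rightarrow> (nat \<Rightarrow>\<^sub>0 real) \<Rightarrow> real" where
  "balance K n v = (\<Sum>i<K. Poly_Mapping.lookup v i) - (\<Sum>i\<in>{K..<n}. Poly_Mapping.lookup v i)"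

lemma linear_balance: "linear (balance K n)"
  by (rule linearI)
    (simp_all add: balance_def lookup_add lookup_scaleR sum.distrib sum_distrib_left[symmetric] algebra_simps)

lemma balance_point_of:
  "balance (length as) (length as + length bs) (point_of (map h (as @ bs)))
    = (\<Sum>a\<leftarrow>as. real (h a)) - (\<Sum>b\<leftarrow>bs. real (h b))"
proof -
  have 1: "(\<Sum>i<length as. Poly_Mapping.lookup (point_of (map h (as @ bs))) i) = (\<Sum>a\<leftarrow>as. real (h a))"
    unfolding sum_list_sum_nth atLeast0LessThan
    by (simp add: point_of_lookup nth_append)
  have "(\<Sum>i\<in>{length as..<length as + length bs}. Poly_Mapping.lookup (point_of (map h (as @ bs))) i)
      = (\<Sum>i\<in>{0..<length bs}. Poly_Mapping.lookup (point_of (map h (as @ bs))) (i + length as))"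
    using sum.shift_bounds_nat_ivl[of _ 0 "length as" "length bs"] by (simp add: add.commute)
  also have "\<dots> = (\<Sum>b\<leftarrow>bs. real (h b))"
    unfolding sum_list_sum_nth by (simp add: point_of_lookup nth_append)
  finally show ?thesis using 1 by (simp add: balance_def)
qed

text \<open>The projection \<open>\<pi>\<close> along w fixes the kernel and kills w, so the
  intersection lies in the span of the images of the other elements of W.\<close>

lemma dim_span_inter_kernel_le:
  fixes \<phi> :: "'a::real_vector \<Rightarrow> real"
  assumes lin: "linear \<phi>" and W: "finite W" and w: "w \<in> W" "\<phi> w \<noteq> 0"
  shows "dim (span W \<inter> {v. \<phi> v = 0}) \<le> card W - 1"
proof -
  define \<pi> where "\<pi> = (\<lambda>v. v - (\<phi> v / \<phi> w) *\<^sub>R w)"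
  have lp: "linear \<pi>"
    by (rule linearI)
      (simp_all add: \<pi>_def linear_add[OF lin] linear_scale[OF lin] add_divide_distrib scaleR_add_left scaleR_diff_right)
  have "\<pi> w = 0" using w by (simp add: \<pi>_def)
  then have "\<pi> ` W \<subseteq> insert 0 (\<pi> ` (W - {w}))" by auto
  then have sp: "span (\<pi> ` W) \<subseteq> span (\<pi> ` (W - {w}))"
    using span_mono[of "\<pi> ` W" "insert 0 (\<pi> ` (W - {w}))"] by simp
  have "span W \<inter> {v. \<phi> v = 0} \<subseteq> span (\<pi> ` (W - {w}))"
  proof
    fix v assume v: "v \<in> span W \<inter> {v. \<phi> v = 0}"
    then have "v = \<pi> v" by (simp add: \<pi>_def)
    then have "v \<in> \<pi> ` span W" using v by blast
    then show "v \<in> span (\<pi> ` (W - {w}))" using sp by (auto simp: linear_span_image[OF lp])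
  qed
  then have "dim (span W \<inter> {v. \<phi> v = 0}) \<le> card (\<pi> ` (W - {w}))" using W by (intro dim_le_card) auto
  also have "\<dots> \<le> card (W - {w})" using W by (intro card_image_le) auto
  finally show ?thesis using W w by simp
qed

section \<open>The three statements\<close>

lemma part_two:
  fixes K D :: nat
  assumes D: "D \<ge> 1"
  defines "n \<equiv> K + (K + D)"
  shows "\<exists>\<V> :: (nat \<Rightarrow>\<^sub>0 real) set set. finite \<V> \<and>
    (\<forall>V\<in>\<V>. subspace V \<and> V \<subseteq> coord_space n \<and> dim V \<le> 3 * D\<^sup>2 - 1) \<and>
    (\<forall>as bs. integral_factorial_ratio K (K + D) as bs \<longrightarrow> point_of (as @ bs) \<in> \<Union>\<V>)"
proof -
  define d where "d = 3 * (real D)\<^sup>2"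
  have d: "d \<ge> 3" using D one_le_power[of "real D" 2] by (simp add: d_def)
  \<comment> \<open>By Bernoulli's inequality the n-th power of 1 - 1/T takes at most (d + 0.3) n/T
    \<le> 1/10 away from d + 0.3. The margin 0.3 is the excess of 1.3, the energy of a balanced
    piece, over 1.\<close>
  define T where "T = 10 * n * (3 * D\<^sup>2 + 1)"
  have n0: "n \<ge> 1" using D by (simp add: n_def)
  have rT: "real T = real n * (10 * (d + 1))" by (simp add: T_def d_def algebra_simps)
  have T1: "T \<ge> 1" using n0 by (simp add: T_def)
  have Tpos: "real T > 0" using T1 by simp
  have q0: "1 - 1 / real T \<ge> 0" using T1 by simp
  have big: "(1 - 1 / real T) ^ n * (d + 0.3) > d"
  proof -
    have "1 + n * (- 1 / real T) \<le> (1 + (- 1 / real T)) ^ n"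
      using T1 by (intro Bernoulli_inequality) auto
    then have "1 - n / real T \<le> (1 - 1 / real T) ^ n" by simp
    then have "(1 - n / real T) * (d + 0.3) \<le> (1 - 1 / real T) ^ n * (d + 0.3)"
      using d by (intro mult_right_mono) auto
    moreover have "n / real T = 1 / (10 * (d + 1))" unfolding rT using n0 by simp
    then have "n / real T * (d + 0.3) \<le> 1 / 10" using d by (simp add: field_simps)
    then have "(1 - n / real T) * (d + 0.3) > d" by (simp add: left_diff_distrib)
    ultimately show ?thesis by linarith
  qed
  define B where "B = T ^ (n * T)"
  define \<W> where "\<W> = point_of ` {ys. set ys \<subseteq> {..B} \<and> length ys = n}"
  have fin\<W>: "finite \<W>" unfolding \<W>_def by (intro finite_imageI finite_lists_length_eq) simp
  define H where "H = {v. balance K n v = 0}"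
  \<comment> \<open>The dimension bound is built into the family, so it has to be verified only for
    the spans that actually occur.\<close>
  define \<V> where "\<V> = {V. dim V \<le> 3 * D\<^sup>2 - 1 \<and> (\<exists>S\<subseteq>\<W>. V = span S \<inter> H)}"
  have subH: "subspace H"
    unfolding H_def using linear_balance by (rule linear_subspace_kernel)
  have "\<V> \<subseteq> (\<lambda>S. span S \<inter> H) ` Pow \<W>" by (auto simp: \<V>_def)
  then have fin\<V>: "finite \<V>" using fin\<W> by (meson finite_Pow_iff finite_imageI finite_subset)
  have spaces: "subspace V \<and> V \<subseteq> coord_space n \<and> dim V \<le> 3 * D\<^sup>2 - 1" if V: "V \<in> \<V>" for V
  proof -
    obtain S where S: "S \<subseteq> \<W>" "V = span S \<inter> H" using V by (auto simp: \<V>_def)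
    have "S \<subseteq> coord_space n" using S(1) point_of_in_coord_space by (auto simp: \<W>_def)
    then have "span S \<subseteq> coord_space n" using subspace_coord_space by (rule span_minimal)
    then show ?thesis using V S subH subspace_inter[OF subspace_span] by (auto simp: \<V>_def)
  qed
  have cover: "point_of (as @ bs) \<in> \<Union>\<V>" if r: "integral_factorial_ratio K (K + D) as bs" for as bs
  proof -
    define f where "f = signed_count as bs"
    have f: "admissible f" unfolding f_def by (rule admissible_signed_count[OF r])
    have mass: "mass f = n" unfolding f_def n_def by (rule mass_signed_count[OF r])
    have len: "length as = K" "length bs = K + D" "length (as @ bs) = n"
      using r by (auto simp: integral_factorial_ratio_def n_def)
    have sf: "supp f = set (as @ bs)" using supp_signed_count[OF r] by (simp add: f_def)
    have finf: "finite (supp f)" using f by (simp add: admissible_def)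
    from tight_decomposition[OF f T1]
    obtain \<S> where \<S>: "finite \<S>" "\<Union>\<S> = supp f" "disjoint \<S>" "{} \<notin> \<S>"
      "\<forall>S\<in>\<S>. tight T (restr f S)"
      "(1 - 1 / real T) ^ mass f * (\<Sum>S\<in>\<S>. energy (restr f S)) \<le> energy f"
      by (elim exE conjE) (rule that)
    have le_d: "(1 - 1 / real T) ^ n * (\<Sum>S\<in>\<S>. energy (restr f S)) \<le> d"
      using \<S>(6) energy_le[OF r, folded f_def] unfolding mass d_def by linarith
    have lt: "(\<Sum>S\<in>\<S>. energy (restr f S)) < d + 0.3"
    proof (rule ccontr)
      assume "\<not> ?thesis"
      then have "(1 - 1 / real T) ^ n * (d + 0.3) \<le> (1 - 1 / real T) ^ n * (\<Sum>S\<in>\<S>. energy (restr f S))"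
        using q0 by (intro mult_left_mono) auto
      then show False using le_d big by linarith
    qed
    have sub: "S \<subseteq> supp f" "S \<noteq> {}" if "S \<in> \<S>" for S using \<S> that by auto
    have supS: "supp (restr f S) = S" if "S \<in> \<S>" for S using sub[OF that] by (auto simp: supp_restr)
    have adS: "admissible (restr f S)" for S by (rule admissible_restr[OF f])
    have e1: "energy (restr f S) \<ge> 1" if "S \<in> \<S>" for S
      using energy_ge_1[OF adS] supS[OF that] sub[OF that] by simp
    have "real (card \<S>) = (\<Sum>S\<in>\<S>. 1)" by simp
    also have "\<dots> \<le> (\<Sum>S\<in>\<S>. energy (restr f S))" by (rule sum_mono[OF e1])
    finally have "real (card \<S>) < real (3 * D\<^sup>2) + 0.3" using lt by (simp add: d_def)
    then have card_le: "card \<S> \<le> 3 * D\<^sup>2" by linarith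
    \<comment> \<open>The shape of the piece S, placed at the coordinates of the tuple: it vanishes
      at the entries outside S, and w S has bounded entries by \<open>tight_le\<close>.\<close>
    define h where "h = (\<lambda>S x. if x \<in> S then x div Gcd S else (0::nat))"
    define w where "w = (\<lambda>S. point_of (map (h S) (as @ bs)))"
    have gcd: "Gcd S dvd x" "x > 0" if "S \<in> \<S>" "x \<in> S" for S x
      using that sub[OF that(1)] admissible_pos[OF f] by auto
    have w\<W>: "w S \<in> \<W>" if S: "S \<in> \<S>" for S
    proof -
      have "h S x \<le> B" for x
      proof (cases "x \<in> S")
        case True
        have "x div Gcd S \<le> T ^ (mass (restr f S) * T)"
          using tight_le[OF bspec[OF \<S>(5) S] adS T1, of x] True supS[OF S] by simp
        also have "\<dots> \<le> T ^ (n * T)"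
        proof (intro power_increasing T1 mult_right_mono)
          show "mass (restr f S) \<le> n" using mass_restr_split[OF f, of S] mass by simp
        qed simp
        finally show ?thesis using True by (simp add: h_def B_def)
      qed (simp add: h_def)
      then have "map (h S) (as @ bs) \<in> {ys. set ys \<subseteq> {..B} \<and> length ys = n}" using len by auto
      then show ?thesis unfolding w_def \<W>_def by blast
    qed
    have point: "point_of (as @ bs) = (\<Sum>S\<in>\<S>. real (Gcd S) *\<^sub>R w S)"
    proof (rule poly_mapping_eqI)
      fix i
      show "Poly_Mapping.lookup (point_of (as @ bs)) i = Poly_Mapping.lookup (\<Sum>S\<in>\<S>. real (Gcd S) *\<^sub>R w S) i"
      proof (cases "i < n")
        case True
        define x where "x = (as @ bs) ! i"
        have "x \<in> supp f" unfolding sf x_def using True len(3) by (metis nth_mem)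
        then obtain S0 where S0: "S0 \<in> \<S>" "x \<in> S0" using \<S>(2) by blast
        have lw: "Poly_Mapping.lookup (w S) i = real (h S x)" for S
          using True len(3) unfolding w_def point_of_lookup by (simp add: x_def del: map_append)
        have "real (Gcd S) * real (h S x) = (if S = S0 then real x else 0)" if "S \<in> \<S>" for S
        proof (cases "S = S0")
          case True
          have "real (Gcd S0) * real (x div Gcd S0) = real x" using gcd(1)[OF S0] by (metis dvd_mult_div_cancel of_nat_mult)
          then show ?thesis using True S0 by (simp add: h_def)
        next
          case False
          then have "x \<notin> S" using \<S>(3) that S0 unfolding disjoint_def by blast
          then show ?thesis using False by (simp add: h_def)
        qed
        then have "Poly_Mapping.lookup (\<Sum>S\<in>\<S>. real (Gcd S) *\<^sub>R w S) i = (\<Sum>S\<in>\<S>. if S = S0 then real x else 0)"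
          unfolding lookup_sum lookup_scaleR lw by (intro sum.cong) auto
        also have "\<dots> = real x" using \<S>(1) S0 by simp
        finally show ?thesis using True len(3) by (simp add: point_of_lookup x_def)
      next
        case False
        then show ?thesis using len(3) by (simp add: lookup_sum lookup_scaleR w_def point_of_lookup)
      qed
    qed
    define S where "S = w ` \<S>"
    have "S \<subseteq> \<W>" using w\<W> by (auto simp: S_def)
    have finS: "finite S" using \<S>(1) by (simp add: S_def)
    have "point_of (as @ bs) \<in> span S"
      unfolding point by (intro span_sum span_scale span_base) (simp add: S_def)
    moreover have "point_of (as @ bs) \<in> H"
    proof -
      have "balance K n (point_of (as @ bs)) = (\<Sum>a\<leftarrow>as. real a) - (\<Sum>b\<leftarrow>bs. real b)"
        using balance_point_of[of as bs id] len by simp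
      also have "\<dots> = real (sum_list as) - real (sum_list bs)" by (simp add: sum_list_of_nat)
      also have "\<dots> = 0" using r by (simp add: integral_factorial_ratio_def)
      finally show ?thesis by (simp add: H_def)
    qed
    moreover have "dim (span S \<inter> H) \<le> 3 * D\<^sup>2 - 1"
    proof (cases "card \<S> \<le> 3 * D\<^sup>2 - 1")
      case True
      have "dim (span S \<inter> H) \<le> card S" using finS by (intro dim_le_card) auto
      also have "\<dots> \<le> card \<S>" unfolding S_def using \<S>(1) by (rule card_image_le)
      finally show ?thesis using True by simp
    next
      case False
      \<comment> \<open>As many as 3 D^2 pieces, each of energy at least 1 and of total below d +
        0.3, have energy below 1.3 each, hence mass below 3, hence are unbalanced. So the balance
        functional does not vanish on their shapes and one dimension is lost.\<close>
      then have card: "card \<S> = 3 * D\<^sup>2" using card_le by simp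
      then have card_d: "real (card \<S>) = d" by (simp add: d_def)
      have "\<S> \<noteq> {}" using card D by auto
      then obtain S0 where S0: "S0 \<in> \<S>" by blast
      have "energy (restr f S0) < 1.3"
      proof -
        have "(\<Sum>S\<in>\<S>. energy (restr f S)) = energy (restr f S0) + (\<Sum>S\<in>\<S> - {S0}. energy (restr f S))"
          using \<S>(1) S0 by (rule sum.remove)
        moreover have "(\<Sum>S\<in>\<S> - {S0}. 1) \<le> (\<Sum>S\<in>\<S> - {S0}. energy (restr f S))"
          by (rule sum_mono) (use e1 in auto)
        moreover have "(\<Sum>S\<in>\<S> - {S0}. 1::real) = d - 1"
          using card_d S0 \<S>(1) d by (simp add: of_nat_diff)
        ultimately show ?thesis using lt by linarith
      qed
      then have m3: "\<not> mass (restr f S0) \<ge> 3"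
        using energy_ge_bound[OF adS, of S0] energy_bound_ge(3)[of "mass (restr f S0)"] by linarith
      have "(\<Sum>a\<in>S0. f a * int a) \<noteq> 0"
      proof
        assume "(\<Sum>a\<in>S0. f a * int a) = 0"
        then have "(\<Sum>a\<in>supp (restr f S0). restr f S0 a * int a) = 0"
          unfolding supS[OF S0] by (simp add: restr_def)
        then show False using balanced_mass_ge_3[OF adS] supS[OF S0] sub[OF S0] m3 by simp
      qed
      then have ne: "real_of_int (\<Sum>a\<in>S0. f a * int a) \<noteq> 0" by (simp only: of_int_eq_0_iff not_False_eq_True)
      define F where "F = (\<lambda>x. if x \<in> S0 then real x else 0)"
      have Fh: "real (Gcd S0) * real (h S0 x) = F x" for x
      proof (cases "x \<in> S0")
        case True
        have "real (Gcd S0) * real (x div Gcd S0) = real x" using gcd(1)[OF S0 True] by (metis dvd_mult_div_cancel of_nat_mult)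
        then show ?thesis using True by (simp add: h_def F_def)
      qed (simp add: h_def F_def)
      have "real (Gcd S0) * balance K n (w S0) = (\<Sum>a\<leftarrow>as. F a) - (\<Sum>b\<leftarrow>bs. F b)"
      proof -
        have "balance K n (w S0) = (\<Sum>a\<leftarrow>as. real (h S0 a)) - (\<Sum>b\<leftarrow>bs. real (h S0 b))"
          unfolding w_def using balance_point_of[of as bs "h S0"] len by simp
        then show ?thesis by (simp add: right_diff_distrib sum_list_const_mult[symmetric] Fh)
      qed
      also have "\<dots> = - (\<Sum>x\<in>supp f. real_of_int (f x) * F x)"
        using sum_signed_count[OF r, of F] by (simp add: f_def)
      also have "(\<Sum>x\<in>supp f. real_of_int (f x) * F x) = (\<Sum>x\<in>S0. real_of_int (f x) * real x)"
        using sub[OF S0] finf by (intro sum.mono_neutral_cong_right) (auto simp: F_def)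
      also have "\<dots> = real_of_int (\<Sum>a\<in>S0. f a * int a)" by simp
      finally have "balance K n (w S0) \<noteq> 0" using ne by auto
      moreover have "w S0 \<in> S" using S0 by (simp add: S_def)
      ultimately have "dim (span S \<inter> H) \<le> card S - 1"
        unfolding H_def by (intro dim_span_inter_kernel_le[OF linear_balance finS])
      also have "\<dots> \<le> card \<S> - 1" unfolding S_def using card_image_le[OF \<S>(1), of w] by simp
      finally show ?thesis using card by simp
    qed
    ultimately show ?thesis using \<open>S \<subseteq> \<W>\<close> unfolding \<V>_def by blast
  qed
  show ?thesis using fin\<V> spaces cover by blast
qed

text \<open>The mass is 2 K + 2, so only 76, 78 and 80 remain below 82. There a cut at a large gap
  would force the energy above 12, so the function is tight, and primitivity turns the bound on
  shapes into a bound on entries.\<close>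

lemma part_three:
  fixes K :: nat
  shows "K + (K + 2) \<ge> 82 \<Longrightarrow> \<not> (\<exists>as bs. integral_factorial_ratio K (K + 2) as bs)"
    and "K + (K + 2) \<ge> 76 \<Longrightarrow>
      finite {(as, bs). integral_factorial_ratio K (K + 2) as bs \<and> primitive (as @ bs)}"
proof -
  have le12: "energy (signed_count as bs) \<le> 12" if "integral_factorial_ratio K (K + 2) as bs" for as bs
    using energy_le[OF that] by simp
  have none: "\<not> integral_factorial_ratio K (K + 2) as bs" if "K + (K + 2) \<ge> 82" for as bs
  proof
    assume r: "integral_factorial_ratio K (K + 2) as bs"
    have "energy_bound (mass (signed_count as bs)) \<le> 12"
      using energy_ge_bound[OF admissible_signed_count[OF r]] le12[OF r] by linarith
    then show False using that by (simp add: mass_signed_count[OF r] energy_bound_def)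
  qed
  then show "K + (K + 2) \<ge> 82 \<Longrightarrow> \<not> (\<exists>as bs. integral_factorial_ratio K (K + 2) as bs)" by blast
  assume K: "K + (K + 2) \<ge> 76"
  show "finite {(as, bs). integral_factorial_ratio K (K + 2) as bs \<and> primitive (as @ bs)}"
  proof (cases "K + (K + 2) \<ge> 82")
    case True
    then show ?thesis using none by simp
  next
    case False
    define n where "n = K + (K + 2)"
    have "n = 76 \<or> n = 77 \<or> n = 78 \<or> n = 79 \<or> n = 80 \<or> n = 81" "even n" using K False by (auto simp: n_def)
    then have n: "n \<in> {76, 78, 80}" by auto
    \<comment> \<open>Large enough that (1 - 1/T) * 12.0008 still exceeds 12.\<close>
    define T :: nat where "T = 20000"
    define B where "B = T ^ (n * T)"
    have bound: "x \<le> B" if r: "integral_factorial_ratio K (K + 2) as bs" and p: "primitive (as @ bs)"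
      and x: "x \<in> set (as @ bs)" for as bs x
    proof -
      let ?f = "signed_count as bs"
      have f: "admissible ?f" by (rule admissible_signed_count[OF r])
      have mass: "mass ?f = n" using mass_signed_count[OF r] by (simp add: n_def)
      have supp: "supp ?f = set (as @ bs)" using supp_signed_count[OF r] by simp
      have "tight T ?f"
      proof (rule ccontr)
        assume nt: "\<not> tight T ?f"
        have T1: "T \<ge> 1" by (simp add: T_def)
        obtain A where A: "mass (restr ?f A) > 0" "mass (restr ?f (-A)) > 0"
          "mass (restr ?f A) + mass (restr ?f (-A)) = mass ?f"
          "(1 - 1 / T) * (energy (restr ?f A) + energy (restr ?f (-A))) \<le> energy ?f"
          using not_tight_cut[OF f T1 nt] by metis
        have "12.0008 \<le> energy_bound (mass (restr ?f A)) + energy_bound (mass (restr ?f (-A)))"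
          using A n mass by (intro energy_bound_split) auto
        also have "\<dots> \<le> energy (restr ?f A) + energy (restr ?f (-A))"
          by (intro add_mono energy_ge_bound admissible_restr f)
        finally have "(1 - 1 / T) * 12.0008 \<le> (1 - 1 / T) * (energy (restr ?f A) + energy (restr ?f (-A)))"
          by (intro mult_left_mono) (simp_all add: T_def)
        then show False using A(4) le12[OF r] by (simp add: T_def)
      qed
      then have "x div Gcd (supp ?f) \<le> T ^ (mass ?f * T)"
        using f x supp by (intro tight_le) (auto simp: T_def)
      moreover have "Gcd (supp ?f) = 1" using p by (simp add: primitive_def supp)
      ultimately show ?thesis by (simp add: mass B_def)
    qed
    have "{(as, bs). integral_factorial_ratio K (K + 2) as bs \<and> primitive (as @ bs)}
        \<subseteq> {as. set as \<subseteq> {..B} \<and> length as = K} \<times> {bs. set bs \<subseteq> {..B} \<and> length bs = K + 2}"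
      using bound by (auto simp: integral_factorial_ratio_def subset_iff)
    moreover have "finite ({as. set as \<subseteq> {..B} \<and> length as = K} \<times> {bs. set bs \<subseteq> {..B} \<and> length bs = K + 2})"
      by (intro finite_cartesian_product finite_lists_length_eq) auto
    ultimately show ?thesis by (rule finite_subset)
  qed
qed

theorem theorem1p2:
  shows "(\<exists>\<epsilon> :: nat \<Rightarrow> real. \<epsilon> \<longlonglongrightarrow> 0 \<and>
            (\<forall>K D L as bs. K \<ge> 1 \<longrightarrow> D \<ge> 1 \<longrightarrow> L = K + D \<longrightarrow>
               integral_factorial_ratio K L as bs \<longrightarrow>
               real (K + L) \<le> (1 + \<epsilon> D) * (18 * exp (2 * euler_mascheroni) / pi\<^sup>2)
                               * (real D)\<^sup>2 * (ln (ln (real (D + 2))))\<^sup>2))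
       \<and> (\<forall>K D L. K \<ge> 1 \<longrightarrow> D \<ge> 1 \<longrightarrow> L = K + D \<longrightarrow>
            (\<exists>\<V> :: (nat \<Rightarrow>\<^sub>0 real) set set. finite \<V> \<and>
               (\<forall>V\<in>\<V>. subspace V \<and> V \<subseteq> coord_space (K + L) \<and> dim V \<le> 3 * D\<^sup>2 - 1) \<and>
               (\<forall>as bs. integral_factorial_ratio K L as bs \<longrightarrow> point_of (as @ bs) \<in> \<Union>\<V>)))
       \<and> (\<forall>K L. K \<ge> 1 \<longrightarrow> L = K + 2 \<longrightarrow>
            (K + L \<ge> 82 \<longrightarrow> \<not> (\<exists>as bs. integral_factorial_ratio K L as bs)) \<and>
            (K + L \<ge> 76 \<longrightarrow>
               finite {(as, bs). integral_factorial_ratio K L as bs \<and> primitive (as @ bs)}))"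
proof (intro conjI)
  show "\<exists>\<epsilon> :: nat \<Rightarrow> real. \<epsilon> \<longlonglongrightarrow> 0 \<and>
      (\<forall>K D L as bs. K \<ge> 1 \<longrightarrow> D \<ge> 1 \<longrightarrow> L = K + D \<longrightarrow>
         integral_factorial_ratio K L as bs \<longrightarrow>
         real (K + L) \<le> (1 + \<epsilon> D) * (18 * exp (2 * euler_mascheroni) / pi\<^sup>2)
                         * (real D)\<^sup>2 * (ln (ln (real (D + 2))))\<^sup>2)"
    by (rule part_one)
qed (use part_two part_three in blast)+

end
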